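(* Fix $\lambda>0$ and $z>0$. The completed filtration generated by $\xi^{\lambda,z}$, $\mathbb{F}^{\xi^{\lambda,z},c}$, is quasi-left-continuous.
   Context: Let $B=(B_t)_{t\ge 0}$ be a standard Brownian motion started at $0$ on a complete probability space $(\Omega,\mathcal{F},\mathbb{P})$, with $\mathcal{N}_{\mathbb{P}}$ the collection of $\mathbb{P}$-null sets. For $\lambda>0$, $z>0$, put $B^\lambda_t=B_t+\lambda t$, $\sigma_z^\lambda=\sup\{t>0: B^\lambda_t=z\}$ (almost surely finite), and $\xi^{\lambda,z}_t=B^\lambda_{t\wedge\sigma_z^\lambda}$, $t\ge 0$. The completed natural filtration is $\mathbb{F}^{\xi^{\lambda,z},c}$ with $\mathcal{F}^{\xi^{\lambda,z},c}_t=\sigma(\xi^{\lambda,z}_s,\,s\le t)\vee\mathcal{N}_{\mathbb{P}}$. A filtration $(\mathcal{G}_t)$ is quasi-left-continuous if $\mathcal{G}_{T-}=\mathcal{G}_T$ on $\{T<\infty\}$ for every predictable stopping time $T$ (equivalently, every accessible stopping time is predictable). *)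

theory Defs
  imports "HOL-Probability.Probability"
begin

text \<open>
  A process indexed by \<open>[0, \<infinity>)\<close> is a function \<open>real \<Rightarrow> 'a \<Rightarrow> real\<close> of which only the values at
  non-negative times are used. Path continuity and the start at 0 are required almost surely only.
  The second parameter of \<^const>\<open>normal_density\<close> is the standard deviation.
\<close>

definition brownian_motion :: "'a measure \<Rightarrow> (real \<Rightarrow> 'a \<Rightarrow> real) \<Rightarrow> bool" where
  "brownian_motion M B \<longleftrightarrow>
     prob_space M \<and>
     (\<forall>t\<ge>0. B t \<in> borel_measurable M) \<and>
     (AE \<omega> in M. B 0 \<omega> = 0) \<and>
     (\<forall>(n::nat) (t :: nat \<Rightarrow> real). 0 \<le> t 0 \<longrightarrow> (\<forall>i<n. t i < t (Suc i)) \<longrightarrow>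
        prob_space.indep_vars M (\<lambda>_. borel) (\<lambda>i \<omega>. B (t (Suc i)) \<omega> - B (t i) \<omega>) {..<n}) \<and>
     (\<forall>s t. 0 \<le> s \<longrightarrow> s < t \<longrightarrow>
        distributed M lborel (\<lambda>\<omega>. B t \<omega> - B s \<omega>) (\<lambda>x. ennreal (normal_density 0 (sqrt (t - s)) x))) \<and>
     (AE \<omega> in M. continuous_on {0..} (\<lambda>t. B t \<omega>))"

definition drifted :: "(real \<Rightarrow> 'a \<Rightarrow> real) \<Rightarrow> real \<Rightarrow> real \<Rightarrow> 'a \<Rightarrow> real" where
  "drifted B lam t \<omega> = B t \<omega> + lam * t"

text \<open>The supremum is taken in \<open>[0, \<infinity>]\<close>, so it is 0 if the level is never hit.\<close>

definition last_passage :: "(real \<Rightarrow> 'a \<Rightarrow> real) \<Rightarrow> real \<Rightarrow> 'a \<Rightarrow> ennreal" where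
  "last_passage X z \<omega> = (SUP t \<in> {t. 0 < t \<and> X t \<omega> = z}. ennreal t)"

definition stopped_at :: "(real \<Rightarrow> 'a \<Rightarrow> real) \<Rightarrow> ('a \<Rightarrow> ennreal) \<Rightarrow> real \<Rightarrow> 'a \<Rightarrow> real" where
  "stopped_at X \<sigma> t \<omega> = X (enn2real (min (ennreal t) (\<sigma> \<omega>))) \<omega>"

definition xi :: "(real \<Rightarrow> 'a \<Rightarrow> real) \<Rightarrow> real \<Rightarrow> real \<Rightarrow> real \<Rightarrow> 'a \<Rightarrow> real" where
  "xi B lam z = stopped_at (drifted B lam) (last_passage (drifted B lam) z)"

text \<open>
  Filtrations are indexed by \<^typ>\<open>ennreal\<close>, so that \<^const>\<open>stopping_time\<close> and
  \<^const>\<open>filtration.pre_sigma\<close> apply to times with values in \<open>[0, \<infinity>]\<close>. The value of the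
  filtration below at \<open>\<infinity>\<close> is the one generated by all the others.
\<close>

definition completed_natural_filtration ::
    "'a measure \<Rightarrow> (real \<Rightarrow> 'a \<Rightarrow> real) \<Rightarrow> ennreal \<Rightarrow> 'a measure" where
  "completed_natural_filtration M X t =
     sigma (space M)
       ({X s -` A \<inter> space M | s A. 0 \<le> s \<and> ennreal s \<le> t \<and> A \<in> sets borel} \<union> null_sets M)"

text \<open>The \<open>\<sigma>\<close>-algebra \<open>\<G>\<^bsub>T-\<^esub>\<close> of events strictly prior to \<open>T\<close>.\<close>

definition strict_pre_sigma ::
    "'a set \<Rightarrow> (ennreal \<Rightarrow> 'a measure) \<Rightarrow> ('a \<Rightarrow> ennreal) \<Rightarrow> 'a measure" where
  "strict_pre_sigma \<Omega> G T =
     sigma \<Omega> (sets (G 0) \<union> {{\<omega> \<in> A. t < T \<omega>} | A t. t < \<infinity> \<and> A \<in> sets (G t)})"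

text \<open>
  The announcing sequence is only required to work almost surely; strict inequality is not asked
  for on \<open>{T = 0}\<close>, in accordance with \<open>\<G>\<^bsub>0-\<^esub> = \<G>\<^bsub>0\<^esub>\<close>.
\<close>

definition predictable_time ::
    "'a measure \<Rightarrow> (ennreal \<Rightarrow> 'a measure) \<Rightarrow> ('a \<Rightarrow> ennreal) \<Rightarrow> bool" where
  "predictable_time M G T \<longleftrightarrow>
     stopping_time G T \<and>
     (\<exists>S :: nat \<Rightarrow> 'a \<Rightarrow> ennreal.
        (\<forall>n. stopping_time G (S n)) \<and>
        (AE \<omega> in M. incseq (\<lambda>n. S n \<omega>) \<and> (\<lambda>n. S n \<omega>) \<longlonglongrightarrow> T \<omega> \<and>
                    (0 < T \<omega> \<longrightarrow> (\<forall>n. S n \<omega> < T \<omega>))))"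

definition quasi_left_continuous :: "'a measure \<Rightarrow> (ennreal \<Rightarrow> 'a measure) \<Rightarrow> bool" where
  "quasi_left_continuous M G \<longleftrightarrow>
     filtration (space M) G \<and>
     (\<forall>T. predictable_time M G T \<longrightarrow>
        sets (restrict_space (strict_pre_sigma (space M) G T) {\<omega> \<in> space M. T \<omega> < \<infinity>}) =
        sets (restrict_space (filtration.pre_sigma (space M) G T) {\<omega> \<in> space M. T \<omega> < \<infinity>}))"

end

theory Submission
  imports Defs
begin

text \<open>
  Strictly before the last passage time \<open>\<sigma>\<close>, observing \<open>\<xi>\<close> is observing the Brownian path, and after
  \<open>\<sigma>\<close> there is nothing left to observe. So a stopping time \<open>T\<close> of the filtration of \<open>\<xi>\<close> agrees on
  \<open>{T < \<sigma>}\<close> with an optional time \<open>\<tau>\<close> of the Brownian filtration, and on \<open>{\<sigma> < T}\<close> every event is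
  decided before \<open>T\<close>.

  If \<open>T\<close> is predictable then \<open>{T = \<sigma>}\<close> is a null set: by the strong Markov property
  \<open>\<P>(\<tau> < \<sigma>) = \<E>[G(z - X\<^bsub>\<tau>\<^esub>)]\<close>, where \<open>X\<close> is the drifted motion and \<open>G\<close> is the distribution
  function of its overall infimum. This infimum has no atoms, so \<open>G\<close> is continuous, and for an
  announcing sequence the probabilities \<open>\<P>(\<tau>\<^sub>n < \<sigma> \<le> \<tau>)\<close> tend to 0.

  On \<open>{T < \<sigma>}\<close>, the strong Markov property shows that \<open>\<F>\<^bsub>\<tau>+\<^esub>\<close> is generated by \<open>\<tau>\<close>, the path stopped
  at \<open>\<tau>\<close> and the null sets. On this event these data are functionals of \<open>T\<close> and of values of \<open>\<xi>\<close> up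
  to \<open>T\<close>, which belong to \<open>\<G>\<^bsub>T-\<^esub>\<close> because \<open>\<xi>\<close> is left-continuous.
\<close>

subsection \<open>Completed natural filtrations\<close>

text \<open>The last passage time is not a stopping time of the Brownian filtration, while
  \<open>\<xi>\<close> reveals at each time whether it has occurred. A stopping time of
  \<open>F\<xi>\<close> therefore cannot be put into the strong Markov property directly, which is
  what forces its replacement by \<tau>. The replacement is an infimum over rational times, so only
  the events \<open>\<tau> < t\<close> are under control, and the Markov theory is developed for
  such optional times. Whether \<tau> precedes the last passage depends only on the position at
  \<tau> and the later increments: the infimum of the path after \<tau>, relative to its value at
  \<tau>, has to be at most \<open>z\<close> minus that value. This is exact except where the
  infimum is 0, so 0 must not be an atom either: Blumenthal's argument is for this level, a density
  argument for the negative ones. Almost sure properties of paths are made sure by changing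
  \<open>B\<close> on a null set. The completed filtration does not notice the change, and the last
  passage becomes a real time at which \<open>z\<close> is attained, for every point of the
  space.\<close>

lemma space_completed_natural_filtration [simp]:
  "space (completed_natural_filtration M X t) = space M"
  unfolding completed_natural_filtration_def
  by (rule space_measure_of) (auto dest: sets.sets_into_space[OF null_setsD2])

lemma sets_completed_natural_filtration:
  "sets (completed_natural_filtration M X t) =
     sigma_sets (space M)
       ({X s -` A \<inter> space M | s A. 0 \<le> s \<and> ennreal s \<le> t \<and> A \<in> sets borel} \<union> null_sets M)"
  unfolding completed_natural_filtration_def
  by (rule sets_measure_of) (auto dest: sets.sets_into_space[OF null_setsD2])

lemma filtration_completed_natural_filtration:
  "filtration (space M) (completed_natural_filtration M X)"
proof
  fix i j :: ennreal assume "i \<le> j"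
  then show "sets (completed_natural_filtration M X i) \<subseteq> sets (completed_natural_filtration M X j)"
    unfolding sets_completed_natural_filtration
    by (intro sigma_sets_mono') (auto intro: order_trans)
qed simp

lemma completed_natural_filtration_mono:
  "A \<in> sets (completed_natural_filtration M X i) \<Longrightarrow> i \<le> j \<Longrightarrow>
    A \<in> sets (completed_natural_filtration M X j)"
  using filtration.sets_F_mono[OF filtration_completed_natural_filtration] by blast

lemma measurable_completed_natural_filtration:
  assumes "0 \<le> s" "ennreal s \<le> t"
  shows "X s \<in> borel_measurable (completed_natural_filtration M X t)"
  using assms
  by (intro measurableI) (auto simp: sets_completed_natural_filtration intro!: sigma_sets.Basic)

lemma null_sets_completed_natural_filtration:
  "N \<in> null_sets M \<Longrightarrow> N \<in> sets (completed_natural_filtration M X t)"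
  by (auto simp: sets_completed_natural_filtration intro!: sigma_sets.Basic)

lemma sets_completed_natural_filtration_subset:
  assumes "\<And>s. 0 \<le> s \<Longrightarrow> X s \<in> borel_measurable M"
  shows "sets (completed_natural_filtration M X t) \<subseteq> sets M"
  unfolding sets_completed_natural_filtration
  by (rule sets.sigma_sets_subset) (use assms in \<open>auto intro: measurable_sets\<close>)

text \<open>Completeness makes the part of \<open>A'\<close> inside the exceptional null set null
  itself, hence a member of \<open>G\<close>; the rest is \<open>A\<close> minus a null set. Almost
  sure identities of events become membership in a sigma-algebra in this way.\<close>

lemma (in complete_measure) sets_AE_cong:
  assumes "null_sets M \<subseteq> sets G" "space G = space M" "A \<in> sets G" "A' \<subseteq> space M"
    and eq: "AE x in M. x \<in> A \<longleftrightarrow> x \<in> A'"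
  shows "A' \<in> sets G"
proof -
  from eq obtain N where N: "N \<in> null_sets M" "{x \<in> space M. \<not> (x \<in> A \<longleftrightarrow> x \<in> A')} \<subseteq> N"
    by (auto elim!: AE_E intro: null_setsI)
  have 1: "A' \<inter> N \<in> null_sets M"
    using complete2[of "A' \<inter> N" N] N by auto
  have 2: "A \<subseteq> space M"
    using sets.sets_into_space[OF assms(3)] assms(2) by simp
  have "A' = (A - N) \<union> (A' \<inter> N)"
    using N(2) 2 assms(4) by blast
  moreover have "\<dots> \<in> sets G"
    using assms(1,3) N(1) 1 by (intro sets.Un sets.Diff) auto
  ultimately show ?thesis by simp
qed

lemma (in complete_measure) sets_completed_natural_filtration_AE_cong:
  assumes "A \<in> sets (completed_natural_filtration M X t)" "A' \<subseteq> space M"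
    and "AE x in M. x \<in> A \<longleftrightarrow> x \<in> A'"
  shows "A' \<in> sets (completed_natural_filtration M X t)"
  using assms by (intro sets_AE_cong[OF _ _ assms(1)]) (auto intro: null_sets_completed_natural_filtration)

text \<open>This permits replacing \<open>B\<close> by a version whose every path is well behaved
  without changing the filtration.\<close>

lemma (in complete_measure) completed_natural_filtration_cong_AE:
  assumes "AE x in M. \<forall>t\<ge>0. X t x = Y t x"
  shows "completed_natural_filtration M X = completed_natural_filtration M Y"
proof -
  have *: "sets (completed_natural_filtration M X t) \<subseteq> sets (completed_natural_filtration M Y t)"
    if eq: "AE x in M. \<forall>t\<ge>0. X t x = Y t x" for X Y :: "real \<Rightarrow> 'a \<Rightarrow> real" and t
  proof -
    have "X s -` A \<inter> space M \<in> sets (completed_natural_filtration M Y t)"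
      if "0 \<le> s" "ennreal s \<le> t" "A \<in> sets borel" for s A
      by (rule sets_completed_natural_filtration_AE_cong[where A = "Y s -` A \<inter> space M"])
         (use that eq in \<open>auto simp: sets_completed_natural_filtration intro!: sigma_sets.Basic\<close>)
    then have "sigma_sets (space M) ({X s -` A \<inter> space M | s A. 0 \<le> s \<and> ennreal s \<le> t \<and> A \<in> sets borel} \<union> null_sets M)
        \<subseteq> sets (completed_natural_filtration M Y t)"
      unfolding space_completed_natural_filtration[of M Y t, symmetric]
      by (intro sets.sigma_sets_subset) (auto intro: null_sets_completed_natural_filtration)
    then show ?thesis
      by (simp add: sets_completed_natural_filtration)
  qed
  have "AE x in M. \<forall>t\<ge>0. Y t x = X t x"
    using assms by eventually_elim auto
  then have "sets (completed_natural_filtration M X t) = sets (completed_natural_filtration M Y t)" for t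
    using *[OF assms] * by (intro equalityI) auto
  then show ?thesis
    \<comment> \<open>The claim is equality of measures, not only of their sets; those built by
      \<open>sigma\<close> carry the zero measure.\<close>
    unfolding completed_natural_filtration_def
    by (intro ext measure_eqI) (auto simp: emeasure_sigma)
qed

subsection \<open>Processes with continuous paths at random times\<close>

text \<open>For \<open>x \<ge> 0\<close> this is the right end of the dyadic interval containing
  \<open>x\<close>, strictly above \<open>x\<close>. Strictness matters for optional times: where
  this value is \<open>t\<close> the time is \<open>< t\<close>, and such events are known at
  \<open>t\<close>.\<close>

definition dyadic_above :: "nat \<Rightarrow> real \<Rightarrow> real" where
  "dyadic_above n x = (real (nat \<lfloor>2^n * x\<rfloor>) + 1) / 2^n"

lemma dyadic_above_pos: "0 < dyadic_above n x"
  by (simp add: dyadic_above_def)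

lemma dyadic_above_eq_iff:
  assumes "0 \<le> x"
  shows "dyadic_above n x = (real k + 1) / 2^n \<longleftrightarrow> real k / 2^n \<le> x \<and> x < (real k + 1) / 2^n"
proof -
  have "dyadic_above n x = (real k + 1) / 2^n \<longleftrightarrow> nat \<lfloor>2^n * x\<rfloor> = k"
    by (simp add: dyadic_above_def)
  also have "\<dots> \<longleftrightarrow> \<lfloor>2^n * x\<rfloor> = int k"
    using assms by (auto simp: nat_eq_iff)
  also have "\<dots> \<longleftrightarrow> real k \<le> 2^n * x \<and> 2^n * x < real k + 1"
    by (simp add: floor_eq_iff)
  finally show ?thesis
    by (simp add: field_simps)
qed

lemma dyadic_above_bounds:
  assumes "0 \<le> x"
  shows "x < dyadic_above n x" "dyadic_above n x \<le> x + 1 / 2^n"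
proof -
  have "real (nat \<lfloor>2^n * x\<rfloor>) / 2^n \<le> x \<and> x < (real (nat \<lfloor>2^n * x\<rfloor>) + 1) / 2^n"
    using dyadic_above_eq_iff[OF assms, of n "nat \<lfloor>2^n * x\<rfloor>"] by (simp add: dyadic_above_def)
  then show "x < dyadic_above n x" "dyadic_above n x \<le> x + 1 / 2^n"
    by (auto simp: dyadic_above_def add_divide_distrib)
qed

lemma dyadic_above_LIMSEQ:
  assumes "0 \<le> x"
  shows "(\<lambda>n. dyadic_above n x) \<longlonglongrightarrow> x"
proof (rule tendsto_sandwich[where f = "\<lambda>_. x" and h = "\<lambda>n. x + (1/2)^n"])
  show "(\<lambda>n. x + (1/2)^n) \<longlonglongrightarrow> x"
    using tendsto_add[OF tendsto_const[of x] LIMSEQ_power_zero[of "1/2::real"]] by simp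
qed (use dyadic_above_bounds[OF assms] in \<open>auto simp: power_divide less_imp_le\<close>)

text \<open>The dyadic approximations of the random time take countably many values, and continuity
  passes to the limit. \<open>N\<close> is arbitrary, so the lemma also serves for small
  sigma-algebras such as \<open>F t\<close>.\<close>

lemma borel_measurable_at_random_time:
  fixes X :: "real \<Rightarrow> 'a \<Rightarrow> real"
  assumes [measurable]: "\<rho> \<in> borel_measurable N"
    and nonneg: "\<And>x. x \<in> space N \<Longrightarrow> 0 \<le> \<rho> x"
    and cont: "\<And>x. x \<in> space N \<Longrightarrow> continuous_on {0..} (\<lambda>t. X t x)"
    and X: "\<And>t. 0 \<le> t \<Longrightarrow> X t \<in> borel_measurable N"
  shows "(\<lambda>x. X (\<rho> x) x) \<in> borel_measurable N"
proof (rule borel_measurable_LIMSEQ_real)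
  fix x assume x: "x \<in> space N"
  show "(\<lambda>n. X (dyadic_above n (\<rho> x)) x) \<longlonglongrightarrow> X (\<rho> x) x"
    by (rule continuous_on_tendsto_compose[OF cont[OF x] dyadic_above_LIMSEQ])
       (use nonneg[OF x] dyadic_above_pos in \<open>auto simp: less_imp_le\<close>)
next
  fix n
  have "(\<lambda>x. (\<lambda>k x. X ((real k + 1) / 2^n) x) (nat \<lfloor>2^n * \<rho> x\<rfloor>) x) \<in> borel_measurable N"
    by (rule measurable_compose_countable) (auto intro!: X)
  then show "(\<lambda>x. X (dyadic_above n (\<rho> x)) x) \<in> borel_measurable N"
    by (simp add: dyadic_above_def)
qed

lemma continuous_on_path_min:
  assumes "continuous_on {0..} (f :: real \<Rightarrow> real)" "0 \<le> t"
  shows "continuous_on {0..} (\<lambda>s. f (min s t))"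
  by (rule continuous_on_compose2[OF assms(1)]) (use assms(2) in \<open>auto intro!: continuous_intros\<close>)

subsection \<open>Measures on path space\<close>

abbreviation paths :: "(real \<Rightarrow> real) measure" where
  "paths \<equiv> Pi\<^sub>M UNIV (\<lambda>_. borel)"

text \<open>A pi-system generating the product sigma-algebra; the values of a measure on it are the
  finite-dimensional distribution functions. The empty \<open>J\<close> gives the whole
  space.\<close>

definition half_boxes :: "(real \<Rightarrow> real) set set" where
  "half_boxes = {{w. \<forall>u\<in>J. w u \<le> a u} | J a. finite J}"

lemma Int_stable_half_boxes: "Int_stable half_boxes"
proof (rule Int_stableI)
  fix P Q assume "P \<in> half_boxes" "Q \<in> half_boxes"
  then obtain J a K b where *: "finite J" "finite K"
      "P = {w. \<forall>u\<in>J. w u \<le> a u}" "Q = {w. \<forall>u\<in>K. w u \<le> b u}"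
    by (auto simp: half_boxes_def)
  define c where "c u = (if u \<in> J \<and> u \<in> K then min (a u) (b u) else if u \<in> J then a u else b u)" for u
  have "P \<inter> Q = {w. \<forall>u\<in>J\<union>K. w u \<le> c u}"
    unfolding * c_def by (auto split: if_splits)
  then show "P \<inter> Q \<in> half_boxes"
    using * by (auto simp: half_boxes_def)
qed

lemma space_paths [simp]: "space paths = UNIV"
  by (simp add: space_PiM)

lemma sets_paths: "sets paths = sigma_sets UNIV half_boxes"
proof
  have [simp]: "space (sigma UNIV half_boxes) = UNIV" "sets (sigma UNIV half_boxes) = sigma_sets UNIV half_boxes"
    by (auto intro!: space_measure_of sets_measure_of)
  have "(\<lambda>w. w u) \<in> borel_measurable (sigma UNIV half_boxes)" for u
  proof (rule borel_measurableI_le)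
    fix y :: real
    have "{w. w u \<le> y} \<in> half_boxes"
      unfolding half_boxes_def by (intro CollectI exI[of _ "{u}"] exI[of _ "\<lambda>_. y"]) auto
    then show "{w \<in> space (sigma UNIV half_boxes). w u \<le> y} \<in> sets (sigma UNIV half_boxes)"
      by (auto intro: sigma_sets.Basic)
  qed
  from measurable_sets[OF this]
  have "sets paths \<subseteq> sets (sigma UNIV half_boxes)"
    by (intro sets_PiM_in_sets) (auto simp: vimage_def)
  then show "sets paths \<subseteq> sigma_sets UNIV half_boxes" by simp
  have "half_boxes \<subseteq> sets paths"
  proof
    fix P assume "P \<in> half_boxes"
    then obtain J a where P: "finite J" "P = {w \<in> space paths. \<forall>u\<in>J. w u \<le> a u}"
      by (auto simp: half_boxes_def)
    show "P \<in> sets paths"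
      unfolding P by (intro sets.sets_Collect_finite_All P) measurable
  qed
  then show "sigma_sets UNIV half_boxes \<subseteq> sets paths"
    using sets.sigma_sets_subset[of half_boxes paths] by simp
qed

lemma half_boxes_measurable [intro]: "P \<in> half_boxes \<Longrightarrow> P \<in> sets paths"
  by (simp add: sets_paths sigma_sets.Basic)

lemma path_measure_eqI:
  assumes "sets P = sets paths" "sets Q = sets paths" "finite_measure P"
    and "\<And>J a. finite J \<Longrightarrow> emeasure P {w. \<forall>u\<in>J. w u \<le> a u} = emeasure Q {w. \<forall>u\<in>J. w u \<le> a u}"
  shows "P = Q"
proof (rule measure_eqI_generator_eq[OF Int_stable_half_boxes, of UNIV P Q "\<lambda>_. UNIV"])
  interpret finite_measure P by fact
  show "\<And>i::nat. emeasure P UNIV \<noteq> \<infinity>" by simp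
  have "{w. \<forall>u\<in>{}. w u \<le> (\<lambda>_. 0::real) u} \<in> half_boxes"
    unfolding half_boxes_def by blast
  then show "range (\<lambda>_::nat. UNIV) \<subseteq> half_boxes" by simp
qed (use assms in \<open>auto simp: sets_paths half_boxes_def\<close>)

section \<open>Limits of distributions on path space\<close>

text \<open>For \<open>m > 0\<close> a piecewise linear cut-off, falling from 1 at \<open>a\<close>
  to 0 at \<open>a + 1/m\<close>: a continuous substitute for the indicator of
  \<open>{..a}\<close>.\<close>

definition ramp :: "real \<Rightarrow> nat \<Rightarrow> real \<Rightarrow> real" where
  "ramp a m x = max 0 (min 1 (1 - real m * (x - a)))"

lemma ramp_bounds: "0 \<le> ramp a m x" "ramp a m x \<le> 1"
  by (auto simp: ramp_def)

lemma ramp_LIMSEQ: "(\<lambda>m. ramp a m x) \<longlonglongrightarrow> indicator {..a} x"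
proof (cases "x \<le> a")
  case True
  then have "ramp a m x = 1" for m
    by (simp add: ramp_def mult_nonneg_nonpos)
  with True show ?thesis by simp
next
  case False
  then obtain m0 :: nat where m0: "1 / (x - a) < real m0"
    using reals_Archimedean2 by blast
  have "eventually (\<lambda>m. ramp a m x = 0) sequentially"
    using eventually_ge_at_top[of m0]
  proof eventually_elim
    case (elim m)
    have "1 < real m0 * (x - a)" using m0 False by (simp add: field_simps)
    also have "\<dots> \<le> real m * (x - a)" using elim False by (intro mult_right_mono) auto
    finally show ?case by (simp add: ramp_def)
  qed
  with False show ?thesis
    by (auto simp: tendsto_eventually)
qed

lemma indicator_half_box:
  assumes "finite J"
  shows "(\<Prod>u\<in>J. indicator {..a u} (w u) :: real) = indicator {w. \<forall>u\<in>J. w u \<le> a u} w"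
  using assms by (induction J) (auto simp: indicator_def)

lemma continuous_ramp: "continuous_on UNIV (ramp a m)"
  unfolding ramp_def by (intro continuous_intros)

lemma ramp_measurable [measurable]: "ramp a m \<in> borel_measurable borel"
  by (intro borel_measurable_continuous_onI continuous_ramp)

lemma prod_ramp_bounds: "finite J \<Longrightarrow> norm (\<Prod>u\<in>J. ramp (a u) m (w u)) \<le> 1"
  unfolding real_norm_def abs_prod by (rule prod_le_1) (use ramp_bounds in \<open>auto simp: abs_le_iff intro: order_trans[of _ 0]\<close>)

text \<open>Indicators of half boxes are not continuous in the path, so the convergence of
  \<open>V n\<close> is tested with products of ramps. Dominated convergence is used twice: in
  \<open>n\<close> for a fixed ramp, and afterwards in the steepness \<open>m\<close> on both
  sides.\<close>

lemma path_distr_limit: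
  assumes "finite_measure N"
    and V[measurable]: "\<And>n. V n \<in> measurable N paths" and W[measurable]: "W \<in> measurable N paths"
    and lim: "\<And>x u. x \<in> space N \<Longrightarrow> (\<lambda>n. V n x u) \<longlonglongrightarrow> W x u"
    and L: "\<And>n. distr N paths (V n) = L"
  shows "distr N paths W = L"
proof (rule path_measure_eqI)
  interpret N: finite_measure N by fact
  show "finite_measure (distr N paths W)"
    by (rule N.finite_measure_distr) measurable
  have sets_L [measurable_cong]: "sets L = sets paths"
    using L[of 0] by (metis sets_distr)
  interpret L: finite_measure L
    using L[of 0] N.finite_measure_distr[OF V] by metis
  show "sets (distr N paths W) = sets paths" by simp
  show "sets L = sets paths" by fact
  fix J :: "real set" and a assume J: "finite J"
  let ?P = "{w :: real \<Rightarrow> real. \<forall>u\<in>J. w u \<le> a u}"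
  have P [measurable]: "?P \<in> sets paths"
    using J by (intro half_boxes_measurable) (auto simp: half_boxes_def)
  have space_L: "space L = UNIV" using sets_eq_imp_space_eq[OF sets_L] by simp
  define f where "f m w = (\<Prod>u\<in>J. ramp (a u) m (w u))" for m and w :: "real \<Rightarrow> real"
  have f_meas [measurable]: "f m \<in> borel_measurable paths" for m
    unfolding f_def by measurable
  have f_bd: "norm (f m w) \<le> 1" "\<bar>f m w\<bar> \<le> 1" for m w
    using prod_ramp_bounds[OF J] by (auto simp: f_def)
  have f_lim: "(\<lambda>m. f m w) \<longlonglongrightarrow> indicator ?P w" for w
    unfolding f_def indicator_half_box[OF J, symmetric] by (intro tendsto_prod ramp_LIMSEQ)
  have eq: "(\<integral>x. f m (W x) \<partial>N) = (\<integral>w. f m w \<partial>L)" for m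
  proof -
    have "(\<lambda>n. \<integral>x. f m (V n x) \<partial>N) \<longlonglongrightarrow> (\<integral>x. f m (W x) \<partial>N)"
    proof (rule integral_dominated_convergence[where w = "\<lambda>_. 1"])
      show "AE x in N. (\<lambda>n. f m (V n x)) \<longlonglongrightarrow> f m (W x)"
        unfolding f_def
        by (intro AE_I2 tendsto_prod continuous_on_tendsto_compose[OF continuous_ramp] lim) auto
    qed (auto intro!: f_bd AE_I2)
    moreover have "(\<integral>x. f m (V n x) \<partial>N) = (\<integral>w. f m w \<partial>L)" for n
      unfolding L[of n, symmetric] by (subst integral_distr) auto
    ultimately show ?thesis
      by (simp add: LIMSEQ_const_iff)
  qed
  have "(\<lambda>m. \<integral>x. f m (W x) \<partial>N) \<longlonglongrightarrow> (\<integral>x. indicator ?P (W x) \<partial>N)"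
    by (rule integral_dominated_convergence[where w = "\<lambda>_. 1"]) (auto intro!: f_bd f_lim AE_I2)
  moreover have "(\<lambda>m. \<integral>w. f m w \<partial>L) \<longlonglongrightarrow> (\<integral>w. indicator ?P w \<partial>L)"
    by (rule integral_dominated_convergence[where w = "\<lambda>_. 1"]) (auto intro!: f_bd f_lim AE_I2)
  ultimately have "(\<integral>x. indicator ?P (W x) \<partial>N) = (\<integral>w. indicator ?P w \<partial>L :: real)"
    unfolding eq using LIMSEQ_unique by blast
  moreover have "(\<integral>x. indicator ?P (W x) \<partial>N) = (\<integral>w. indicator ?P w \<partial>distr N paths W :: real)"
    by (subst integral_distr) auto
  ultimately have "measure (distr N paths W) ?P = measure L ?P"
    by (simp add: space_L)
  then show "emeasure (distr N paths W) ?P = emeasure L ?P"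
    using L.emeasure_eq_measure finite_measure.emeasure_eq_measure[OF \<open>finite_measure (distr N paths W)\<close>]
    by metis
qed

subsection \<open>The Markov property of Brownian motion\<close>

lemma grid_mono:
  fixes t :: "nat \<Rightarrow> real"
  assumes "\<forall>i<n. t i < t (Suc i)" "i < j" "j \<le> n"
  shows "t i < t j"
  using assms(2,3)
proof (induction j)
  case (Suc j)
  then show ?case using assms(1) by (cases "i = j") (auto intro: less_trans)
qed simp

lemma grid_nonneg:
  fixes t :: "nat \<Rightarrow> real"
  assumes "0 \<le> t 0" "\<forall>i<n. t i < t (Suc i)" "i \<le> n"
  shows "0 \<le> t i"
  using grid_mono[OF assms(2), of 0 i] assms by (cases "i = 0") auto

lemma finite_set_grid:
  fixes S :: "real set"
  assumes "finite S" "S \<noteq> {}"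
  obtains t :: "nat \<Rightarrow> real" and n where "\<forall>i<n. t i < t (Suc i)" "t ` {..n} = S"
proof
  let ?xs = "sorted_list_of_set S"
  have len: "length ?xs = card S" "card S \<noteq> 0" using assms by auto
  show "\<forall>i<card S - 1. ?xs ! i < ?xs ! Suc i"
    using sorted_wrt_nth_less[OF strict_sorted_list_of_set[of S]] len by simp
  have "{..card S - 1} = {..<length ?xs}" using len by auto
  then have "(!) ?xs ` {..card S - 1} = set ?xs"
    using nth_image[of "length ?xs" ?xs] by (simp only: atLeast0LessThan take_all le_refl)
  then show "(!) ?xs ` {..card S - 1} = S" using assms by simp
qed

text \<open>Independence is transferred through laws: for a nonempty index set it says that the
  joint law is the product of the marginal laws, and laws are insensitive to null sets. The empty
  index set is treated apart.\<close>

lemma brownian_motion_cong_AE: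
  fixes B :: "real \<Rightarrow> 'a \<Rightarrow> real"
  assumes bm: "brownian_motion M B" and B': "\<And>t. 0 \<le> t \<Longrightarrow> B' t \<in> borel_measurable M"
    and eq: "AE x in M. \<forall>t\<ge>0. B' t x = B t x"
  shows "brownian_motion M B'"
proof -
  interpret prob_space M using bm by (simp add: brownian_motion_def)
  have B: "B t \<in> borel_measurable M" if "0 \<le> t" for t
    using bm that by (simp add: brownian_motion_def)
  have diff: "AE x in M. B t x - B s x = B' t x - B' s x" if "0 \<le> s" "0 \<le> t" for s t
    using eq by eventually_elim (use that in auto)
  have indep: "indep_vars (\<lambda>_. borel) (\<lambda>i x. B' (t (Suc i)) x - B' (t i) x) {..<n}"
    if t: "0 \<le> t 0" "\<forall>i<n. t i < t (Suc i)" for n and t :: "nat \<Rightarrow> real"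
  proof (cases "n = 0")
    case True
    then show ?thesis by (simp add: indep_vars_def2 indep_sets_def)
  next
    case False
    then have ne: "{..<n} \<noteq> {}" by auto
    have t0: "0 \<le> t i" if "i \<le> n" for i using grid_nonneg[OF t that] .
    have rv: "(\<lambda>x. B (t (Suc i)) x - B (t i) x) \<in> borel_measurable M"
       "(\<lambda>x. B' (t (Suc i)) x - B' (t i) x) \<in> borel_measurable M" if "i \<in> {..<n}" for i
      using that by (auto intro!: borel_measurable_diff B B' t0)
    have ae: "AE x in M. \<forall>i\<in>{..<n}. B (t (Suc i)) x - B (t i) x = B' (t (Suc i)) x - B' (t i) x"
      using eq by eventually_elim (use t0 in auto)
    have "indep_vars (\<lambda>_. borel) (\<lambda>i x. B (t (Suc i)) x - B (t i) x) {..<n}"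
      using bm t by (simp add: brownian_motion_def)
    then have "distr M (\<Pi>\<^sub>M i\<in>{..<n}. borel) (\<lambda>x. \<lambda>i\<in>{..<n}. B (t (Suc i)) x - B (t i) x) =
        (\<Pi>\<^sub>M i\<in>{..<n}. distr M borel (\<lambda>x. B (t (Suc i)) x - B (t i) x))"
      by (subst (asm) indep_vars_iff_distr_eq_PiM'[OF ne rv(1)])
    also have "distr M (\<Pi>\<^sub>M i\<in>{..<n}. borel) (\<lambda>x. \<lambda>i\<in>{..<n}. B (t (Suc i)) x - B (t i) x) =
        distr M (\<Pi>\<^sub>M i\<in>{..<n}. borel) (\<lambda>x. \<lambda>i\<in>{..<n}. B' (t (Suc i)) x - B' (t i) x)"
    proof (rule distr_cong_AE)
      show "AE x in M. (\<lambda>i\<in>{..<n}. B (t (Suc i)) x - B (t i) x) = (\<lambda>i\<in>{..<n}. B' (t (Suc i)) x - B' (t i) x)"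
        using ae by eventually_elim auto
    qed (auto intro!: measurable_restrict rv)
    also have "(\<Pi>\<^sub>M i\<in>{..<n}. distr M borel (\<lambda>x. B (t (Suc i)) x - B (t i) x)) =
        (\<Pi>\<^sub>M i\<in>{..<n}. distr M borel (\<lambda>x. B' (t (Suc i)) x - B' (t i) x))"
      by (intro PiM_cong refl distr_cong_AE diff t0 rv) auto
    finally show ?thesis
      by (subst indep_vars_iff_distr_eq_PiM'[OF ne rv(2)])
  qed
  have distr: "distributed M lborel (\<lambda>x. B' t x - B' s x) (\<lambda>y. ennreal (normal_density 0 (sqrt (t - s)) y))"
    if "0 \<le> s" "s < t" for s t
  proof -
    have D: "distributed M lborel (\<lambda>x. B t x - B s x) (\<lambda>y. ennreal (normal_density 0 (sqrt (t - s)) y))"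
      using bm that by (simp add: brownian_motion_def)
    have "distr M lborel (\<lambda>x. B t x - B s x) = distr M lborel (\<lambda>x. B' t x - B' s x)"
      by (intro distr_cong_AE diff) (use that in \<open>auto intro!: borel_measurable_diff B B'\<close>)
    then show ?thesis
      using D that by (auto simp: distributed_def intro!: borel_measurable_diff B')
  qed
  have ae: "AE x in M. B 0 x = 0" "AE x in M. continuous_on {0..} (\<lambda>t. B t x)"
    using bm by (simp_all add: brownian_motion_def)
  have "AE x in M. B' 0 x = 0"
    using ae(1) eq by eventually_elim simp
  moreover have "AE x in M. continuous_on {0..} (\<lambda>t. B' t x)"
    using ae(2) eq
  proof eventually_elim
    case (elim x)
    then show ?case
      using continuous_on_cong[of "{0..}" "{0..}" "\<lambda>t. B t x" "\<lambda>t. B' t x"] by simp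
  qed
  ultimately show ?thesis
    unfolding brownian_motion_def using indep distr B' prob_space_axioms by auto
qed

locale continuous_brownian = prob_space M + complete_measure M
  for M :: "'a measure" and B :: "real \<Rightarrow> 'a \<Rightarrow> real" +
  assumes brownian: "brownian_motion M B"
    and continuous_B: "x \<in> space M \<Longrightarrow> continuous_on {0..} (\<lambda>t. B t x)"
    and B_0: "x \<in> space M \<Longrightarrow> B 0 x = 0"
begin

abbreviation F :: "real \<Rightarrow> 'a measure" where
  "F t \<equiv> completed_natural_filtration M B (ennreal t)"

text \<open>The absolute value makes paths total functions on the reals, only times \<open>u \<ge> 0\<close> matter.\<close>

definition path :: "real \<Rightarrow> 'a \<Rightarrow> real \<Rightarrow> real" where
  "path r x u = B (r + \<bar>u\<bar>) x - B r x"

text \<open>Wiener measure, carried by functions that are even in \<open>u\<close> because of the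
  absolute value.\<close>

definition law :: "(real \<Rightarrow> real) measure" where
  "law = distr M paths (path 0)"

lemma B_measurable: "0 \<le> t \<Longrightarrow> B t \<in> borel_measurable M"
  using brownian by (simp add: brownian_motion_def)

lemma sets_F_subset: "A \<in> sets (completed_natural_filtration M B t) \<Longrightarrow> A \<in> sets M"
  by (rule subsetD[OF sets_completed_natural_filtration_subset]) (rule B_measurable)

lemma measurable_F_imp:
  "f \<in> measurable (completed_natural_filtration M B t) N \<Longrightarrow> f \<in> measurable M N"
  using measurable_mono[of N N "completed_natural_filtration M B t" M]
    sets_F_subset by auto

lemma path_measurable:
  assumes "\<rho> \<in> borel_measurable M" "\<And>x. x \<in> space M \<Longrightarrow> 0 \<le> \<rho> x"
  shows "(\<lambda>x. path (\<rho> x) x) \<in> measurable M paths"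
proof -
  have 1: "(\<lambda>x. B (\<rho> x + \<bar>u\<bar>) x) \<in> borel_measurable M" for u
  proof (rule borel_measurable_at_random_time[where X = B and \<rho> = "\<lambda>x. \<rho> x + \<bar>u\<bar>"])
    show "(\<lambda>x. \<rho> x + \<bar>u\<bar>) \<in> borel_measurable M" using assms(1) by measurable
  qed (use assms(2) in \<open>auto intro: continuous_B B_measurable\<close>)
  have 2: "(\<lambda>x. B (\<rho> x) x) \<in> borel_measurable M"
    using 1[of 0] by simp
  show ?thesis
    unfolding path_def[abs_def]
    by (rule measurable_PiM_single') (use borel_measurable_diff[OF 1 2] in auto)
qed

lemma path_measurable_const: "0 \<le> r \<Longrightarrow> path r \<in> measurable M paths"
  using path_measurable[of "\<lambda>_. r"] by simp

lemma sets_law [simp, measurable_cong]: "sets law = sets paths"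
  by (simp add: law_def)

lemma space_law [simp]: "space law = UNIV"
  by (simp add: law_def)

lemma prob_space_law: "prob_space law"
  unfolding law_def by (intro prob_space_distr path_measurable_const) simp

lemma measure_law: "G \<in> sets paths \<Longrightarrow> measure law G = prob {x \<in> space M. path 0 x \<in> G}"
  unfolding law_def
  by (subst measure_distr) (auto intro!: path_measurable_const arg_cong[where f = prob])

section \<open>Independence of past and future at a fixed time\<close>

lemma increments_indep:
  assumes "0 \<le> t 0" "\<forall>i<n. t i < t (Suc i)"
  shows "indep_vars (\<lambda>_. borel) (\<lambda>i x. B (t (Suc i)) x - B (t i) x) {..<n::nat}"
  using brownian assms by (simp add: brownian_motion_def)

lemma increment_distr:
  assumes "0 \<le> s" "s < t"
  shows "distr M borel (\<lambda>x. B t x - B s x) = density lborel (normal_density 0 (sqrt (t - s)))"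
proof -
  have "distributed M lborel (\<lambda>x. B t x - B s x) (\<lambda>y. ennreal (normal_density 0 (sqrt (t - s)) y))"
    using brownian assms by (simp add: brownian_motion_def)
  then show ?thesis
    by (simp add: distributed_def cong: distr_cong)
qed

lemma increments_law:
  assumes t: "0 \<le> t 0" "\<forall>i<n. t i < t (Suc i)" and n: "n \<noteq> 0"
  shows "distr M (\<Pi>\<^sub>M i\<in>{..<n}. borel) (\<lambda>x. \<lambda>i\<in>{..<n}. B (t (Suc i)) x - B (t i) x) =
    (\<Pi>\<^sub>M i\<in>{..<n}. density lborel (normal_density 0 (sqrt (t (Suc i) - t i))))"
proof -
  have t0: "0 \<le> t i" if "i \<le> n" for i using grid_nonneg[OF t that] .
  have ne: "{..<n} \<noteq> {}" using n by auto
  have rv: "(\<lambda>x. B (t (Suc i)) x - B (t i) x) \<in> borel_measurable M" if "i \<in> {..<n}" for i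
    using that by (auto intro!: borel_measurable_diff B_measurable t0)
  have "distr M (\<Pi>\<^sub>M i\<in>{..<n}. borel) (\<lambda>x. \<lambda>i\<in>{..<n}. B (t (Suc i)) x - B (t i) x) =
        (\<Pi>\<^sub>M i\<in>{..<n}. distr M borel (\<lambda>x. B (t (Suc i)) x - B (t i) x))"
    using increments_indep[OF t] by (subst (asm) indep_vars_iff_distr_eq_PiM'[OF ne rv])
  also have "\<dots> = (\<Pi>\<^sub>M i\<in>{..<n}. density lborel (normal_density 0 (sqrt (t (Suc i) - t i))))"
    by (intro PiM_cong refl increment_distr) (use t t0 in auto)
  finally show ?thesis .
qed

text \<open>All times involved are put on one grid. Past values are sums of increments before
  \<open>q\<close>, future ones of increments after \<open>q\<close>, so they come from disjoint
  independent blocks. The future block has the law of the same grid moved back to 0, because the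
  normal laws depend on time differences only.\<close>

lemma markov_boxes:
  assumes q: "0 \<le> q" and J: "finite J" "J \<subseteq> {0..q}" and K: "finite K"
    and A: "\<And>s. s \<in> J \<Longrightarrow> A s \<in> sets borel"
  shows "prob {x \<in> space M. (\<forall>s\<in>J. B s x \<in> A s) \<and> (\<forall>u\<in>K. path q x u \<le> b u)} =
    prob {x \<in> space M. \<forall>s\<in>J. B s x \<in> A s} * prob {x \<in> space M. \<forall>u\<in>K. path 0 x u \<le> b u}"
proof -
  \<comment> \<open>Time 0 anchors the past sums at \<open>B 0 = 0\<close>; \<open>q + 1\<close>
    guarantees a grid point beyond \<open>q\<close>, so the block of future increments is
    nonempty.\<close>
  define S where "S = insert 0 (insert q (insert (q + 1) (J \<union> (\<lambda>u. q + \<bar>u\<bar>) ` K)))"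
  have S: "finite S" "S \<noteq> {}" "S \<subseteq> {0..}" "q \<in> S" "q + 1 \<in> S" "0 \<in> S"
    using J K q by (auto simp: S_def)
  obtain t :: "nat \<Rightarrow> real" and n where t: "\<forall>i<n. t i < t (Suc i)" and tS: "t ` {..n} = S"
    using finite_set_grid[OF S(1,2)] by blast
  have mono: "t i < t j" if "i < j" "j \<le> n" for i j using grid_mono[OF t that] .
  have nonneg: "0 \<le> t i" if "i \<le> n" for i using tS S(3) that by force
  define idx where "idx s = (SOME i. i \<le> n \<and> t i = s)" for s
  have idx: "idx s \<le> n \<and> t (idx s) = s" if "s \<in> S" for s
    unfolding idx_def by (rule someI_ex) (use tS that in auto)
  have idx_le: "idx s \<le> idx s'" if "s \<in> S" "s' \<in> S" "s \<le> s'" for s s'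
    using idx[OF that(1)] idx[OF that(2)] mono[of "idx s'" "idx s"] that(3) by force
  have "t (idx 0) = 0" "idx 0 \<le> n" using idx S by auto
  then have t0: "t 0 = 0" using nonneg[of 0] mono[of 0 "idx 0"] by force
  define a where "a = idx q"
  have a: "a \<le> n" "t a = q" using idx S by (auto simp: a_def)
  have "a \<noteq> n" using idx[OF S(5)] a mono[of "idx (q + 1)" n] by force
  then have an: "a < n" using a by simp
  define m where "m = n - a"
  define inc where "inc i x = B (t (Suc i)) x - B (t i) x" for i x
  \<comment> \<open>Increments over the future part of the grid moved back by \<open>q\<close>, so
    that it starts at time 0.\<close>
  define inc' where "inc' i x = B (t (Suc (a + i)) - q) x - B (t (a + i) - q) x" for i x
  have tele: "(\<Sum>k\<in>{i..<j}. inc k x) = B (t j) x - B (t i) x" if "i \<le> j" for i j x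
    unfolding inc_def using that by (rule sum_Suc_diff')
  have past: "B s x = (\<Sum>k\<in>{0..<idx s}. inc k x)" if "s \<in> J" "x \<in> space M" for s x
    using tele[of 0 "idx s"] idx[of s] that t0 B_0 by (simp add: S_def)
  have idx_past: "idx s \<le> a" if "s \<in> J" for s
    unfolding a_def using that J by (intro idx_le) (auto simp: S_def)
  have idx_fut: "a \<le> idx (q + \<bar>u\<bar>)" if "u \<in> K" for u
    unfolding a_def using that by (intro idx_le) (auto simp: S_def)
  have fut: "path q x u = (\<Sum>k\<in>{0..<idx (q + \<bar>u\<bar>) - a}. inc (a + k) x)" if "u \<in> K" for u x
  proof -
    have "path q x u = (\<Sum>k\<in>{a..<idx (q + \<bar>u\<bar>)}. inc k x)"
      using tele[OF idx_fut[OF that]] idx[of "q + \<bar>u\<bar>"] a that by (simp add: S_def path_def)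
    also have "\<dots> = (\<Sum>k\<in>{0..<idx (q + \<bar>u\<bar>) - a}. inc (a + k) x)"
      using sum.shift_bounds_nat_ivl[of "\<lambda>k. inc k x" 0 a "idx (q + \<bar>u\<bar>) - a"] idx_fut[OF that]
      by (simp add: add.commute)
    finally show ?thesis .
  qed
  have tele': "(\<Sum>k\<in>{0..<j}. inc' k x) = B (t (a + j) - q) x - B (t a - q) x" for j x
    unfolding inc'_def using sum_Suc_diff'[of 0 j "\<lambda>k. B (t (a + k) - q) x"] by simp
  have fut': "path 0 x u = (\<Sum>k\<in>{0..<idx (q + \<bar>u\<bar>) - a}. inc' k x)" if "u \<in> K" "x \<in> space M" for u x
    using tele'[of x "idx (q + \<bar>u\<bar>) - a"] idx_fut[OF that(1)] idx[of "q + \<bar>u\<bar>"] a that(1)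
      B_0[OF that(2)]
    by (simp add: S_def path_def)
  define G1 where "G1 = {y \<in> space (\<Pi>\<^sub>M i\<in>{..<a}. borel :: real measure). \<forall>s\<in>J. (\<Sum>k\<in>{0..<idx s}. y k) \<in> A s}"
  have G1: "G1 \<in> sets (\<Pi>\<^sub>M i\<in>{..<a}. borel)"
    unfolding G1_def
  proof (intro sets.sets_Collect_finite_All J)
    fix s assume s: "s \<in> J"
    have "(\<lambda>y. \<Sum>k\<in>{0..<idx s}. y k) \<in> borel_measurable (\<Pi>\<^sub>M i\<in>{..<a}. borel :: real measure)"
      by (intro borel_measurable_sum measurable_component_singleton) (use idx_past[OF s] in auto)
    from measurable_sets[OF this A[OF s]]
    show "{y \<in> space (\<Pi>\<^sub>M i\<in>{..<a}. borel). (\<Sum>k = 0..<idx s. y k) \<in> A s} \<in> sets (\<Pi>\<^sub>M i\<in>{..<a}. borel)"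
      by (simp add: vimage_def Int_def conj_commute)
  qed
  \<comment> \<open>The offset \<open>c\<close> lets one condition serve two indexings:
    \<open>{a..<n}\<close>, where independence of the past is available, and \<open>{..<m}\<close>,
    where the laws of \<open>inc\<close> and \<open>inc'\<close> are compared.\<close>
  define H where "H I c = {y \<in> space (\<Pi>\<^sub>M i\<in>I. borel :: real measure). \<forall>u\<in>K. (\<Sum>k\<in>{0..<idx (q + \<bar>u\<bar>) - a}. y (c + k)) \<le> b u}" for I :: "nat set" and c
  have H: "H I c \<in> sets (\<Pi>\<^sub>M i\<in>I. borel)" if I: "{c..<c+m} \<subseteq> I" for I c
    unfolding H_def
  proof (intro sets.sets_Collect_finite_All K)
    fix u assume u: "u \<in> K"
    have "idx (q + \<bar>u\<bar>) \<le> n" using idx[of "q + \<bar>u\<bar>"] u by (simp add: S_def)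
    then have "(\<lambda>y. \<Sum>k\<in>{0..<idx (q + \<bar>u\<bar>) - a}. y (c + k)) \<in> borel_measurable (\<Pi>\<^sub>M i\<in>I. borel :: real measure)"
      by (intro borel_measurable_sum measurable_component_singleton) (use I m_def in \<open>auto simp: subset_iff\<close>)
    then show "{y \<in> space (\<Pi>\<^sub>M i\<in>I. borel). (\<Sum>k = 0..<idx (q + \<bar>u\<bar>) - a. y (c + k)) \<le> b u} \<in> sets (\<Pi>\<^sub>M i\<in>I. borel)"
      by measurable
  qed
  have idx_m: "k < m" "a + k < n" if "u \<in> K" "k < idx (q + \<bar>u\<bar>) - a" for u k
  proof -
    have "idx (q + \<bar>u\<bar>) \<le> n" using idx[of "q + \<bar>u\<bar>"] that(1) by (simp add: S_def)
    then show "k < m" "a + k < n" using that(2) unfolding m_def by linarith+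
  qed
  have ind: "indep_vars (\<lambda>_. borel) inc {..<n}"
    using increments_indep[of t n] t t0 by (simp add: inc_def[abs_def])
  have iv: "indep_var (\<Pi>\<^sub>M i\<in>{..<a}. borel) (\<lambda>x. \<lambda>i\<in>{..<a}. inc i x)
      (\<Pi>\<^sub>M i\<in>{a..<n}. borel) (\<lambda>x. \<lambda>i\<in>{a..<n}. inc i x)"
    by (rule indep_var_restrict[OF ind]) (use an in auto)
  have Ha: "H {a..<n} a \<in> sets (\<Pi>\<^sub>M i\<in>{a..<n}. borel)" and H0: "H {..<m} 0 \<in> sets (\<Pi>\<^sub>M i\<in>{..<m}. borel)"
    using an by (auto intro!: H simp: m_def)
  have E1: "(\<lambda>x. \<lambda>i\<in>{..<a}. inc i x) -` G1 \<inter> space M = {x \<in> space M. \<forall>s\<in>J. B s x \<in> A s}"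
  proof -
    have "(\<Sum>k\<in>{0..<idx s}. (\<lambda>i\<in>{..<a}. inc i x) k) = B s x" if "s \<in> J" "x \<in> space M" for s x
      unfolding past[OF that] by (intro sum.cong) (use idx_past[OF that(1)] in auto)
    then show ?thesis
      by (auto simp: G1_def space_PiM)
  qed
  have E2: "(\<lambda>x. \<lambda>i\<in>{a..<n}. inc i x) -` H {a..<n} a \<inter> space M = {x \<in> space M. \<forall>u\<in>K. path q x u \<le> b u}"
  proof -
    have "(\<Sum>k\<in>{0..<idx (q + \<bar>u\<bar>) - a}. (\<lambda>i\<in>{a..<n}. inc i x) (a + k)) = path q x u" if "u \<in> K" for u x
      unfolding fut[OF that] by (intro sum.cong) (use idx_m[OF that] in \<open>auto simp: m_def\<close>)
    then show ?thesis
      by (auto simp: H_def space_PiM)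
  qed
  have E3: "(\<lambda>x. \<lambda>i\<in>{..<m}. inc (a + i) x) -` H {..<m} 0 \<inter> space M = {x \<in> space M. \<forall>u\<in>K. path q x u \<le> b u}"
  proof -
    have "(\<Sum>k\<in>{0..<idx (q + \<bar>u\<bar>) - a}. (\<lambda>i\<in>{..<m}. inc (a + i) x) (0 + k)) = path q x u" if "u \<in> K" for u x
      unfolding fut[OF that] by (intro sum.cong) (use idx_m[OF that] in \<open>auto simp: m_def\<close>)
    then show ?thesis
      by (auto simp: H_def space_PiM)
  qed
  have E4: "(\<lambda>x. \<lambda>i\<in>{..<m}. inc' i x) -` H {..<m} 0 \<inter> space M = {x \<in> space M. \<forall>u\<in>K. path 0 x u \<le> b u}"
  proof -
    have "(\<Sum>k\<in>{0..<idx (q + \<bar>u\<bar>) - a}. (\<lambda>i\<in>{..<m}. inc' i x) (0 + k)) = path 0 x u" if "u \<in> K" "x \<in> space M" for u x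
      unfolding fut'[OF that] by (intro sum.cong) (use idx_m[OF that(1)] in \<open>auto simp: m_def\<close>)
    then show ?thesis
      by (auto simp: H_def space_PiM)
  qed
  have law1: "distr M (\<Pi>\<^sub>M i\<in>{..<m}. borel) (\<lambda>x. \<lambda>i\<in>{..<m}. inc (a + i) x) =
      (\<Pi>\<^sub>M i\<in>{..<m}. density lborel (normal_density 0 (sqrt (t (Suc (a + i)) - t (a + i)))))"
    using increments_law[of "\<lambda>i. t (a + i)" m] t an a q by (simp add: inc_def m_def)
  have law2: "distr M (\<Pi>\<^sub>M i\<in>{..<m}. borel) (\<lambda>x. \<lambda>i\<in>{..<m}. inc' i x) =
      (\<Pi>\<^sub>M i\<in>{..<m}. density lborel (normal_density 0 (sqrt (t (Suc (a + i)) - t (a + i)))))"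
    using increments_law[of "\<lambda>i. t (a + i) - q" m] t an a by (simp add: inc'_def m_def)
  have "inc (a + i) \<in> borel_measurable M" "inc' i \<in> borel_measurable M" if "i < m" for i
  proof -
    have "q \<le> t (a + i)" "q \<le> t (Suc (a + i))"
      using mono[of a "a + i"] mono[of a "Suc (a + i)"] a that by (cases "i = 0"; force simp: m_def)+
    then show "inc (a + i) \<in> borel_measurable M" "inc' i \<in> borel_measurable M"
      unfolding inc_def[abs_def] inc'_def[abs_def]
      using q by (auto intro!: borel_measurable_diff B_measurable)
  qed
  then have meas: "(\<lambda>x. \<lambda>i\<in>{..<m}. inc (a + i) x) \<in> measurable M (\<Pi>\<^sub>M i\<in>{..<m}. borel)"
    "(\<lambda>x. \<lambda>i\<in>{..<m}. inc' i x) \<in> measurable M (\<Pi>\<^sub>M i\<in>{..<m}. borel)"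
    by (auto intro!: measurable_restrict)
  have "prob {x \<in> space M. \<forall>u\<in>K. path q x u \<le> b u} = prob {x \<in> space M. \<forall>u\<in>K. path 0 x u \<le> b u}"
    unfolding E3[symmetric] E4[symmetric] using law1 law2
    by (simp add: measure_distr[OF meas(1) H0, symmetric] measure_distr[OF meas(2) H0, symmetric])
  moreover have "{x \<in> space M. (\<forall>s\<in>J. B s x \<in> A s) \<and> (\<forall>u\<in>K. path q x u \<le> b u)} =
      (\<lambda>x. (\<lambda>i\<in>{..<a}. inc i x, \<lambda>i\<in>{a..<n}. inc i x)) -` (G1 \<times> H {a..<n} a) \<inter> space M"
    using E1 E2 by auto
  ultimately show ?thesis
    using indep_varD[OF iv G1 Ha] by (simp only: E1 E2)
qed

text \<open>With \<open>A\<close> fixed and \<open>G\<close> varying, the Markov property becomes an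
  equality of two measures on path space, which uniqueness theorems can settle.\<close>

lemma emeasure_distr_restricted:
  assumes A: "A \<in> events" and V: "V \<in> measurable M paths" and G: "G \<in> sets paths"
  shows "emeasure (distr (density M (indicator A)) paths V) G = ennreal (prob {x \<in> A. V x \<in> G})"
proof -
  have "emeasure (distr (density M (indicator A)) paths V) G =
      emeasure (density M (indicator A)) (V -` G \<inter> space M)"
    using V G by (subst emeasure_distr) auto
  also have "\<dots> = emeasure M (A \<inter> (V -` G \<inter> space M))"
    by (intro emeasure_restricted A measurable_sets[OF V G])
  also have "A \<inter> (V -` G \<inter> space M) = {x \<in> A. V x \<in> G}"
    using sets.sets_into_space[OF A] by auto
  finally show ?thesis by (simp add: emeasure_eq_measure)
qed

lemma emeasure_scaled_law:
  assumes "0 \<le> c" "G \<in> sets paths"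
  shows "emeasure (density law (\<lambda>_. ennreal c)) G = ennreal (c * measure law G)"
proof -
  interpret L: prob_space law by (rule prob_space_law)
  show ?thesis
    using assms by (simp add: emeasure_density_const L.emeasure_eq_measure ennreal_mult)
qed

lemma measure_law_box:
  "finite K \<Longrightarrow> measure law {w. \<forall>u\<in>K. w u \<le> b u} = prob {x \<in> space M. \<forall>u\<in>K. path 0 x u \<le> b u}"
  using half_boxes_measurable[of "{w. \<forall>u\<in>K. w u \<le> b u}"]
  by (subst measure_law) (auto simp: half_boxes_def)

text \<open>Two extensions of \<open>markov_boxes\<close>: for a cylinder \<open>A\<close>, from
  half boxes to all \<open>G\<close> by uniqueness of measures; for fixed \<open>G\<close>, from
  cylinders to all of \<open>F q\<close> by induction over disjoint unions and complements.\<close>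

lemma simple_markov:
  assumes q: "0 \<le> q" and A: "A \<in> sets (F q)" and G: "G \<in> sets paths"
  shows "prob {x \<in> A. path q x \<in> G} = prob A * measure law G"
proof -
  define E where "E = {x \<in> space M. path q x \<in> G}"
  have E: "E \<in> events"
    using measurable_sets[OF path_measurable_const[OF q] G] by (simp add: E_def vimage_def Int_def conj_commute)
  \<comment> \<open>Cylinders only up to null sets: the class then contains all generators of the
    completed sigma-algebra, a null set being almost surely the impossible condition, and it stays
    closed under intersection.\<close>
  define Cyl where "Cyl = {A \<in> events. \<exists>J As. finite J \<and> J \<subseteq> {0..q} \<and> (\<forall>s\<in>J. As s \<in> sets borel) \<and>
      (AE x in M. x \<in> A \<longleftrightarrow> (\<forall>s\<in>J. B s x \<in> As s))}"
  have cyl: "prob (A \<inter> E) = prob A * measure law G" if "A \<in> Cyl" for A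
  proof -
    from that obtain J As where J: "finite J" "J \<subseteq> {0..q}" and As: "\<And>s. s \<in> J \<Longrightarrow> As s \<in> sets borel"
      and ae: "AE x in M. x \<in> A \<longleftrightarrow> (\<forall>s\<in>J. B s x \<in> As s)" and A: "A \<in> events"
      by (auto simp: Cyl_def)
    define A0 where "A0 = {x \<in> space M. \<forall>s\<in>J. B s x \<in> As s}"
    have A0: "A0 \<in> events"
      unfolding A0_def
    proof (intro sets.sets_Collect_finite_All J)
      fix s assume s: "s \<in> J"
      then have "B s \<in> borel_measurable M" using J by (intro B_measurable) auto
      from measurable_sets[OF this As[OF s]]
      show "{x \<in> space M. B s x \<in> As s} \<in> events"
        by (simp add: vimage_def Int_def conj_commute)
    qed
    have "distr (density M (indicator A0)) paths (path q) = density law (\<lambda>_. ennreal (prob A0))"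
    proof (rule path_measure_eqI)
      fix K :: "real set" and b assume K: "finite K"
      then have box: "{w. \<forall>u\<in>K. w u \<le> b u} \<in> sets paths"
        by (intro half_boxes_measurable) (auto simp: half_boxes_def)
      have "prob {x \<in> A0. path q x \<in> {w. \<forall>u\<in>K. w u \<le> b u}} =
          prob {x \<in> space M. (\<forall>s\<in>J. B s x \<in> As s) \<and> (\<forall>u\<in>K. path q x u \<le> b u)}"
        by (intro arg_cong[where f = prob]) (auto simp: A0_def)
      also have "\<dots> = prob A0 * measure law {w. \<forall>u\<in>K. w u \<le> b u}"
        using markov_boxes[OF q J K As] by (simp add: A0_def measure_law_box[OF K])
      finally show "emeasure (distr (density M (indicator A0)) paths (path q)) {w. \<forall>u\<in>K. w u \<le> b u} =
          emeasure (density law (\<lambda>_. ennreal (prob A0))) {w. \<forall>u\<in>K. w u \<le> b u}"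
        using emeasure_distr_restricted[OF A0 path_measurable_const[OF q] box]
          emeasure_scaled_law[OF _ box, of "prob A0"] by simp
    next
      show "finite_measure (distr (density M (indicator A0)) paths (path q))"
      proof
        have "UNIV \<in> sets paths" using sets.top[of paths] by simp
        from emeasure_distr_restricted[OF A0 path_measurable_const[OF q] this]
        show "emeasure (distr (density M (indicator A0)) paths (path q)) (space (distr (density M (indicator A0)) paths (path q))) \<noteq> \<infinity>"
          by simp
      qed
    qed simp_all
    then have "ennreal (prob {x \<in> A0. path q x \<in> G}) = ennreal (prob A0 * measure law G)"
      using emeasure_distr_restricted[OF A0 path_measurable_const[OF q] G]
        emeasure_scaled_law[OF _ G, of "prob A0"] by simp
    then have "prob {x \<in> A0. path q x \<in> G} = prob A0 * measure law G"
      by (subst (asm) ennreal_inj) auto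
    moreover have "{x \<in> A0. path q x \<in> G} = A0 \<inter> E"
      by (auto simp: A0_def E_def)
    moreover have ae0: "AE x in M. x \<in> A \<longleftrightarrow> x \<in> A0"
      using ae AE_space by eventually_elim (simp add: A0_def)
    then have "AE x in M. x \<in> A \<inter> E \<longleftrightarrow> x \<in> A0 \<inter> E"
      by eventually_elim simp
    then have "prob (A \<inter> E) = prob (A0 \<inter> E)"
      using A A0 E by (intro finite_measure_eq_AE) auto
    moreover have "prob A = prob A0"
      by (intro finite_measure_eq_AE ae0 A A0)
    ultimately show ?thesis by simp
  qed
  have stable: "Int_stable Cyl"
  proof (rule Int_stableI)
    fix A1 A2 assume "A1 \<in> Cyl" "A2 \<in> Cyl"
    then obtain J K As Bs where *: "A1 \<in> events" "A2 \<in> events" "finite J" "J \<subseteq> {0..q}"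
      "\<forall>s\<in>J. As s \<in> sets borel" "AE x in M. x \<in> A1 \<longleftrightarrow> (\<forall>s\<in>J. B s x \<in> As s)"
      "finite K" "K \<subseteq> {0..q}"
      "\<forall>s\<in>K. Bs s \<in> sets borel" "AE x in M. x \<in> A2 \<longleftrightarrow> (\<forall>s\<in>K. B s x \<in> Bs s)"
      by (auto simp: Cyl_def)
    define Cs where "Cs s = (if s \<in> J then As s else UNIV) \<inter> (if s \<in> K then Bs s else UNIV)" for s
    have "AE x in M. x \<in> A1 \<inter> A2 \<longleftrightarrow> (\<forall>s\<in>J\<union>K. B s x \<in> Cs s)"
      using *(6,10) by eventually_elim (auto simp: Cs_def split: if_splits)
    moreover have "\<forall>s\<in>J\<union>K. Cs s \<in> sets borel"
      using * by (auto simp: Cs_def)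
    ultimately show "A1 \<inter> A2 \<in> Cyl"
      unfolding Cyl_def using *
      by (intro CollectI conjI exI[of _ "J \<union> K"] exI[of _ Cs]) auto
  qed
  have closed: "Cyl \<subseteq> Pow (space M)"
    using sets.sets_into_space by (auto simp: Cyl_def)
  have gen: "{B s -` A \<inter> space M |s A. 0 \<le> s \<and> ennreal s \<le> ennreal q \<and> A \<in> sets borel} \<union> null_sets M \<subseteq> Cyl"
  proof (intro Un_least subsetI)
    fix C assume "C \<in> {B s -` A \<inter> space M |s A. 0 \<le> s \<and> ennreal s \<le> ennreal q \<and> A \<in> sets borel}"
    then obtain s A where *: "C = B s -` A \<inter> space M" "0 \<le> s" "s \<le> q" "A \<in> sets borel"
      using q by auto
    then show "C \<in> Cyl"
      unfolding Cyl_def using measurable_sets[OF B_measurable[of s]]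
      by (intro CollectI conjI exI[of _ "{s}"] exI[of _ "\<lambda>_. A"]) auto
  next
    fix C assume C: "C \<in> null_sets M"
    then have "AE x in M. x \<notin> C" by (rule AE_not_in)
    then show "C \<in> Cyl"
      unfolding Cyl_def using C q
      by (intro CollectI conjI exI[of _ "{0}"] exI[of _ "\<lambda>_. {}"]) auto
  qed
  have "A \<in> sigma_sets (space M) Cyl"
    using A sigma_sets_mono'[OF gen] unfolding sets_completed_natural_filtration by blast
  have Cyl_ev: "sigma_sets (space M) Cyl \<subseteq> events"
    by (rule sets.sigma_sets_subset) (auto simp: Cyl_def)
  have "prob (A \<inter> E) = prob A * measure law G"
    using stable closed \<open>A \<in> sigma_sets (space M) Cyl\<close>
  proof (induction rule: sigma_sets_induct_disjoint)
    case (basic A)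
    then show ?case by (rule cyl)
  next
    case empty
    show ?case by simp
  next
    case (compl A)
    have A: "A \<in> events" using compl(1) Cyl_ev by auto
    have sp: "space M \<in> Cyl"
      unfolding Cyl_def by (intro CollectI conjI exI[of _ "{}"]) auto
    have "prob ((space M - A) \<inter> E) = prob (space M \<inter> E - A \<inter> E)"
      by (intro arg_cong[where f = prob]) (use E sets.sets_into_space in auto)
    also have "\<dots> = prob (space M \<inter> E) - prob (A \<inter> E)"
      using A E sets.sets_into_space by (intro finite_measure_Diff) auto
    also have "\<dots> = prob (space M - A) * measure law G"
      unfolding prob_compl[OF A] cyl[OF sp] compl(2) by (simp add: prob_space left_diff_distrib)
    finally show ?case .
  next
    case (union A)
    have A: "range A \<subseteq> events" using union(2) Cyl_ev by auto
    have "(\<lambda>i. prob (A i \<inter> E)) sums prob (\<Union>i. A i \<inter> E)"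
      by (intro finite_measure_UNION) (use A E union(1) in \<open>auto simp: disjoint_family_on_def\<close>)
    moreover have "(\<lambda>i. prob (A i) * measure law G) sums (prob (\<Union>i. A i) * measure law G)"
      by (intro sums_mult2 finite_measure_UNION A union(1))
    ultimately show ?case
      using union(3) by (simp add: sums_unique2)
  qed
  moreover have "{x \<in> A. path q x \<in> G} = A \<inter> E"
    using sets.sets_into_space[OF A] by (auto simp: E_def)
  ultimately show ?thesis by simp
qed

section \<open>Optional times and the strong Markov property\<close>

text \<open>The inequality is strict because the times met later are infima over rational times, and
  an infimum is below \<open>t\<close> exactly when one of countably many members is.\<close>

definition optional :: "('a \<Rightarrow> real) \<Rightarrow> bool" where
  "optional \<tau> \<longleftrightarrow> (\<forall>x\<in>space M. 0 \<le> \<tau> x) \<and> (\<forall>t\<ge>0. {x \<in> space M. \<tau> x < t} \<in> sets (F t))"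

text \<open>This is the \<open>\<sigma>\<close>-algebra usually written \<open>\<F>\<^bsub>\<tau>+\<^esub>\<close>.\<close>

definition post :: "('a \<Rightarrow> real) \<Rightarrow> 'a set set" where
  "post \<tau> = {C. C \<subseteq> space M \<and> (\<forall>t\<ge>0. {x \<in> C. \<tau> x < t} \<in> sets (F t))}"

lemma optional_nonneg: "optional \<tau> \<Longrightarrow> x \<in> space M \<Longrightarrow> 0 \<le> \<tau> x"
  by (simp add: optional_def)

lemma optional_less: "optional \<tau> \<Longrightarrow> {x \<in> space M. \<tau> x < t} \<in> sets (F t)"
proof (cases "0 \<le> t")
  case False
  moreover assume "optional \<tau>"
  ultimately have "{x \<in> space M. \<tau> x < t} = {}" using optional_nonneg by force
  then show ?thesis by (simp only: sets.empty_sets)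
qed (simp add: optional_def)

lemma optional_measurable: "optional \<tau> \<Longrightarrow> \<tau> \<in> borel_measurable M"
  by (intro borel_measurableI_less sets_F_subset[OF optional_less])

lemma optional_const:
  assumes "0 \<le> c"
  shows "optional (\<lambda>_. c)"
proof -
  have "{x \<in> space M. c < t} \<in> sets (F t)" for t
  proof (cases "c < t")
    case True
    then have "{x \<in> space M. c < t} = space (F t)" by simp
    then show ?thesis by (simp only: sets.top)
  next
    case False
    then have "{x \<in> space M. c < t} = {}" by simp
    then show ?thesis by (simp only: sets.empty_sets)
  qed
  with assms show ?thesis
    unfolding optional_def by blast
qed

lemma post_less: "C \<in> post \<tau> \<Longrightarrow> 0 \<le> t \<Longrightarrow> {x \<in> C. \<tau> x < t} \<in> sets (F t)"
  by (simp add: post_def)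

lemma space_in_post: "optional \<tau> \<Longrightarrow> space M \<in> post \<tau>"
  by (simp add: post_def optional_less)

lemma post_events:
  assumes "C \<in> post \<tau>"
  shows "C \<in> events"
proof -
  have "C = (\<Union>n::nat. {x \<in> C. \<tau> x < real n})"
    using reals_Archimedean2 by auto
  also have "\<dots> \<in> events"
    using assms by (intro sets.countable_UN image_subsetI sets_F_subset[OF post_less]) auto
  finally show ?thesis .
qed

lemma sigma_algebra_post:
  assumes "optional \<tau>"
  shows "sigma_algebra (space M) (post \<tau>)"
  unfolding sigma_algebra_iff2
proof (intro conjI ballI allI impI)
  show "post \<tau> \<subseteq> Pow (space M)" "{} \<in> post \<tau>" by (auto simp: post_def)
  fix C assume C: "C \<in> post \<tau>"
  have "{x \<in> space M. \<tau> x < t} - {x \<in> C. \<tau> x < t} \<in> sets (F t)" if "0 \<le> t" for t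
    using C that assms by (intro sets.Diff optional_less post_less)
  moreover have "{x \<in> space M. \<tau> x < t} - {x \<in> C. \<tau> x < t} = {x \<in> space M - C. \<tau> x < t}" for t
    by auto
  ultimately show "space M - C \<in> post \<tau>" by (simp add: post_def)
next
  fix C :: "nat \<Rightarrow> 'a set" assume C: "range C \<subseteq> post \<tau>"
  have "(\<Union>i. {x \<in> C i. \<tau> x < t}) \<in> sets (F t)" if "0 \<le> t" for t
    using C that by (intro sets.countable_UN image_subsetI post_less) auto
  moreover have "(\<Union>i. {x \<in> C i. \<tau> x < t}) = {x \<in> (\<Union>i. C i). \<tau> x < t}" for t
    by auto
  ultimately show "(\<Union>i. C i) \<in> post \<tau>" using C by (auto simp: post_def)
qed

lemma null_sets_post: "N \<in> null_sets M \<Longrightarrow> N \<in> post \<tau>"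
proof -
  assume N: "N \<in> null_sets M"
  have "{x \<in> N. \<tau> x < t} \<in> null_sets M" for t
    using complete2[OF _ N] by auto
  then show ?thesis
    using sets.sets_into_space[OF null_setsD2[OF N]]
    by (auto simp: post_def intro: null_sets_completed_natural_filtration)
qed

lemma continuous_path:
  assumes "x \<in> space M" "\<And>n. 0 \<le> r n" "0 \<le> s" "r \<longlonglongrightarrow> s"
  shows "(\<lambda>n. B (r n) x) \<longlonglongrightarrow> B s x"
  by (rule continuous_on_tendsto_compose[OF continuous_B[OF assms(1)] assms(4)]) (use assms in auto)

text \<open>On each value of the dyadic time above \<open>\<tau>\<close> the Markov property at a
  fixed time applies, and the pieces add up. By continuity the increments after the dyadic times
  converge coordinatewise to those after \<open>\<tau>\<close>; all have the same law on
  \<open>C\<close>, hence so has the limit.\<close>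

lemma strong_markov:
  assumes opt: "optional \<tau>" and C: "C \<in> post \<tau>" and G: "G \<in> sets paths"
  shows "prob {x \<in> C. path (\<tau> x) x \<in> G} = prob C * measure law G"
proof -
  have \<tau> [measurable]: "\<tau> \<in> borel_measurable M" by (rule optional_measurable[OF opt])
  have nonneg: "0 \<le> \<tau> x" if "x \<in> space M" for x using optional_nonneg[OF opt that] .
  have Cs: "C \<subseteq> space M" using C by (simp add: post_def)
  have Cev: "C \<in> events" by (rule post_events[OF C])
  define V where "V n x = path (dyadic_above n (\<tau> x)) x" for n x
  have V: "V n \<in> measurable M paths" for n
    unfolding V_def[abs_def]
  proof (rule path_measurable)
    show "(\<lambda>x. dyadic_above n (\<tau> x)) \<in> borel_measurable M"
      unfolding dyadic_above_def by measurable
  qed (simp add: dyadic_above_pos less_imp_le)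
  have W: "(\<lambda>x. path (\<tau> x) x) \<in> measurable M paths"
    by (rule path_measurable[OF \<tau> nonneg])
  have approx: "prob {x \<in> C. V n x \<in> G} = prob C * measure law G" if G: "G \<in> sets paths" for n G
  proof -
    define t where "t k = (real k + 1) / 2^n" for k
    define D where "D k = {x \<in> C. dyadic_above n (\<tau> x) = t k}" for k
    have t: "0 \<le> t k" for k by (simp add: t_def)
    \<comment> \<open>Both comparisons are strict and concern times at most \<open>t k\<close>, so
      optionality and membership in \<open>post\<close> decide them at \<open>t k\<close>.\<close>
    have D_eq: "D k = {x \<in> C. \<tau> x < t k} - {x \<in> space M. \<tau> x < real k / 2^n}" for k
      unfolding D_def t_def using dyadic_above_eq_iff[OF nonneg] Cs by force
    have D: "D k \<in> sets (F (t k))" for k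
      unfolding D_eq
    proof (intro sets.Diff post_less[OF C t])
      show "{x \<in> space M. \<tau> x < real k / 2^n} \<in> sets (F (t k))"
        by (rule completed_natural_filtration_mono[OF optional_less[OF opt]])
           (auto simp: t_def ennreal_leI divide_right_mono)
    qed
    have disj: "disjoint_family D"
      by (auto simp: disjoint_family_on_def D_def t_def)
    have UN: "C = (\<Union>k. D k)"
      by (auto simp: D_def t_def dyadic_above_def)
    have Dev: "range D \<subseteq> events" using sets_F_subset[OF D] by auto
    have "(\<lambda>k. prob {x \<in> D k. V n x \<in> G}) sums prob (\<Union>k. {x \<in> D k. V n x \<in> G})"
    proof (rule finite_measure_UNION)
      have "{x \<in> D k. V n x \<in> G} = D k \<inter> (V n -` G \<inter> space M)" for k
        using Cs by (auto simp: D_def)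
      then show "range (\<lambda>k. {x \<in> D k. V n x \<in> G}) \<subseteq> events"
        using measurable_sets[OF V G] Dev by auto
    qed (use disj in \<open>auto simp: disjoint_family_on_def\<close>)
    moreover have "(\<Union>k. {x \<in> D k. V n x \<in> G}) = {x \<in> C. V n x \<in> G}"
      unfolding UN by auto
    moreover have "prob {x \<in> D k. V n x \<in> G} = prob (D k) * measure law G" for k
    proof -
      have "{x \<in> D k. V n x \<in> G} = {x \<in> D k. path (t k) x \<in> G}"
        by (auto simp: D_def V_def)
      then show ?thesis using simple_markov[OF t D G] by simp
    qed
    moreover have "(\<lambda>k. prob (D k) * measure law G) sums (prob C * measure law G)"
      unfolding UN by (intro sums_mult2 finite_measure_UNION Dev disj)
    ultimately show ?thesis by (simp add: sums_unique2)
  qed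
  have fin: "finite_measure (density M (indicator C))"
  proof
    show "emeasure (density M (indicator C)) (space (density M (indicator C))) \<noteq> \<infinity>"
      using emeasure_restricted[OF Cev, of "space M"] by (simp add: emeasure_eq_measure)
  qed
  have 1: "distr (density M (indicator C)) paths (V n) = density law (\<lambda>_. ennreal (prob C))" for n
  proof (rule measure_eqI)
    fix G assume "G \<in> sets (distr (density M (indicator C)) paths (V n))"
    then have G: "G \<in> sets paths" by simp
    show "emeasure (distr (density M (indicator C)) paths (V n)) G = emeasure (density law (\<lambda>_. ennreal (prob C))) G"
      unfolding emeasure_distr_restricted[OF Cev V G] emeasure_scaled_law[OF measure_nonneg G] approx[OF G] ..
  qed simp
  have 2: "(\<lambda>n. V n x u) \<longlonglongrightarrow> path (\<tau> x) x u" if "x \<in> space (density M (indicator C))" for x u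
    unfolding V_def path_def using that dyadic_above_LIMSEQ[OF nonneg] nonneg
    by (intro tendsto_diff continuous_path tendsto_add) (auto intro: less_imp_le[OF dyadic_above_pos] add_nonneg_nonneg)
  have 3: "V n \<in> measurable (density M (indicator C)) paths"
    "(\<lambda>x. path (\<tau> x) x) \<in> measurable (density M (indicator C)) paths" for n
    using V W by (simp_all only: measurable_density_eq1)
  have "distr (density M (indicator C)) paths (\<lambda>x. path (\<tau> x) x) = density law (\<lambda>_. ennreal (prob C))"
    by (rule path_distr_limit[OF fin 3 2 1])
  then have "ennreal (prob {x \<in> C. path (\<tau> x) x \<in> G}) = ennreal (prob C * measure law G)"
    unfolding emeasure_distr_restricted[OF Cev W G, symmetric] emeasure_scaled_law[OF measure_nonneg G, symmetric] by simp
  then show ?thesis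
    by (subst (asm) ennreal_inj) auto
qed

section \<open>Conditioning on the data available at an optional time\<close>

definition Post :: "('a \<Rightarrow> real) \<Rightarrow> 'a measure" where
  "Post \<tau> = sigma (space M) (post \<tau>)"

lemma space_Post [simp]: "space (Post \<tau>) = space M"
  unfolding Post_def by (rule space_measure_of) (auto simp: post_def)

lemma sets_Post: "optional \<tau> \<Longrightarrow> sets (Post \<tau>) = post \<tau>"
  unfolding Post_def by (rule sigma_algebra.sets_measure_of_eq[OF sigma_algebra_post])

lemma measurable_Post_imp:
  assumes "optional \<tau>" "X \<in> measurable (Post \<tau>) N"
  shows "X \<in> measurable M N"
  using measurable_mono[OF order_refl refl, of "Post \<tau>" M N] assms post_events
  by (auto simp: sets_Post)

text \<open>By \<open>strong_markov\<close> the joint law of \<open>X\<close> and the path after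
  \<open>\<tau>\<close>, restricted to \<open>D\<close>, is a product measure; Fubini gives the
  formula. It extends the strong Markov property from rectangles to arbitrary joint events.\<close>

lemma post_path_product:
  assumes opt: "optional \<tau>" and D: "D \<in> post \<tau>" and X: "X \<in> measurable (Post \<tau>) N"
    and \<Gamma>: "\<Gamma> \<in> sets (N \<Otimes>\<^sub>M paths)"
  shows "emeasure M {x \<in> D. (X x, path (\<tau> x) x) \<in> \<Gamma>} =
    (\<integral>\<^sup>+x. emeasure law (Pair (X x) -` \<Gamma>) * indicator D x \<partial>M)"
proof -
  interpret L: prob_space law by (rule prob_space_law)
  define K where "K = density M (indicator D)"
  define W where "W x = path (\<tau> x) x" for x
  have Dev: "D \<in> events" by (rule post_events[OF D])
  have Ds: "D \<subseteq> space M" using D by (simp add: post_def)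
  have sK: "space K = space M" "sets K = events" by (simp_all add: K_def)
  have XM: "X \<in> measurable M N" by (rule measurable_Post_imp[OF opt X])
  have WM: "W \<in> measurable M paths"
    unfolding W_def by (rule path_measurable[OF optional_measurable[OF opt] optional_nonneg[OF opt]])
  have XK: "X \<in> measurable K N" and WK: "W \<in> measurable K paths"
    using XM WM by (simp_all only: K_def measurable_density_eq1)
  have XW: "(\<lambda>x. (X x, W x)) \<in> measurable K (N \<Otimes>\<^sub>M paths)"
    by (rule measurable_Pair[OF XK WK])
  have emK: "emeasure K A = emeasure M (D \<inter> A)" if "A \<in> events" for A
    unfolding K_def by (rule emeasure_restricted[OF Dev that])
  interpret K: finite_measure K
  proof
    show "emeasure K (space K) \<noteq> \<infinity>" using emK[of "space M"] by (simp add: sK emeasure_eq_measure)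
  qed
  interpret N1: finite_measure "distr K N X"
    by (rule K.finite_measure_distr[OF XK])
  have eq: "distr K N X \<Otimes>\<^sub>M law = distr K (N \<Otimes>\<^sub>M paths) (\<lambda>x. (X x, W x))"
  proof (rule pair_measure_eqI)
    show "sigma_finite_measure (distr K N X)" "sigma_finite_measure law" by unfold_locales
    show "sets (distr K N X \<Otimes>\<^sub>M law) = sets (distr K (N \<Otimes>\<^sub>M paths) (\<lambda>x. (X x, W x)))"
      by (simp cong: sets_pair_measure_cong)
    fix A G assume "A \<in> sets (distr K N X)" "G \<in> sets law"
    then have A: "A \<in> sets N" and G: "G \<in> sets paths" by simp_all
    have XA: "X -` A \<inter> space M \<in> post \<tau>"
      using measurable_sets[OF X A] by (simp add: sets_Post[OF opt])
    interpret P: sigma_algebra "space M" "post \<tau>" by (rule sigma_algebra_post[OF opt])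
    have DA: "D \<inter> (X -` A \<inter> space M) \<in> post \<tau>"
      by (rule P.Int[OF D XA])
    have "emeasure (distr K N X) A = emeasure M (D \<inter> (X -` A \<inter> space M))"
      by (simp add: emeasure_distr[OF XK A] sK emK measurable_sets[OF XM A])
    moreover have "emeasure law G = ennreal (measure law G)"
      by (rule L.emeasure_eq_measure)
    moreover have "emeasure (distr K (N \<Otimes>\<^sub>M paths) (\<lambda>x. (X x, W x))) (A \<times> G) =
        emeasure M (D \<inter> ((\<lambda>x. (X x, W x)) -` (A \<times> G) \<inter> space M))"
      using measurable_sets[OF XW pair_measureI[OF A G]]
      by (simp add: emeasure_distr[OF XW pair_measureI[OF A G]] sK emK)
    moreover have "D \<inter> ((\<lambda>x. (X x, W x)) -` (A \<times> G) \<inter> space M) =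
        {x \<in> D \<inter> (X -` A \<inter> space M). path (\<tau> x) x \<in> G}"
      by (auto simp: W_def)
    ultimately show "emeasure (distr K N X) A * emeasure law G =
        emeasure (distr K (N \<Otimes>\<^sub>M paths) (\<lambda>x. (X x, W x))) (A \<times> G)"
      by (simp only: emeasure_eq_measure strong_markov[OF opt DA G] ennreal_mult measure_nonneg)
  qed
  have \<Gamma>': "\<Gamma> \<in> sets (distr K N X \<Otimes>\<^sub>M law)"
    using \<Gamma> by (simp cong: sets_pair_measure_cong)
  have meas: "(\<lambda>y. emeasure law (Pair y -` \<Gamma>)) \<in> borel_measurable N"
    by (rule L.measurable_emeasure_Pair) (use \<Gamma> in \<open>simp cong: sets_pair_measure_cong\<close>)
  have set_eq: "{x \<in> D. (X x, path (\<tau> x) x) \<in> \<Gamma>} = D \<inter> ((\<lambda>x. (X x, W x)) -` \<Gamma> \<inter> space M)"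
    using Ds by (auto simp: W_def)
  have "emeasure M {x \<in> D. (X x, path (\<tau> x) x) \<in> \<Gamma>} =
      emeasure (distr K (N \<Otimes>\<^sub>M paths) (\<lambda>x. (X x, W x))) \<Gamma>"
    unfolding set_eq using measurable_sets[OF XW \<Gamma>]
    by (simp add: emeasure_distr[OF XW \<Gamma>] sK emK)
  also have "\<dots> = (\<integral>\<^sup>+y. emeasure law (Pair y -` \<Gamma>) \<partial>distr K N X)"
    unfolding eq[symmetric] by (rule L.emeasure_pair_measure_alt[OF \<Gamma>'])
  also have "\<dots> = (\<integral>\<^sup>+x. emeasure law (Pair (X x) -` \<Gamma>) \<partial>K)"
    by (rule nn_integral_distr[OF XK]) (simp add: meas)
  also have "\<dots> = (\<integral>\<^sup>+x. indicator D x * emeasure law (Pair (X x) -` \<Gamma>) \<partial>M)"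
    unfolding K_def
    by (rule nn_integral_density) (use Dev measurable_compose[OF XM meas] in auto)
  finally show ?thesis by (simp add: mult.commute)
qed

section \<open>The past at an optional time and the stopped path\<close>

lemma min_optional_measurable:
  assumes "optional \<tau>" "0 \<le> t"
  shows "(\<lambda>x. min (\<tau> x) t) \<in> borel_measurable (F t)"
proof (rule borel_measurableI_less)
  fix y
  show "{x \<in> space (F t). min (\<tau> x) t < y} \<in> sets (F t)"
  proof (cases "t < y")
    case True
    then have "{x \<in> space (F t). min (\<tau> x) t < y} = space (F t)" by auto
    then show ?thesis by (simp only: sets.top)
  next
    case False
    then have "{x \<in> space (F t). min (\<tau> x) t < y} = {x \<in> space M. \<tau> x < y}" by auto
    moreover have "{x \<in> space M. \<tau> x < y} \<in> sets (F t)"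
      using False by (intro completed_natural_filtration_mono[OF optional_less[OF assms(1)]])
        (simp add: ennreal_leI)
    ultimately show ?thesis by (simp only:)
  qed
qed

lemma stopped_measurable:
  assumes opt: "optional \<tau>" and t: "0 \<le> t" and s: "0 \<le> s"
  shows "(\<lambda>x. B (min s (min (\<tau> x) t)) x) \<in> borel_measurable (F t)"
proof -
  have "(\<lambda>x. (\<lambda>u x. B (min u t) x) (min s (min (\<tau> x) t)) x) \<in> borel_measurable (F t)"
  proof (rule borel_measurable_at_random_time[where X = "\<lambda>u x. B (min u t) x" and \<rho> = "\<lambda>x. min s (min (\<tau> x) t)"])
    show "(\<lambda>x. min s (min (\<tau> x) t)) \<in> borel_measurable (F t)"
      by (intro borel_measurable_min borel_measurable_const min_optional_measurable opt t)
  next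
    fix x assume "x \<in> space (F t)"
    then have x: "x \<in> space M" by simp
    show "0 \<le> min s (min (\<tau> x) t)" using s t optional_nonneg[OF opt x] by simp
    show "continuous_on {0..} (\<lambda>u. B (min u t) x)"
      by (rule continuous_on_path_min[OF continuous_B[OF x] t])
  next
    fix u :: real assume "0 \<le> u"
    then show "(\<lambda>x. B (min u t) x) \<in> borel_measurable (F t)"
      using t by (intro measurable_completed_natural_filtration) (auto intro: ennreal_leI)
  qed
  then show ?thesis by (simp add: min.assoc)
qed

definition stopped_gens :: "('a \<Rightarrow> real) \<Rightarrow> 'a set set" where
  "stopped_gens \<tau> = {\<tau> -` A \<inter> space M | A. A \<in> sets borel} \<union>
     {(\<lambda>x. B (min s (\<tau> x)) x) -` A \<inter> space M | s A. 0 \<le> s \<and> A \<in> sets borel} \<union> null_sets M"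

definition Stopped :: "('a \<Rightarrow> real) \<Rightarrow> 'a measure" where
  "Stopped \<tau> = sigma (space M) (stopped_gens \<tau>)"

lemma stopped_gens_closed: "stopped_gens \<tau> \<subseteq> Pow (space M)"
  by (auto simp: stopped_gens_def dest: sets.sets_into_space[OF null_setsD2])

lemma space_Stopped [simp]: "space (Stopped \<tau>) = space M"
  unfolding Stopped_def by (rule space_measure_of[OF stopped_gens_closed])

lemma sets_Stopped: "sets (Stopped \<tau>) = sigma_sets (space M) (stopped_gens \<tau>)"
  unfolding Stopped_def by (rule sets_measure_of[OF stopped_gens_closed])

lemma measurable_Stopped:
  "\<tau> \<in> borel_measurable (Stopped \<tau>)"
  "0 \<le> s \<Longrightarrow> (\<lambda>x. B (min s (\<tau> x)) x) \<in> borel_measurable (Stopped \<tau>)"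
  by (intro measurableI; force simp: sets_Stopped stopped_gens_def intro!: sigma_sets.Basic)+

lemma sets_Stopped_subset_post:
  assumes opt: "optional \<tau>"
  shows "sets (Stopped \<tau>) \<subseteq> post \<tau>"
proof -
  interpret P: sigma_algebra "space M" "post \<tau>" by (rule sigma_algebra_post[OF opt])
  have \<tau>: "\<tau> -` A \<inter> space M \<in> post \<tau>" if A: "A \<in> sets borel" for A
  proof -
    have "{x \<in> \<tau> -` A \<inter> space M. \<tau> x < t} \<in> sets (F t)" if t: "0 \<le> t" for t
    proof -
      have "{x \<in> \<tau> -` A \<inter> space M. \<tau> x < t} =
          ((\<lambda>x. min (\<tau> x) t) -` A \<inter> space (F t)) \<inter> {x \<in> space M. \<tau> x < t}"
        by (auto simp: min_def)
      also have "\<dots> \<in> sets (F t)"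
        by (intro sets.Int measurable_sets[OF min_optional_measurable[OF opt t]] optional_less[OF opt] A)
      finally show ?thesis .
    qed
    then show ?thesis by (simp add: post_def)
  qed
  have path: "(\<lambda>x. B (min s (\<tau> x)) x) -` A \<inter> space M \<in> post \<tau>" if A: "A \<in> sets borel" and s: "0 \<le> s" for A s
  proof -
    have "{x \<in> (\<lambda>x. B (min s (\<tau> x)) x) -` A \<inter> space M. \<tau> x < t} \<in> sets (F t)" if t: "0 \<le> t" for t
    proof -
      have "{x \<in> (\<lambda>x. B (min s (\<tau> x)) x) -` A \<inter> space M. \<tau> x < t} =
          ((\<lambda>x. B (min s (min (\<tau> x) t)) x) -` A \<inter> space (F t)) \<inter> {x \<in> space M. \<tau> x < t}"
        by (auto simp: min_absorb1)
      also have "\<dots> \<in> sets (F t)"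
        by (intro sets.Int measurable_sets[OF stopped_measurable[OF opt t s]] optional_less[OF opt] A)
      finally show ?thesis .
    qed
    then show ?thesis by (simp add: post_def)
  qed
  show ?thesis
    unfolding sets_Stopped
    by (rule P.sigma_sets_subset) (auto simp: stopped_gens_def intro: \<tau> path null_sets_post)
qed

lemma continuous_path_shift:
  assumes "x \<in> space M" "0 \<le> r"
  shows "continuous_on A (\<lambda>u. path r x u)"
proof -
  have "continuous_on A (\<lambda>u. r + \<bar>u\<bar>)" by (intro continuous_intros)
  moreover have "(\<lambda>u. r + \<bar>u\<bar>) ` A \<subseteq> {0..}" using assms(2) by auto
  ultimately have "continuous_on A (\<lambda>u. B (r + \<bar>u\<bar>) x)"
    by (rule continuous_on_compose2[OF continuous_B[OF assms(1)]])
  then show ?thesis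
    unfolding path_def by (rule continuous_on_diff) (rule continuous_on_const)
qed

text \<open>
  A Brownian path is determined by its part up to \<open>\<tau>\<close> and its increments after \<open>\<tau>\<close>. The latter are
  independent of \<open>\<F>\<^bsub>\<tau>+\<^esub>\<close>, so they do not help to decide an event of \<open>\<F>\<^bsub>\<tau>+\<^esub>\<close>.
\<close>

lemma post_subset_sets_Stopped:
  assumes opt: "optional \<tau>" and C: "C \<in> post \<tau>"
  shows "C \<in> sets (Stopped \<tau>)"
proof -
  interpret L: prob_space law by (rule prob_space_law)
  define W where "W x = path (\<tau> x) x" for x
  \<comment> \<open>\<open>V\<close> collects the stopped data and the increments after
    \<open>\<tau>\<close>. It contains every \<open>F t\<close>, and therefore
    \<open>C\<close>.\<close>
  define V where "V = vimage_algebra (space M) (\<lambda>x. (x, W x)) (Stopped \<tau> \<Otimes>\<^sub>M paths)"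
  have spV: "space V = space M" by (simp add: V_def)
  have pair: "(\<lambda>x. (x, W x)) \<in> measurable V (Stopped \<tau> \<Otimes>\<^sub>M paths)"
    unfolding V_def by (rule measurable_vimage_algebra1) (simp add: space_pair_measure)
  have id: "(\<lambda>x. x) \<in> measurable V (Stopped \<tau>)"
    using measurable_compose[OF pair measurable_fst] by simp
  have W: "W \<in> measurable V paths"
    using measurable_compose[OF pair measurable_snd] by simp
  have null: "null_sets M \<subseteq> sets (Stopped \<tau>)"
    by (auto simp: sets_Stopped stopped_gens_def intro: sigma_sets.Basic)
  have Stopped_V: "A \<in> sets V" if "A \<in> sets (Stopped \<tau>)" for A
  proof -
    have "(\<lambda>x. x) -` A \<inter> space V = A"
      using sets.sets_into_space[OF that] by (auto simp: spV)
    then show ?thesis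
      using measurable_sets[OF id that] by simp
  qed
  have \<tau>V: "\<tau> \<in> borel_measurable V"
    using measurable_compose[OF id measurable_Stopped(1)] by simp
  have BV: "B t \<in> borel_measurable V" if t: "0 \<le> t" for t
  proof -
    have 1: "(\<lambda>x. B (min t (\<tau> x)) x) \<in> borel_measurable V"
      using measurable_compose[OF id measurable_Stopped(2)[OF t]] by simp
    have 2: "(\<lambda>x. (\<lambda>u x. W x u) (max 0 (t - \<tau> x)) x) \<in> borel_measurable V"
    proof (rule borel_measurable_at_random_time[where X = "\<lambda>u x. W x u" and \<rho> = "\<lambda>x. max 0 (t - \<tau> x)"])
      show "(\<lambda>x. max 0 (t - \<tau> x)) \<in> borel_measurable V"
        by (intro borel_measurable_max borel_measurable_diff borel_measurable_const \<tau>V)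
      show "continuous_on {0..} (\<lambda>u. W x u)" if "x \<in> space V" for x
        unfolding W_def using that optional_nonneg[OF opt] by (intro continuous_path_shift) (auto simp: spV)
      show "(\<lambda>x. W x u) \<in> borel_measurable V" for u
        by (rule measurable_compose[OF W measurable_component_singleton]) simp
    qed simp
    have "B t x = B (min t (\<tau> x)) x + W x (max 0 (t - \<tau> x))" for x
      by (auto simp: W_def path_def min_def max_def)
    then have "B t = (\<lambda>x. B (min t (\<tau> x)) x + W x (max 0 (t - \<tau> x)))" by (rule ext)
    with borel_measurable_add[OF 1 2] show ?thesis by simp
  qed
  have F_V: "sets (F t) \<subseteq> sets V" for t
  proof -
    have "B s -` A \<inter> space M \<in> sets V" if "0 \<le> s" "A \<in> sets borel" for s A
      using measurable_sets[OF BV[OF that(1)] that(2)] by (simp only: spV)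
    then have "{B s -` A \<inter> space M | s A. 0 \<le> s \<and> ennreal s \<le> ennreal t \<and> A \<in> sets borel} \<union> null_sets M \<subseteq> sets V"
      using null Stopped_V by blast
    from sets.sigma_sets_subset[OF this] show ?thesis
      by (simp only: spV sets_completed_natural_filtration)
  qed
  have "C = (\<Union>n::nat. {x \<in> C. \<tau> x < real n})"
    using reals_Archimedean2 by auto
  also have "\<dots> \<in> sets V"
  proof (intro sets.countable_UN image_subsetI)
    fix n :: nat
    show "{x \<in> C. \<tau> x < real n} \<in> sets V"
      by (rule subsetD[OF F_V post_less[OF C]]) simp
  qed
  finally have "C \<in> sets V" .
  then obtain \<Gamma> where \<Gamma>: "\<Gamma> \<in> sets (Stopped \<tau> \<Otimes>\<^sub>M paths)" and C_eq: "C = (\<lambda>x. (x, W x)) -` \<Gamma> \<inter> space M"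
    unfolding V_def by (subst (asm) sets_vimage_algebra2) (auto simp: space_pair_measure)
  \<comment> \<open>\<open>g\<close> is the conditional probability of \<open>C\<close> given
    \<open>Stopped \<tau>\<close>. As \<open>C\<close> lies in \<open>post \<tau>\<close>,
    integrating \<open>g\<close> over \<open>C\<close> and over its complement forces
    \<open>g\<close> to be almost surely 1 on \<open>C\<close> and 0 off it.\<close>
  define g where "g x = emeasure law (Pair x -` \<Gamma>)" for x
  have g: "g \<in> borel_measurable (Stopped \<tau>)"
    unfolding g_def by (rule L.measurable_emeasure_Pair) (use \<Gamma> in \<open>simp cong: sets_pair_measure_cong\<close>)
  \<comment> \<open>The identity map, seen as a random variable with values in
    \<open>Stopped \<tau>\<close>, will be the known data \<open>X\<close> of
    \<open>post_path_product\<close>.\<close>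
  have idP: "(\<lambda>x. x) \<in> measurable (Post \<tau>) (Stopped \<tau>)"
  proof (rule measurableI)
    fix A assume A: "A \<in> sets (Stopped \<tau>)"
    then have "(\<lambda>x. x) -` A \<inter> space (Post \<tau>) = A"
      using sets.sets_into_space[OF A] by auto
    then show "(\<lambda>x. x) -` A \<inter> space (Post \<tau>) \<in> sets (Post \<tau>)"
      using A sets_Stopped_subset_post[OF opt] by (auto simp: sets_Post[OF opt])
  qed simp
  have gM: "g \<in> borel_measurable M"
    using measurable_compose[OF measurable_Post_imp[OF opt idP] g] by simp
  have Cev: "C \<in> events" by (rule post_events[OF C])
  have int: "emeasure M (D \<inter> C) = (\<integral>\<^sup>+x. g x * indicator D x \<partial>M)" if D: "D \<in> post \<tau>" for D
  proof -
    have "{x \<in> D. (x, path (\<tau> x) x) \<in> \<Gamma>} = D \<inter> C"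
      using D by (auto simp: C_eq W_def post_def)
    then show ?thesis
      using post_path_product[OF opt D idP \<Gamma>] by (simp add: g_def)
  qed
  interpret P: sigma_algebra "space M" "post \<tau>" by (rule sigma_algebra_post[OF opt])
  have "(\<integral>\<^sup>+x. g x * indicator (space M - C) x \<partial>M) = 0"
  proof -
    have "(space M - C) \<inter> C = {}" by blast
    then show ?thesis using int[OF P.compl_sets[OF C]] by (simp only: emeasure_empty)
  qed
  then have ae0: "AE x in M. x \<notin> C \<longrightarrow> g x = 0"
    using gM Cev by (subst (asm) nn_integral_0_iff_AE) (auto simp: indicator_def)
  have "(\<integral>\<^sup>+x. indicator C x - g x * indicator C x \<partial>M) =
      (\<integral>\<^sup>+x. indicator C x \<partial>M) - (\<integral>\<^sup>+x. g x * indicator C x \<partial>M)"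
  proof (rule nn_integral_diff)
    show "(\<integral>\<^sup>+x. g x * indicator C x \<partial>M) \<noteq> \<infinity>"
      using int[OF C] by (simp add: emeasure_eq_measure flip: int[OF C])
    show "AE x in M. g x * indicator C x \<le> indicator C x"
      by (intro AE_I2) (auto simp: indicator_def g_def L.emeasure_le_1)
  qed (use Cev gM in auto)
  also have "\<dots> = 0"
    using Cev by (simp add: emeasure_eq_measure flip: int[OF C])
  finally have ae1: "AE x in M. x \<in> C \<longrightarrow> 1 - g x = 0"
    using gM Cev by (subst (asm) nn_integral_0_iff_AE) (auto simp: indicator_def elim!: AE_mp)
  show ?thesis
  proof (rule sets_AE_cong[OF null space_Stopped])
    show "{x \<in> space (Stopped \<tau>). g x = 1} \<in> sets (Stopped \<tau>)"
      using g by measurable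
    show "C \<subseteq> space M" using C by (simp add: post_def)
    show "AE x in M. (x \<in> {x \<in> space (Stopped \<tau>). g x = 1}) = (x \<in> C)"
      using ae0 ae1 AE_space
    proof eventually_elim
      case (elim x)
      have "g x \<le> 1" by (simp add: g_def L.emeasure_le_1)
      then show ?case
        using elim by (auto simp: diff_eq_0_iff_ennreal)
    qed
  qed
qed

subsection \<open>Brownian motion with positive drift tends to infinity\<close>

lemma B_distributed:
  assumes "0 < t"
  shows "distributed M lborel (B t) (\<lambda>y. ennreal (normal_density 0 (sqrt t) y))"
proof -
  have D: "distributed M lborel (\<lambda>x. B t x - B 0 x) (\<lambda>y. ennreal (normal_density 0 (sqrt (t - 0)) y))"
    using brownian assms unfolding brownian_motion_def by blast
  have "distr M lborel (\<lambda>x. B t x - B 0 x) = distr M lborel (B t)"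
    by (rule distr_cong) (simp_all add: B_0)
  then show ?thesis
    using D B_measurable[of t] assms by (simp add: distributed_def)
qed

lemma prob_B_eq:
  assumes X: "distributed M lborel X (\<lambda>y. ennreal (normal_density 0 (sqrt t) y))" and t: "0 < t"
    and A: "A \<in> sets borel"
  shows "prob {x \<in> space M. X x \<in> A} = prob {x \<in> space M. B t x \<in> A}"
proof -
  have *: "measure (distr M lborel Y) A = prob {x \<in> space M. Y x \<in> A}" if "Y \<in> measurable M lborel" for Y
    using that A by (subst measure_distr) (auto intro!: arg_cong[where f = prob])
  have "distr M lborel X = distr M lborel (B t)"
    using X B_distributed[OF t] by (simp add: distributed_def)
  then show ?thesis
    using *[of X] *[of "B t"] X B_distributed[OF t] by (simp only: distributed_def)
qed

text \<open>Symmetry of the normal law: the events for \<open>B t\<close> and \<open>- B t\<close>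
  are equally likely and cover the space. Time 0 is included for the last grid point in the maximal
  inequality.\<close>

lemma B_half:
  assumes "0 \<le> t"
  shows "1 / 2 \<le> prob {x \<in> space M. B t x \<le> 0}"
proof (cases "t = 0")
  case True
  then have "{x \<in> space M. B t x \<le> 0} = space M" by (auto simp: B_0)
  then show ?thesis by (simp add: prob_space)
next
  case False
  with assms have t: "0 < t" by simp
  have Bt [measurable]: "B t \<in> borel_measurable M" using t by (simp add: B_measurable)
  have "distributed M lborel (\<lambda>x. 0 + (-1) * B t x) (normal_density (0 + (-1) * 0) (\<bar>-1\<bar> * sqrt t))"
    by (rule normal_density_affine[OF B_distributed[OF t]]) (use t in auto)
  then have "prob {x \<in> space M. - B t x \<in> {..0}} = prob {x \<in> space M. B t x \<in> {..0}}"
    by (intro prob_B_eq t) auto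
  moreover have "1 = prob ({x \<in> space M. - B t x \<in> {..0}} \<union> {x \<in> space M. B t x \<in> {..0}})"
    by (subst prob_space[symmetric]) (intro arg_cong[where f = prob], auto)
  moreover have "\<dots> \<le> prob {x \<in> space M. - B t x \<in> {..0}} + prob {x \<in> space M. B t x \<in> {..0}}"
    by (rule measure_Un_le) measurable
  ultimately show ?thesis by simp
qed

text \<open>Chebyshev's inequality is sharp enough: the level \<open>c\<close> will be proportional
  to \<open>t\<close>, and the resulting bound of order \<open>1/t\<close> is summable along powers
  of two.\<close>

lemma prob_B_tail:
  assumes t: "0 < t" and c: "0 < c"
  shows "prob {x \<in> space M. B t x < - c} \<le> t / c\<^sup>2"
proof -
  have Bt [measurable]: "B t \<in> borel_measurable M" using t by (simp add: B_measurable)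
  have st: "0 < sqrt t" using t by simp
  have "integrable lborel (\<lambda>y. normal_density 0 (sqrt t) y * (y - 0)^2)"
    by (rule integrable_normal_moment) (rule st)
  then have int: "integrable M (\<lambda>x. (B t x)\<^sup>2)"
    by (subst distributed_integrable[OF B_distributed[OF t], of "\<lambda>y. y\<^sup>2", symmetric])
       (auto simp: normal_density_nonneg)
  have "expectation (B t) = 0" "variance (B t) = t"
    using normal_distributed_expectation[OF st B_distributed[OF t]]
      normal_distributed_variance[OF st B_distributed[OF t]] t by auto
  then have "prob {x \<in> space M. c \<le> \<bar>B t x\<bar>} \<le> t / c\<^sup>2"
    using Chebyshev_inequality[OF Bt int c] by simp
  moreover have "prob {x \<in> space M. B t x < - c} \<le> prob {x \<in> space M. c \<le> \<bar>B t x\<bar>}"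
    by (intro finite_measure_mono) auto
  ultimately show ?thesis by linarith
qed

text \<open>Brownian scaling: \<open>B u\<close> has the law of \<open>sqrt u * B 1\<close>, and
  \<open>u \<le> sqrt u\<close> on the unit interval, so the probability at time 1 is a lower bound
  at all earlier times.\<close>

lemma B_below_line_bounded_away:
  obtains \<delta> where "0 < \<delta>" "\<And>u. 0 < u \<Longrightarrow> u \<le> 1 \<Longrightarrow> \<delta> \<le> prob {x \<in> space M. B u x < - \<bar>c\<bar> * u}"
proof
  define \<delta> where "\<delta> = prob {x \<in> space M. B 1 x \<in> {..<-\<bar>c\<bar>}}"
  have B1 [measurable]: "B 1 \<in> borel_measurable M" by (simp add: B_measurable)
  have "emeasure M (B 1 -` {..<-\<bar>c\<bar>} \<inter> space M) \<noteq> 0"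
  proof
    assume "emeasure M (B 1 -` {..<-\<bar>c\<bar>} \<inter> space M) = 0"
    then have "(\<integral>\<^sup>+y. ennreal (normal_density 0 (sqrt 1) y) * indicator {..<-\<bar>c\<bar>} y \<partial>lborel) = 0"
      by (subst (asm) distributed_emeasure[OF B_distributed]) auto
    then have "AE y in lborel. ennreal (normal_density 0 (sqrt 1) y) * indicator {..<-\<bar>c\<bar>} y = 0"
      by (subst (asm) nn_integral_0_iff_AE) auto
    then have "AE y in lborel. y \<notin> {..<-\<bar>c\<bar>}"
    proof eventually_elim
      case (elim y)
      have "0 < normal_density 0 1 y" by (rule normal_density_pos) simp
      then show ?case using elim by (auto simp: indicator_def)
    qed
    then have "AE y in lborel. y \<notin> {-\<bar>c\<bar> - 1..-\<bar>c\<bar> - 1 / 2}"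
      by eventually_elim auto
    then have "{-\<bar>c\<bar> - 1..-\<bar>c\<bar> - 1 / 2} \<in> null_sets lborel"
      using Measure_Space.AE_iff_null_sets[of "{-\<bar>c\<bar> - 1..-\<bar>c\<bar> - 1 / 2}" lborel] by simp
    then have "emeasure lborel {-\<bar>c\<bar> - 1..-\<bar>c\<bar> - 1 / 2} = 0" by (rule null_setsD1)
    then show False by (subst (asm) emeasure_lborel_Icc) auto
  qed
  then show "0 < \<delta>"
    by (simp add: \<delta>_def emeasure_eq_measure vimage_def Int_def conj_commute zero_less_measure_iff)
  fix u :: real assume u: "0 < u" "u \<le> 1"
  have Bu [measurable]: "B u \<in> borel_measurable M" using u by (simp add: B_measurable)
  have su: "0 < sqrt u" "sqrt u \<le> 1" "sqrt u * sqrt u = u" using u by auto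
  have "distributed M lborel (\<lambda>x. 0 + sqrt u * B 1 x) (normal_density (0 + sqrt u * 0) (\<bar>sqrt u\<bar> * sqrt 1))"
    by (rule normal_density_affine[OF B_distributed]) (use u in auto)
  then have "prob {x \<in> space M. sqrt u * B 1 x \<in> {..<-\<bar>c\<bar> * u}} = prob {x \<in> space M. B u x \<in> {..<-\<bar>c\<bar> * u}}"
    using u by (intro prob_B_eq) auto
  moreover have "\<delta> \<le> prob {x \<in> space M. sqrt u * B 1 x \<in> {..<-\<bar>c\<bar> * u}}"
    unfolding \<delta>_def
  proof (intro finite_measure_mono subsetI)
    fix x assume "x \<in> {x \<in> space M. B 1 x \<in> {..<-\<bar>c\<bar>}}"
    then have x: "x \<in> space M" "B 1 x < - \<bar>c\<bar>" by auto
    have "sqrt u * B 1 x < sqrt u * (- \<bar>c\<bar>)"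
      using x(2) su(1) by (rule mult_strict_left_mono)
    also have "\<dots> \<le> - \<bar>c\<bar> * u"
    proof -
      have "\<bar>c\<bar> * u = (\<bar>c\<bar> * sqrt u) * sqrt u" by (simp only: mult.assoc su(3))
      also have "\<dots> \<le> (\<bar>c\<bar> * sqrt u) * 1" using su by (intro mult_left_mono) auto
      finally show ?thesis by (simp add: mult.commute)
    qed
    finally show "x \<in> {x \<in> space M. sqrt u * B 1 x \<in> {..<-\<bar>c\<bar> * u}}"
      using x(1) by simp
  qed measurable
  ultimately show "\<delta> \<le> prob {x \<in> space M. B u x < - \<bar>c\<bar> * u}" by simp
qed

lemma AE_B_notin_countable:
  assumes t: "0 < t" and S: "countable S"
  shows "AE x in M. B t x \<notin> S"
proof -
  have "AE y in lborel. y \<notin> S"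
    using countable_imp_null_set_lborel[OF S] by (rule AE_not_in)
  then have "AE y in density lborel (\<lambda>y. ennreal (normal_density 0 (sqrt t) y)). y \<notin> S"
    by (subst AE_density) auto
  then have "AE y in distr M lborel (B t). y \<notin> S"
    using B_distributed[OF t] by (simp only: distributed_def)
  then show ?thesis
    by (rule AE_distrD[rotated]) (use B_measurable[of t] t in simp)
qed

text \<open>
  Levy's maximal inequality: after the first time the walk is below the level, it stays below its
  current value with probability at least one half.
\<close>

lemma grid_maximal_inequality:
  assumes h: "0 \<le> h"
  shows "prob (\<Union>k\<le>n. {x \<in> space M. B (real k * h) x < - c}) \<le> 2 * prob {x \<in> space M. B (real n * h) x < - c}"
proof -
  define S where "S k = {x \<in> space M. B (real k * h) x < - c}" for k :: nat
  \<comment> \<open>\<open>D k\<close>: the walk is below the level at step \<open>k\<close> for the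
    first time.\<close>
  define D where "D = disjointed S"
  have S: "S k \<in> sets (F (real k * h))" for k
  proof -
    have "B (real k * h) \<in> borel_measurable (F (real k * h))"
      using h by (intro measurable_completed_natural_filtration) auto
    from measurable_sets[OF this, of "{..<-c}"] show ?thesis
      by (simp add: S_def vimage_def Int_def conj_commute)
  qed
  have D: "D k \<in> sets (F (real k * h))" for k
    unfolding D_def disjointed_def
  proof (intro sets.Diff sets.finite_UN S)
    fix i assume "i \<in> {0..<k}"
    then show "S i \<in> sets (F (real k * h))"
      using h by (intro completed_natural_filtration_mono[OF S] ennreal_leI mult_right_mono) auto
  qed simp
  have Dev: "D k \<in> events" for k by (rule sets_F_subset[OF D])
  have disj: "disjoint_family D" by (simp add: D_def disjoint_family_disjointed)
  define N where "N k = {x \<in> D k. path (real k * h) x (real (n - k) * h) \<le> 0}" for k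
  have G: "{w. w u \<le> 0} \<in> sets paths" for u :: real
    using half_boxes_measurable[of "{w. \<forall>u\<in>{u}. w u \<le> 0}"] unfolding half_boxes_def by fastforce
  have N_prob: "prob (D k) / 2 \<le> prob (N k)" for k
  proof -
    have "prob (N k) = prob (D k) * measure law {w. w (real (n - k) * h) \<le> 0}"
      unfolding N_def using simple_markov[OF _ D[of k] G[of "real (n - k) * h"]] h by simp
    moreover have "1 / 2 \<le> measure law {w. w (real (n - k) * h) \<le> 0}"
    proof -
      have "measure law {w. w (real (n - k) * h) \<le> 0} = prob {x \<in> space M. B (real (n - k) * h) x \<le> 0}"
        unfolding measure_law[OF G] using h
        by (intro arg_cong[where f = prob]) (auto simp: path_def B_0)
      then show ?thesis using B_half[of "real (n - k) * h"] h by simp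
    qed
    then have "prob (D k) * (1 / 2) \<le> prob (D k) * measure law {w. w (real (n - k) * h) \<le> 0}"
      by (intro mult_left_mono) auto
    ultimately show ?thesis by simp
  qed
  have Nev: "N k \<in> events" for k
  proof -
    have "{x \<in> space M. path (real k * h) x (real (n - k) * h) \<le> 0} \<in> events"
      using measurable_sets[OF path_measurable_const[of "real k * h"] G] h
      by (simp add: vimage_def Int_def conj_commute)
    moreover have "N k = D k \<inter> {x \<in> space M. path (real k * h) x (real (n - k) * h) \<le> 0}"
      using sets.sets_into_space[OF Dev] by (auto simp: N_def)
    ultimately show ?thesis using Dev by simp
  qed
  have disjN: "disjoint_family_on N {0..<Suc n}"
    using disj by (auto simp: disjoint_family_on_def N_def)
  have "(\<Union>k\<le>n. S k) = (\<Union>k\<in>{0..<Suc n}. D k)"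
    using finite_UN_disjointed_eq[of S "Suc n"]
    by (simp only: D_def atLeast0LessThan lessThan_Suc_atMost)
  then have "prob (\<Union>k\<le>n. S k) = prob (\<Union>k\<in>{0..<Suc n}. D k)" by simp
  also have "\<dots> = (\<Sum>k\<in>{0..<Suc n}. prob (D k))"
    by (rule finite_measure_finite_Union) (use disj Dev in \<open>auto simp: disjoint_family_on_def\<close>)
  also have "\<dots> \<le> (\<Sum>k\<in>{0..<Suc n}. 2 * prob (N k))"
    using N_prob by (intro sum_mono) (simp add: field_simps)
  also have "\<dots> = 2 * prob (\<Union>k\<in>{0..<Suc n}. N k)"
    unfolding sum_distrib_left[symmetric]
    by (subst finite_measure_finite_Union) (use disjN Nev in auto)
  also have "\<dots> \<le> 2 * prob (S n)"
  proof (intro mult_left_mono finite_measure_mono UN_least)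
    fix k assume k: "k \<in> {0..<Suc n}"
    show "N k \<subseteq> S n"
    proof
      fix x assume x: "x \<in> N k"
      then have "x \<in> S k" using disjointed_subset[of S k] by (auto simp: N_def D_def)
      moreover have "real k * h + real (n - k) * h = real n * h"
        using k by (simp flip: distrib_right of_nat_add)
      ultimately show "x \<in> S n" using x h by (auto simp: N_def S_def path_def)
    qed
  qed (use sets_F_subset[OF S] in auto)
  finally show ?thesis by (simp add: S_def)
qed

text \<open>Dyadic fractions of \<open>T\<close> keep the event measurable; since the inequality is
  strict, continuity recovers all other times in \<open>[0, T]\<close>.\<close>

definition dips :: "real \<Rightarrow> real \<Rightarrow> 'a set" where
  "dips T c = (\<Union>j. \<Union>k\<le>2^j. {x \<in> space M. B (real k * (T / 2^j)) x < - c})"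

lemma dips_events:
  assumes "0 \<le> T"
  shows "(\<Union>k\<le>n. {x \<in> space M. B (real k * (T / 2^j)) x < - c}) \<in> events" "dips T c \<in> events"
proof -
  have "{x \<in> space M. B (real k * (T / 2^j)) x < - c} \<in> events" for k j :: nat
  proof -
    have "B (real k * (T / 2^j)) \<in> borel_measurable M" using assms by (intro B_measurable) simp
    then show ?thesis by measurable
  qed
  then show "(\<Union>k\<le>n. {x \<in> space M. B (real k * (T / 2^j)) x < - c}) \<in> events" for n j :: nat
    by (intro sets.finite_UN) auto
  then show "dips T c \<in> events" unfolding dips_def by (intro sets.countable_UN) auto
qed

text \<open>The maximal inequality gives a bound independent of the mesh, and the grids are nested,
  so it survives the limit.\<close>

lemma prob_dips:
  assumes T: "0 < T" and c: "0 < c"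
  shows "prob (dips T c) \<le> 2 * T / c\<^sup>2"
proof -
  define E where "E j = (\<Union>k\<le>2^j. {x \<in> space M. B (real k * (T / 2^j)) x < - c})" for j :: nat
  have E: "E j \<in> events" for j unfolding E_def using T by (intro dips_events) simp
  have "incseq E"
  proof (rule incseq_SucI)
    fix j
    have "{x \<in> space M. B (real k * (T / 2^j)) x < - c} \<subseteq> E (Suc j)" if "k \<le> 2^j" for k
    proof -
      have "real k * (T / 2^j) = real (2 * k) * (T / 2^Suc j)" by simp
      then show ?thesis unfolding E_def using that by (intro subsetI UN_I[of "2 * k"]) auto
    qed
    then show "E j \<subseteq> E (Suc j)" unfolding E_def[of j] by blast
  qed
  then have "(\<lambda>j. prob (E j)) \<longlonglongrightarrow> prob (\<Union>j. E j)"
    using E by (intro finite_Lim_measure_incseq) auto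
  moreover have "prob (E j) \<le> 2 * T / c\<^sup>2" for j
    using grid_maximal_inequality[where h = "T / 2^j" and n = "2^j" and c = c] prob_B_tail[OF T c] T by (simp add: E_def)
  ultimately have "prob (\<Union>j. E j) \<le> 2 * T / c\<^sup>2"
    by (intro LIMSEQ_le_const2) auto
  then show ?thesis by (simp add: dips_def E_def)
qed

lemma in_dips:
  assumes x: "x \<in> space M" and s: "0 \<le> s" "s \<le> T" and T: "0 < T" and less: "B s x < - c"
  shows "x \<in> dips T c"
\<comment> \<open>Dyadic approximation from above would leave \<open>[0, T]\<close> at
  \<open>s = T\<close>, but \<open>T\<close> is itself a point of the coarsest grid.\<close>
proof (cases "s = T")
  case True
  then have "x \<in> (\<Union>k\<le>2^0. {x \<in> space M. B (real k * (T / 2^0)) x < - c})"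
    using less x by (intro UN_I[of 1]) auto
  then show ?thesis unfolding dips_def by blast
next
  case False
  have q: "0 \<le> s / T" "s / T < 1" using s T False by auto
  have "(\<lambda>n. dyadic_above n (s / T) * T) \<longlonglongrightarrow> s / T * T"
    by (intro tendsto_mult dyadic_above_LIMSEQ q tendsto_const)
  then have "(\<lambda>n. B (dyadic_above n (s / T) * T) x) \<longlonglongrightarrow> B s x"
    using T s by (intro continuous_path x) (auto intro: less_imp_le dyadic_above_pos mult_nonneg_nonneg)
  from order_tendstoD(2)[OF this less]
  obtain n where n: "B (dyadic_above n (s / T) * T) x < - c"
    unfolding eventually_sequentially by blast
  define k where "k = Suc (nat \<lfloor>2^n * (s / T)\<rfloor>)"
  have "\<lfloor>2^n * (s / T)\<rfloor> < 2^n"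
    using mult_strict_left_mono[OF q(2), of "2^n"] by (simp add: floor_less_iff)
  then have k: "k \<le> 2^n" using q by (simp add: k_def Suc_le_eq nat_less_iff)
  have "dyadic_above n (s / T) * T = real k * (T / 2^n)"
    by (simp add: dyadic_above_def k_def add.commute)
  then have "x \<in> (\<Union>k\<le>2^n. {x \<in> space M. B (real k * (T / 2^n)) x < - c})"
    using n x k by (intro UN_I[of k]) auto
  then show ?thesis unfolding dips_def by blast
qed

text \<open>Borel-Cantelli on dyadic blocks of time: from some block on, \<open>B\<close> loses at
  most half of what the drift has gained, so the path stays above the line of slope
  \<open>lam / 2\<close>.\<close>

lemma AE_drift_at_top:
  assumes lam: "0 < lam"
  shows "AE x in M. filterlim (\<lambda>t. B t x + lam * t) at_top at_top"
proof -
  \<comment> \<open>The level is half the drift accumulated by time \<open>2^m\<close>, the start of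
    the block that ends at \<open>2^Suc m\<close>.\<close>
  define A where "A m = dips (2^Suc m) (lam * 2^m / 2)" for m :: nat
  have A: "A m \<in> events" for m unfolding A_def by (intro dips_events) simp
  have bound: "prob (A m) \<le> 16 / lam\<^sup>2 * (1/2)^m" for m
  proof -
    have "prob (A m) \<le> 2 * 2^Suc m / (lam * 2^m / 2)\<^sup>2"
      unfolding A_def using lam by (intro prob_dips) auto
    also have "\<dots> = 16 / lam\<^sup>2 * (1/2)^m"
      using lam by (simp add: field_simps power2_eq_square)
    finally show ?thesis .
  qed
  have "summable (\<lambda>m. prob (A m))"
  proof (rule summable_comparison_test')
    show "summable (\<lambda>m. 16 / lam\<^sup>2 * (1/2)^m)"
      by (intro summable_mult summable_geometric) simp
    show "norm (prob (A m)) \<le> 16 / lam\<^sup>2 * (1/2)^m" if "0 \<le> m" for m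
      unfolding real_norm_def abs_of_nonneg[OF measure_nonneg] by (rule bound)
  qed
  then have "AE x in M. eventually (\<lambda>m. x \<in> space M - A m) sequentially"
    by (intro borel_cantelli_AE1 A) (simp_all add: emeasure_eq_measure)
  then show ?thesis
  proof eventually_elim
    case (elim x)
    then obtain m0 where m0: "\<And>m. m0 \<le> m \<Longrightarrow> x \<in> space M \<and> x \<notin> A m"
      unfolding eventually_sequentially by blast
    have "lam / 2 * t \<le> B t x + lam * t" if t: "2^m0 \<le> t" for t
    proof -
      obtain n where "t < 2^n" using real_arch_pow[of 2 t] by auto
      also have "(2::real)^n \<le> 2^Suc n" by simp
      finally have ex: "\<exists>n. t < 2^Suc n" by blast
      define m where "m = (LEAST m. t < 2^Suc m)"
      have m: "t < 2^Suc m" unfolding m_def by (rule LeastI_ex[OF ex])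
      have m': "2^m \<le> t"
      proof (cases m)
        case 0
        then show ?thesis using t one_le_power[of "2::real" m0] by (simp del: one_le_power)
      next
        case (Suc m')
        then have "\<not> t < 2^Suc m'" unfolding m_def by (intro not_less_Least) simp
        then show ?thesis using Suc by simp
      qed
      have "(2::real)^m0 < 2^Suc m" using t m by linarith
      then have "m0 < Suc m" by (subst (asm) power_strict_increasing_iff) auto
      then have "x \<in> space M" "x \<notin> A m" using m0[of m] by auto
      moreover have "0 \<le> t" using m' by (meson order_trans zero_le_numeral zero_le_power)
      ultimately have "\<not> B t x < - (lam * 2^m / 2)"
        using in_dips[of x t "2^Suc m" "lam * 2^m / 2"] m by (auto simp: A_def)
      moreover have "lam * 2^m \<le> lam * t" using m' lam by (intro mult_left_mono) auto
      ultimately show ?thesis by simp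
    qed
    then have ev: "eventually (\<lambda>t. lam / 2 * t \<le> B t x + lam * t) at_top"
      unfolding eventually_at_top_linorder by blast
    have "filterlim (\<lambda>t. lam / 2 * t) at_top at_top"
      using lam by (intro filterlim_tendsto_pos_mult_at_top[OF tendsto_const] filterlim_ident) auto
    then show ?case
      by (rule filterlim_at_top_mono[OF _ ev])
  qed
qed

end

subsection \<open>The last passage time of Brownian motion with drift\<close>

locale drifted_brownian = continuous_brownian M B
  for M :: "'a measure" and B :: "real \<Rightarrow> 'a \<Rightarrow> real" +
  fixes lam z :: real
  assumes lam: "0 < lam" and z: "0 < z"
    and drift: "x \<in> space M \<Longrightarrow> filterlim (\<lambda>t. B t x + lam * t) at_top at_top"
begin

abbreviation X :: "real \<Rightarrow> 'a \<Rightarrow> real" where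
  "X \<equiv> drifted B lam"

definition last :: "'a \<Rightarrow> real" where
  "last x = Sup {t. 0 < t \<and> X t x = z}"

lemma continuous_X: "x \<in> space M \<Longrightarrow> continuous_on {0..} (\<lambda>t. X t x)"
  unfolding drifted_def by (intro continuous_intros continuous_B)

lemma X_0: "x \<in> space M \<Longrightarrow> X 0 x = 0"
  by (simp add: drifted_def B_0)

lemma X_unbounded:
  assumes "x \<in> space M"
  obtains T where "0 \<le> T" "\<And>t. T \<le> t \<Longrightarrow> y < X t x"
proof -
  have "eventually (\<lambda>t. y < B t x + lam * t) at_top"
    using drift[OF assms] by (auto simp: filterlim_at_top_dense)
  then obtain T where "\<And>t. T \<le> t \<Longrightarrow> y < B t x + lam * t"
    unfolding eventually_at_top_linorder by blast
  then show thesis by (intro that[of "max 0 T"]) (auto simp: drifted_def)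
qed

lemma X_hits_above:
  assumes x: "x \<in> space M" and s: "0 \<le> s" "X s x \<le> y"
  obtains t where "s \<le> t" "X t x = y"
proof -
  obtain T where T: "0 \<le> T" "\<And>t. T \<le> t \<Longrightarrow> y < X t x" using X_unbounded[OF x] by blast
  have "y \<le> X (max s T) x" using T(2)[of "max s T"] by simp
  moreover have "continuous_on {s..max s T} (\<lambda>t. X t x)"
    by (rule continuous_on_subset[OF continuous_X[OF x]]) (use s in auto)
  ultimately obtain t where "s \<le> t" "t \<le> max s T" "X t x = y"
    using IVT'[of "\<lambda>t. X t x" s y "max s T"] s(2) by auto
  then show thesis using that by blast
qed

text \<open>The set of visits to \<open>z\<close> is nonempty by the intermediate value theorem,
  bounded because the path tends to infinity, and closed by continuity, time 0 being excluded by
  \<open>z > 0\<close>. So the supremum is itself a visit.\<close>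

lemma last_props:
  assumes x: "x \<in> space M"
  shows "0 < last x" "X (last x) x = z" "\<And>t. 0 < t \<Longrightarrow> X t x = z \<Longrightarrow> t \<le> last x"
proof -
  define S where "S = {t. 0 < t \<and> X t x = z}"
  obtain t where t: "0 \<le> t" "X t x = z"
    using X_hits_above[OF x, of 0 z] X_0[OF x] z by auto
  moreover have "t \<noteq> 0" using t(2) X_0[OF x] z by auto
  ultimately have "t \<in> S" by (simp add: S_def)
  then have ne: "S \<noteq> {}" by auto
  obtain T where T: "0 \<le> T" "\<And>t. T \<le> t \<Longrightarrow> z < X t x" using X_unbounded[OF x] by blast
  have bdd: "bdd_above S"
  proof (rule bdd_aboveI)
    fix t assume "t \<in> S"
    then show "t \<le> T" using T(2)[of t] by (cases "T \<le> t") (auto simp: S_def)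
  qed
  have "S = {t \<in> {0..}. X t x = z}"
    using X_0[OF x] z by (auto simp: S_def le_less)
  then have "closed S"
    using continuous_closed_preimage_constant[OF continuous_X[OF x], of z] by simp
  then have "Sup S \<in> S" by (rule closed_contains_Sup[OF ne bdd])
  then show "0 < last x" "X (last x) x = z" by (simp_all add: last_def S_def)
  show "t \<le> last x" if "0 < t" "X t x = z" for t
    unfolding last_def S_def[symmetric] using that by (intro cSup_upper bdd) (simp add: S_def)
qed

lemma last_passage_eq:
  assumes x: "x \<in> space M"
  shows "last_passage X z x = ennreal (last x)"
  unfolding last_passage_def
proof (rule antisym)
  show "(SUP t\<in>{t. 0 < t \<and> X t x = z}. ennreal t) \<le> ennreal (last x)"
    by (intro SUP_least ennreal_leI) (use last_props(3)[OF x] in auto)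
  show "ennreal (last x) \<le> (SUP t\<in>{t. 0 < t \<and> X t x = z}. ennreal t)"
    by (intro SUP_upper) (use last_props(1,2)[OF x] in auto)
qed

lemma xi_eq:
  assumes x: "x \<in> space M" and t: "0 \<le> t"
  shows "xi B lam z t x = X (min t (last x)) x"
proof -
  have "min (ennreal t) (ennreal (last x)) = ennreal (min t (last x))"
    by (cases "t \<le> last x") (simp_all add: min_absorb1 min_absorb2 ennreal_leI)
  then show ?thesis
    using t last_props(1)[OF x] by (simp add: xi_def stopped_at_def last_passage_eq[OF x])
qed

lemma xi_before: "x \<in> space M \<Longrightarrow> 0 \<le> t \<Longrightarrow> t < last x \<Longrightarrow> xi B lam z t x = X t x"
  by (simp add: xi_eq min_absorb1)

lemma xi_after: "x \<in> space M \<Longrightarrow> last x \<le> t \<Longrightarrow> xi B lam z t x = z"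
  using last_props(1,2)[of x] by (simp add: xi_eq min_absorb2)

lemma continuous_xi:
  assumes x: "x \<in> space M"
  shows "continuous_on {0..} (\<lambda>t. xi B lam z t x)"
proof -
  have "continuous_on {0..} (\<lambda>t. X (min t (last x)) x)"
    using last_props(1)[OF x] by (intro continuous_on_path_min continuous_X[OF x]) simp
  then show ?thesis
    by (rule continuous_on_eq) (simp add: xi_eq[OF x])
qed

section \<open>The infimum of the path after a given time\<close>

text \<open>The infimum is restricted to dyadic times to make it measurable on path space.\<close>

definition low :: "(real \<Rightarrow> real) \<Rightarrow> ereal" where
  "low w = (INF p. ereal (w (real (fst p) / 2 ^ snd p) + lam * (real (fst p) / 2 ^ snd p)))"

lemma low_measurable: "low \<in> borel_measurable paths"
  unfolding low_def by measurable

text \<open>By continuity the dyadic infimum is the infimum over all times. It is attained, because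
  the path tends to infinity; therefore \<open>\<le>\<close> yields an actual time and not only
  approximate ones.\<close>

lemma low_path_le_iff:
  assumes x: "x \<in> space M" and r: "0 \<le> r"
  shows "low (path r x) \<le> ereal y \<longleftrightarrow> (\<exists>u\<ge>0. X (r + u) x - X r x \<le> y)"
proof -
  define f where "f u = path r x u + lam * u" for u
  have f: "f u = X (r + u) x - X r x" if "0 \<le> u" for u
    using that by (simp add: f_def path_def drifted_def algebra_simps)
  have contf: "continuous_on A f" for A
    unfolding f_def by (intro continuous_intros continuous_path_shift x r)
  have low_le: "low (path r x) \<le> ereal (f (real k / 2^n))" for k n
    unfolding low_def f_def by (rule INF_lower2[of "(k, n)"]) auto
  show ?thesis
  proof
    assume "\<exists>u\<ge>0. X (r + u) x - X r x \<le> y"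
    then obtain u where u: "0 \<le> u" "f u \<le> y" using f by auto
    have "(\<lambda>n. f (dyadic_above n u)) \<longlonglongrightarrow> f u"
      by (rule continuous_on_tendsto_compose[OF contf[of UNIV] dyadic_above_LIMSEQ[OF u(1)]]) auto
    then have "(\<lambda>n. ereal (f (dyadic_above n u))) \<longlonglongrightarrow> ereal (f u)"
      by (rule tendsto_ereal)
    moreover have "low (path r x) \<le> ereal (f (dyadic_above n u))" for n
      using low_le[of "Suc (nat \<lfloor>2^n * u\<rfloor>)" n] by (simp add: dyadic_above_def add.commute)
    ultimately have "low (path r x) \<le> ereal (f u)"
      by (intro LIMSEQ_le_const) blast+
    also have "\<dots> \<le> ereal y" using u by simp
    finally show "low (path r x) \<le> ereal y" .
  next
    assume low: "low (path r x) \<le> ereal y"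
    show "\<exists>u\<ge>0. X (r + u) x - X r x \<le> y"
    proof (rule ccontr)
      assume "\<not> ?thesis"
      then have gt: "y < f u" if "0 \<le> u" for u using f that by force
      \<comment> \<open>The margin 1 keeps the increments after \<open>T\<close> away from
        \<open>y\<close>, so the minimum over the compact interval \<open>{0..T}\<close>
        decides.\<close>
      obtain T where T: "0 \<le> T" "\<And>t. T \<le> t \<Longrightarrow> y + 1 + X r x < X t x"
        using X_unbounded[OF x] by blast
      obtain u0 where u0: "u0 \<in> {0..T}" "\<And>u. u \<in> {0..T} \<Longrightarrow> f u0 \<le> f u"
        using continuous_attains_inf[of "{0..T}" f] contf T(1) by auto
      have "min (f u0) (y + 1) \<le> f u" if u: "0 \<le> u" for u
      proof (cases "u \<le> T")
        case True
        then show ?thesis using u0(2)[of u] u by simp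
      next
        case False
        then have "y + 1 + X r x < X (r + u) x" using r by (intro T(2)) simp
        then show ?thesis using f[OF u] by simp
      qed
      then have "ereal (min (f u0) (y + 1)) \<le> low (path r x)"
        unfolding low_def f_def[symmetric] by (intro INF_greatest iffD2[OF ereal_less_eq(3)]) simp
      with low have "min (f u0) (y + 1) \<le> y" by (simp flip: ereal_less_eq(3))
      then show False using gt[of u0] u0(1) by (auto simp: min_def split: if_splits)
    qed
  qed
qed

lemma low_path_ge_iff:
  assumes x: "x \<in> space M" and r: "0 \<le> r"
  shows "ereal y \<le> low (path r x) \<longleftrightarrow> (\<forall>u\<ge>0. y \<le> X (r + u) x - X r x)"
proof
  assume ge: "ereal y \<le> low (path r x)"
  show "\<forall>u\<ge>0. y \<le> X (r + u) x - X r x"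
  proof (intro allI impI)
    fix u :: real assume "0 \<le> u"
    then have "low (path r x) \<le> ereal (X (r + u) x - X r x)"
      using low_path_le_iff[OF x r] by blast
    with ge have "ereal y \<le> ereal (X (r + u) x - X r x)" by (rule order_trans)
    then show "y \<le> X (r + u) x - X r x" by simp
  qed
next
  assume ge: "\<forall>u\<ge>0. y \<le> X (r + u) x - X r x"
  show "ereal y \<le> low (path r x)"
  proof (rule ccontr)
    assume "\<not> ereal y \<le> low (path r x)"
    then have "low (path r x) < ereal y" by simp
    then obtain c where c: "low (path r x) < ereal c" "ereal c < ereal y" using ereal_dense2 by blast
    then obtain u where "0 \<le> u" "X (r + u) x - X r x \<le> c"
      using low_path_le_iff[OF x r, of c] by auto
    then show False using ge c(2) by force
  qed
qed

lemma X_measurable: "0 \<le> t \<Longrightarrow> X t \<in> borel_measurable (F t)"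
  unfolding drifted_def[abs_def]
  by (intro borel_measurable_add borel_measurable_const measurable_completed_natural_filtration) auto

lemma X_measurable_M: "0 \<le> t \<Longrightarrow> X t \<in> borel_measurable M"
  by (rule measurable_F_imp[OF X_measurable])

lemma at_optional_measurable:
  assumes opt: "optional \<tau>"
  shows "(\<lambda>x. X (\<tau> x) x) \<in> borel_measurable (Post \<tau>)"
proof -
  have sub: "sets (Stopped \<tau>) \<subseteq> sets (Post \<tau>)"
    using sets_Stopped_subset_post[OF opt] by (simp add: sets_Post[OF opt])
  have mono: "f \<in> borel_measurable (Post \<tau>)" if "f \<in> borel_measurable (Stopped \<tau>)" for f :: "'a \<Rightarrow> real"
    using that sub by (auto simp: measurable_def)
  have "(\<lambda>x. B (\<tau> x) x) \<in> borel_measurable (Post \<tau>)"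
  proof (rule borel_measurable_LIMSEQ_real)
    show "(\<lambda>x. B (min (real n) (\<tau> x)) x) \<in> borel_measurable (Post \<tau>)" for n
      by (intro mono measurable_Stopped) simp
    fix x
    obtain N :: nat where N: "\<tau> x < real N" using reals_Archimedean2 by blast
    have "eventually (\<lambda>n. B (min (real n) (\<tau> x)) x = B (\<tau> x) x) sequentially"
      using eventually_ge_at_top[of N]
    proof eventually_elim
      case (elim n)
      then have "min (real n) (\<tau> x) = \<tau> x" using N by simp
      then show ?case by simp
    qed
    then show "(\<lambda>n. B (min (real n) (\<tau> x)) x) \<longlonglongrightarrow> B (\<tau> x) x"
      by (rule tendsto_eventually)
  qed
  moreover have "\<tau> \<in> borel_measurable (Post \<tau>)" by (intro mono measurable_Stopped)
  ultimately show ?thesis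
    unfolding drifted_def by (intro borel_measurable_add borel_measurable_times borel_measurable_const)
qed

lemma low_path_events: "{w. low w \<le> ereal y} \<in> sets paths" "{w. low w = ereal y} \<in> sets paths"
  using measurable_sets[OF low_measurable, of "{..ereal y}"] measurable_sets[OF low_measurable, of "{ereal y}"]
  by (simp_all add: vimage_def)

section \<open>The overall infimum has no atoms\<close>

text \<open>At this stage the law of \<open>low\<close> might have atoms, but only countably many.
  \<open>X h\<close> has a density and is independent of the path after \<open>h\<close>, so
  \<open>y - X h\<close> almost surely misses all of them.\<close>

lemma AE_low_path_shift_neq:
  assumes h: "0 < h"
  shows "AE x in M. low (path h x) \<noteq> ereal (y - X h x)"
proof -
  interpret L: prob_space law by (rule prob_space_law)
  interpret D: finite_measure "distr law borel low"
    by (intro L.finite_measure_distr) (simp add: low_measurable cong: measurable_cong_sets)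
  have lowL: "low \<in> borel_measurable law" using low_measurable by (simp cong: measurable_cong_sets)
  \<comment> \<open>The values of \<open>B h\<close> for which \<open>y - X h\<close> would be an
    atom, with \<open>X h = B h + lam * h\<close> solved for \<open>B h\<close>.\<close>
  define S where "S = (\<lambda>e. y - real_of_ereal e - lam * h) ` {e. measure (distr law borel low) {e} \<noteq> 0}"
  have S: "countable S" unfolding S_def by (intro countable_image D.countable_support)
  have opt: "optional (\<lambda>_. h)" using h by (intro optional_const) simp
  define \<Gamma> where "\<Gamma> = {p \<in> space (borel \<Otimes>\<^sub>M paths). low (snd p) = ereal (y - fst p)}"
  have lowP [measurable]: "(\<lambda>p. low (snd p)) \<in> borel_measurable (borel \<Otimes>\<^sub>M paths)"
    by (rule measurable_compose[OF measurable_snd low_measurable])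
  have \<Gamma>: "\<Gamma> \<in> sets (borel \<Otimes>\<^sub>M paths)" unfolding \<Gamma>_def by measurable
  have vim: "Pair r -` \<Gamma> = {w. low w = ereal (y - r)}" for r
    by (auto simp: \<Gamma>_def space_pair_measure)
  have "AE x in M. emeasure law (Pair (X h x) -` \<Gamma>) * indicator (space M) x = 0"
    using AE_B_notin_countable[OF h S]
  proof eventually_elim
    case (elim x)
    have "measure (distr law borel low) {ereal (y - X h x)} = 0"
    proof (rule ccontr)
      assume "measure (distr law borel low) {ereal (y - X h x)} \<noteq> 0"
      then have "y - real_of_ereal (ereal (y - X h x)) - lam * h \<in> S" unfolding S_def by blast
      then show False using elim by (simp add: drifted_def)
    qed
    then have "measure law {w. low w = ereal (y - X h x)} = 0"
      by (subst (asm) measure_distr[OF lowL]) (auto simp: vimage_def)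
    then show ?case by (simp add: vim L.emeasure_eq_measure)
  qed
  then have "(\<integral>\<^sup>+x. emeasure law (Pair (X h x) -` \<Gamma>) * indicator (space M) x \<partial>M) = 0"
    by (subst nn_integral_cong_AE[where v = "\<lambda>_. 0"]) auto
  then have "emeasure M {x \<in> space M. (X h x, path h x) \<in> \<Gamma>} = 0"
    using post_path_product[OF opt space_in_post[OF opt] at_optional_measurable[OF opt] \<Gamma>] by simp
  moreover have "{x \<in> space M. (X h x, path h x) \<in> \<Gamma>} \<in> events"
  proof -
    have "(\<lambda>x. (X h x, path h x)) \<in> measurable M (borel \<Otimes>\<^sub>M paths)"
      using h by (intro measurable_Pair X_measurable_M path_measurable_const) auto
    from measurable_sets[OF this \<Gamma>] show ?thesis by (simp add: vimage_def Int_def conj_commute)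
  qed
  ultimately have "AE x in M. \<not> (X h x, path h x) \<in> \<Gamma>"
    by (subst AE_iff_measurable[OF _ refl]) auto
  then show ?thesis by eventually_elim (auto simp: \<Gamma>_def space_pair_measure)
qed

lemma measure_law_eq_0I:
  assumes G: "G \<in> sets paths" and ae: "AE x in M. path 0 x \<notin> G"
  shows "measure law G = 0"
proof -
  have "{x \<in> space M. path 0 x \<in> G} \<in> events"
    using measurable_sets[OF path_measurable_const[of 0] G] by (simp add: vimage_def Int_def conj_commute)
  then have "emeasure M {x \<in> space M. path 0 x \<in> G} = 0"
    using ae AE_iff_measurable[of "{x \<in> space M. path 0 x \<in> G}" M "\<lambda>x. path 0 x \<notin> G"] by simp
  then have "prob {x \<in> space M. path 0 x \<in> G} = 0" by (simp add: measure_def)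
  then show ?thesis by (simp add: measure_law[OF G])
qed

text \<open>
  Blumenthal's argument: the event that \<open>X\<close> is nonnegative near 0 lies in \<open>\<F>\<^bsub>0+\<^esub>\<close>, hence is
  independent of \<open>X u\<close>, which is negative with probability bounded away from 0 as \<open>u\<close> decreases to 0.
\<close>

lemma AE_low_path_neq_0: "AE x in M. low (path 0 x) \<noteq> ereal 0"
proof -
  define d where "d p = real (fst p) / 2 ^ snd p" for p :: "nat \<times> nat"
  define E where "E n = {x \<in> space M. \<forall>p. 0 < d p \<and> d p < 1 / real (Suc n) \<longrightarrow> 0 \<le> X (d p) x}" for n
  define E0 where "E0 = (\<Union>n. E n)"
  have d0: "0 \<le> d p" for p by (simp add: d_def)
  have mono: "E m \<subseteq> E n" if "m \<le> n" for m n
  proof -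
    have "1 / real (Suc n) \<le> 1 / real (Suc m)" using that by (intro divide_left_mono) auto
    then show ?thesis unfolding E_def by force
  qed
  have En: "E n \<in> sets (F t)" if "1 / real (Suc n) \<le> t" for n t
  proof -
    have "{x \<in> space (F t). 0 < d p \<and> d p < 1 / real (Suc n) \<longrightarrow> 0 \<le> X (d p) x} \<in> sets (F t)" for p
    proof (cases "0 < d p \<and> d p < 1 / real (Suc n)")
      case True
      then have dt: "d p \<le> t" using that by simp
      have "{x \<in> space (F (d p)). 0 \<le> X (d p) x} \<in> sets (F (d p))"
        using measurable_sets[OF X_measurable[OF d0], of "{0..}" p] by (simp add: vimage_def Int_def conj_commute)
      then have "{x \<in> space M. 0 \<le> X (d p) x} \<in> sets (F t)"
        unfolding space_completed_natural_filtration
        by (rule completed_natural_filtration_mono) (rule ennreal_leI[OF dt])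
      moreover have "{x \<in> space (F t). 0 < d p \<and> d p < 1 / real (Suc n) \<longrightarrow> 0 \<le> X (d p) x} = {x \<in> space M. 0 \<le> X (d p) x}"
        using True by auto
      ultimately show ?thesis by (simp only:)
    next
      case False
      then have "{x \<in> space (F t). 0 < d p \<and> d p < 1 / real (Suc n) \<longrightarrow> 0 \<le> X (d p) x} = space (F t)"
        by auto
      then show ?thesis by (simp only: sets.top)
    qed
    then have "{x \<in> space (F t). \<forall>p. 0 < d p \<and> d p < 1 / real (Suc n) \<longrightarrow> 0 \<le> X (d p) x} \<in> sets (F t)"
      by (rule sets.sets_Collect_countable_All)
    then show ?thesis unfolding E_def space_completed_natural_filtration .
  qed
  have E0F: "E0 \<in> sets (F t)" if "0 < t" for t
  proof -
    obtain N where N: "1 / real (Suc N) < t" using nat_approx_posE[OF \<open>0 < t\<close>] by blast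
    \<comment> \<open>The sets \<open>E n\<close> increase, so the initial ones may be dropped;
      those that remain only look at times before \<open>t\<close>.\<close>
    have "E0 = (\<Union>n. E (n + N))" unfolding E0_def using mono[OF le_add1] by blast
    also have "\<dots> \<in> sets (F t)"
    proof (intro sets.countable_UN image_subsetI En)
      fix n
      have "1 / real (Suc (n + N)) \<le> 1 / real (Suc N)" by (intro divide_left_mono) auto
      then show "1 / real (Suc (n + N)) \<le> t" using N by linarith
    qed
    finally show ?thesis .
  qed
  \<comment> \<open>At the constant time 0 the family \<open>post\<close> is the germ sigma-algebra,
    and the strong Markov property supplies its independence of the path.\<close>
  have opt: "optional (\<lambda>_. 0)" by (rule optional_const) simp
  have post: "E0 \<in> post (\<lambda>_. 0)"
  proof -
    have "{x \<in> E0. 0 < t} \<in> sets (F t)" for t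
    proof (cases "0 < t")
      case True
      then have "{x \<in> E0. 0 < t} = E0" by simp
      then show ?thesis using E0F[OF True] by (simp only:)
    next
      case False
      then have "{x \<in> E0. 0 < t} = {}" by simp
      then show ?thesis by (simp only: sets.empty_sets)
    qed
    moreover have "E0 \<subseteq> space M" by (auto simp: E0_def E_def)
    ultimately show ?thesis unfolding post_def by blast
  qed
  have E0ev: "E0 \<in> events" by (rule post_events[OF post])
  obtain \<delta> where \<delta>: "0 < \<delta>" "\<And>u. 0 < u \<Longrightarrow> u \<le> 1 \<Longrightarrow> \<delta> \<le> prob {x \<in> space M. B u x < - \<bar>lam\<bar> * u}"
    using B_below_line_bounded_away[of lam] by blast
  define u where "u m = d (1, m)" for m
  have u: "0 < u m" "u m \<le> 1" for m by (auto simp: u_def d_def divide_le_eq_1)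
  have u0: "u \<longlonglongrightarrow> 0"
    using LIMSEQ_power_zero[of "1/2::real"] by (simp add: u_def[abs_def] d_def power_divide)
  define H where "H m = {x \<in> E0. X (u m) x < 0}" for m
  have Hev: "H m \<in> events" for m
  proof -
    have "{x \<in> space M. X (u m) x < 0} \<in> events"
      using X_measurable_M[of "u m"] u(1)[of m] by (intro borel_measurable_less) auto
    moreover have "H m = E0 \<inter> {x \<in> space M. X (u m) x < 0}"
      using sets.sets_into_space[OF E0ev] by (auto simp: H_def)
    ultimately show ?thesis using E0ev by simp
  qed
  have H_prob: "prob E0 * \<delta> \<le> prob (H m)" for m
  proof -
    define G where "G = {w \<in> space paths. w (u m) < - lam * u m}"
    have G: "G \<in> sets paths" unfolding G_def by measurable
    have eqs: "path 0 x \<in> G \<longleftrightarrow> B (u m) x < - lam * u m" if "x \<in> space M" for x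
      using B_0[OF that] u(1)[of m] by (simp add: G_def path_def)
    have "{x \<in> E0. path 0 x \<in> G} = H m"
      unfolding H_def using eqs sets.sets_into_space[OF E0ev] by (auto simp: drifted_def)
    then have "prob (H m) = prob E0 * measure law G"
      using strong_markov[OF opt post G] by simp
    moreover have "measure law G = prob {x \<in> space M. B (u m) x < - \<bar>lam\<bar> * u m}"
      unfolding measure_law[OF G] using eqs lam by (intro arg_cong[where f = prob]) auto
    ultimately show ?thesis
      using \<delta>(2)[OF u] by (simp add: mult_left_mono)
  qed
  \<comment> \<open>A point of \<open>E0\<close> leaves \<open>H m\<close> as soon as
    \<open>u m\<close> is in its interval of nonnegativity. So the probabilities tend to 0 although
    each is at least \<open>prob E0 * \<delta>\<close>.\<close>
  have "(\<lambda>m. \<integral>x. indicator (H m) x \<partial>M) \<longlonglongrightarrow> (\<integral>x. (0::real) \<partial>M)"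
  proof (rule integral_dominated_convergence[where w = "\<lambda>_. 1"])
    show "AE x in M. (\<lambda>m. indicator (H m) x) \<longlonglongrightarrow> (0::real)"
    proof (rule AE_I2)
      fix x assume x: "x \<in> space M"
      have "eventually (\<lambda>m. x \<notin> H m) sequentially"
      proof (cases "x \<in> E0")
        case True
        then obtain n where n: "x \<in> E n" by (auto simp: E0_def)
        have "eventually (\<lambda>m. u m < 1 / real (Suc n)) sequentially"
          using order_tendstoD(2)[OF u0] by simp
        then show ?thesis
        proof eventually_elim
          case (elim m)
          then have "0 \<le> X (u m) x" using n u(1)[of m] by (auto simp: E_def u_def)
          then show ?case by (simp add: H_def)
        qed
      qed (simp add: H_def)
      then show "(\<lambda>m. indicator (H m) x) \<longlonglongrightarrow> (0::real)"
        by (intro tendsto_eventually) (auto elim!: eventually_mono)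
    qed
  qed (use Hev in \<open>auto simp: indicator_def\<close>)
  then have "(\<lambda>m. prob (H m)) \<longlonglongrightarrow> 0" using Hev sets.Int_space_eq2[OF Hev] by simp
  then have "prob E0 * \<delta> \<le> 0" by (rule LIMSEQ_le_const) (use H_prob in auto)
  then have "prob E0 = 0" using \<delta>(1) by (simp add: mult_le_0_iff measure_le_0_iff)
  then have "AE x in M. x \<notin> E0"
    using E0ev by (intro AE_not_in) (simp add: null_sets_def emeasure_eq_measure)
  then show ?thesis
    using AE_space
  proof eventually_elim
    case (elim x)
    show ?case
    proof
      assume "low (path 0 x) = ereal 0"
      then have "\<forall>u\<ge>0. 0 \<le> X u x"
        using low_path_ge_iff[OF elim(2) order_refl, of 0] X_0[OF elim(2)] by simp
      then have "x \<in> E 0" using elim(2) d0 by (simp add: E_def)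
      then show False using elim(1) by (auto simp: E0_def)
    qed
  qed
qed

text \<open>
  A negative infimum is attained at some time after \<open>h > 0\<close>, and the infimum after \<open>h\<close> is the sum of
  two independent variables, the first of which has a density.
\<close>

lemma AE_low_path_neq: "AE x in M. low (path 0 x) \<noteq> ereal y"
proof (cases "y < 0")
  case y: True
  have "AE x in M. \<forall>n. low (path (1 / real (Suc n)) x) \<noteq> ereal (y - X (1 / real (Suc n)) x)"
    by (intro iffD2[OF AE_all_countable] allI AE_low_path_shift_neq) simp
  then show ?thesis
    using AE_space
  proof eventually_elim
    case (elim x)
    show ?case
    proof
      assume low: "low (path 0 x) = ereal y"
      have ge: "y \<le> X u x" if "0 \<le> u" for u
        using low_path_ge_iff[OF elim(2) order_refl, of y] low X_0[OF elim(2)] that by simp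
      obtain u where u: "0 \<le> u" "X u x \<le> y"
        using low_path_le_iff[OF elim(2) order_refl, of y] low X_0[OF elim(2)] by auto
      then have "0 < u" using X_0[OF elim(2)] y by (cases "u = 0") auto
      then obtain n where n: "1 / real (Suc n) < u" using nat_approx_posE by blast
      define h where "h = 1 / real (Suc n)"
      have h: "0 \<le> h" "0 \<le> u - h" using n by (auto simp: h_def)
      have "low (path h x) \<le> ereal (y - X h x)"
        unfolding low_path_le_iff[OF elim(2) h(1)] using h u by (intro exI[of _ "u - h"]) simp
      moreover have "ereal (y - X h x) \<le> low (path h x)"
        unfolding low_path_ge_iff[OF elim(2) h(1)] using h ge by simp
      ultimately have "low (path h x) = ereal (y - X h x)" by (rule antisym)
      then show False using elim(1) unfolding h_def by blast
    qed
  qed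
next
  case False
  show ?thesis
  proof (cases "y = 0")
    case True
    then show ?thesis using AE_low_path_neq_0 by simp
  next
    case ne: False
    show ?thesis
      using AE_space
    proof eventually_elim
      case (elim x)
      have "low (path 0 x) \<le> ereal 0"
        unfolding low_path_le_iff[OF elim order_refl] by (intro exI[of _ 0]) simp
      also have "\<dots> < ereal y" using False ne by simp
      finally show ?case by simp
    qed
  qed
qed

lemma measure_low_eq: "measure law {w. low w = ereal y} = 0"
  by (rule measure_law_eq_0I[OF low_path_events(2)]) (use AE_low_path_neq in simp)

section \<open>The probability that an optional time precedes the last passage\<close>

definition G :: "real \<Rightarrow> real" where
  "G y = measure law {w. low w \<le> ereal y}"

text \<open>Off the null event \<open>low w = y\<close> the indicators under the integral
  converge.\<close>

lemma G_tendsto: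
  assumes "f \<longlonglongrightarrow> y"
  shows "(\<lambda>n. G (f n)) \<longlonglongrightarrow> G y"
proof -
  interpret L: prob_space law by (rule prob_space_law)
  have ev: "{w. low w \<le> ereal c} \<in> sets law" "{w. low w = ereal c} \<in> sets law" for c
    using low_path_events by simp_all
  have ae: "AE w in law. low w \<noteq> ereal y"
    using measure_low_eq ev
    by (subst AE_iff_measurable[OF _ refl]) (auto simp: L.emeasure_eq_measure)
  have "(\<lambda>n. \<integral>w. indicator {w. low w \<le> ereal (f n)} w \<partial>law) \<longlonglongrightarrow> (\<integral>w. (indicator {w. low w \<le> ereal y} w :: real) \<partial>law)"
  proof (rule integral_dominated_convergence[where w = "\<lambda>_. 1"])
    show "AE w in law. (\<lambda>n. indicator {w. low w \<le> ereal (f n)} w) \<longlonglongrightarrow> (indicator {w. low w \<le> ereal y} w :: real)"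
      using ae
    proof eventually_elim
      case (elim w)
      have lim: "(\<lambda>n. ereal (f n)) \<longlonglongrightarrow> ereal y" using assms by (rule tendsto_ereal)
      show ?case
      proof (cases "low w < ereal y")
        case True
        have "eventually (\<lambda>n. indicator {w. low w \<le> ereal (f n)} w = (1::real)) sequentially"
          using order_tendstoD(1)[OF lim True] by eventually_elim simp
        then show ?thesis using True by (simp add: tendsto_eventually)
      next
        case False
        then have less: "ereal y < low w" using elim by simp
        have "eventually (\<lambda>n. indicator {w. low w \<le> ereal (f n)} w = (0::real)) sequentially"
          using order_tendstoD(2)[OF lim less] by eventually_elim simp
        then show ?thesis using less by (simp add: tendsto_eventually)
      qed
    qed
    show "(\<lambda>w. indicator {w. low w \<le> ereal (f n)} w :: real) \<in> borel_measurable law"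
      "(\<lambda>w. indicator {w. low w \<le> ereal y} w :: real) \<in> borel_measurable law" for n
      by (intro borel_measurable_indicator ev)+
  qed (auto simp: indicator_def)
  then show ?thesis using ev by (simp add: G_def)
qed

lemma G_measurable [measurable]: "G \<in> borel_measurable borel"
  by (intro borel_measurable_continuous_onI) (auto simp: continuous_on_sequentially intro!: G_tendsto simp: comp_def)

text \<open>A path at or below \<open>z\<close> has to come back to \<open>z\<close> on its way to
  infinity. The excluded case is real: with \<open>X t x = z\<close> and the path never lower
  afterwards, the right side holds although \<open>t\<close> may be the last visit.\<close>

lemma less_last_iff:
  assumes x: "x \<in> space M" and t: "0 \<le> t" and ne: "low (path t x) \<noteq> ereal 0"
  shows "t < last x \<longleftrightarrow> low (path t x) \<le> ereal (z - X t x)"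
proof
  assume "t < last x"
  then show "low (path t x) \<le> ereal (z - X t x)"
    unfolding low_path_le_iff[OF x t] using last_props(2)[OF x] by (intro exI[of _ "last x - t"]) simp
next
  assume le: "low (path t x) \<le> ereal (z - X t x)"
  \<comment> \<open>From a point strictly below \<open>z\<close> the return to \<open>z\<close>
    takes positive time, so in both alternatives there is a visit strictly after
    \<open>t\<close>.\<close>
  have "\<exists>v. t \<le> v \<and> (X v x < z \<or> t < v \<and> X v x = z)"
  proof (cases "X t x = z")
    case True
    have "\<not> ereal 0 \<le> low (path t x)" using le ne True by (auto intro: antisym)
    then obtain u where "0 \<le> u" "X (t + u) x < X t x"
      unfolding low_path_ge_iff[OF x t] by force
    then show ?thesis using True by (intro exI[of _ "t + u"]) simp
  next
    case False
    obtain u where u: "0 \<le> u" "X (t + u) x \<le> z"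
      using le unfolding low_path_le_iff[OF x t] by auto
    then show ?thesis using False by (intro exI[of _ "t + u"]) (cases "u = 0"; auto)
  qed
  then obtain v where v: "t \<le> v" "X v x < z \<or> t < v \<and> X v x = z" by blast
  then have "0 \<le> v" "X v x \<le> z" using t by auto
  then obtain s where s: "v \<le> s" "X s x = z" using X_hits_above[OF x] by blast
  have "t < s" using v s by (cases "v = s") auto
  then show "t < last x" using last_props(3)[OF x _ s(2)] t by simp
qed

lemma AE_low_path_optional_neq_0:
  assumes opt: "optional \<tau>"
  shows "AE x in M. low (path (\<tau> x) x) \<noteq> ereal 0"
proof -
  have W: "(\<lambda>x. path (\<tau> x) x) \<in> measurable M paths"
    by (rule path_measurable[OF optional_measurable[OF opt] optional_nonneg[OF opt]])
  have "prob {x \<in> space M. path (\<tau> x) x \<in> {w. low w = ereal 0}} = 0"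
    using strong_markov[OF opt space_in_post[OF opt] low_path_events(2)] by (simp add: measure_low_eq)
  moreover have "{x \<in> space M. path (\<tau> x) x \<in> {w. low w = ereal 0}} \<in> events"
    using measurable_sets[OF W low_path_events(2)[of 0]] by (simp add: vimage_def Int_def conj_commute)
  ultimately show ?thesis
    by (subst AE_iff_measurable[OF _ refl]) (auto simp: emeasure_eq_measure)
qed

text \<open>By \<open>less_last_iff\<close> the event agrees almost surely with a measurable one
  about \<open>X\<close> at \<open>\<tau>\<close> and the path after \<open>\<tau>\<close>.
  Completeness gives measurability, \<open>post_path_product\<close> the probability.\<close>

lemma prob_less_last:
  assumes opt: "optional \<tau>"
  shows "{x \<in> space M. \<tau> x < last x} \<in> events"
    and "prob {x \<in> space M. \<tau> x < last x} = (\<integral>x. G (z - X (\<tau> x) x) \<partial>M)"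
proof -
  interpret L: prob_space law by (rule prob_space_law)
  have X\<tau>: "(\<lambda>x. X (\<tau> x) x) \<in> borel_measurable M"
    by (rule measurable_Post_imp[OF opt at_optional_measurable[OF opt]])
  have W: "(\<lambda>x. path (\<tau> x) x) \<in> measurable M paths"
    by (rule path_measurable[OF optional_measurable[OF opt] optional_nonneg[OF opt]])
  define \<Gamma> where "\<Gamma> = {p \<in> space (borel \<Otimes>\<^sub>M paths). low (snd p) \<le> ereal (z - fst p)}"
  have lowP [measurable]: "(\<lambda>p. low (snd p)) \<in> borel_measurable (borel \<Otimes>\<^sub>M paths)"
    by (rule measurable_compose[OF measurable_snd low_measurable])
  have \<Gamma>: "\<Gamma> \<in> sets (borel \<Otimes>\<^sub>M paths)" unfolding \<Gamma>_def by measurable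
  have vim: "Pair y -` \<Gamma> = {w. low w \<le> ereal (z - y)}" for y
    by (auto simp: \<Gamma>_def space_pair_measure)
  define A where "A = {x \<in> space M. (X (\<tau> x) x, path (\<tau> x) x) \<in> \<Gamma>}"
  have A: "A \<in> events"
    using measurable_sets[OF measurable_Pair[OF X\<tau> W] \<Gamma>] by (simp add: A_def vimage_def Int_def conj_commute)
  have ae: "AE x in M. x \<in> A \<longleftrightarrow> x \<in> {x \<in> space M. \<tau> x < last x}"
    using AE_low_path_optional_neq_0[OF opt] AE_space
    by eventually_elim (auto simp: A_def \<Gamma>_def space_pair_measure less_last_iff optional_nonneg[OF opt])
  show ev: "{x \<in> space M. \<tau> x < last x} \<in> events"
    by (rule sets_AE_cong[OF _ refl A _ ae]) auto
  have "prob {x \<in> space M. \<tau> x < last x} = prob A"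
    by (rule finite_measure_eq_AE[symmetric]) (use ae A ev in auto)
  moreover have "ennreal (prob A) = (\<integral>\<^sup>+x. ennreal (G (z - X (\<tau> x) x)) \<partial>M)"
    unfolding emeasure_eq_measure[symmetric] A_def
    unfolding post_path_product[OF opt space_in_post[OF opt] at_optional_measurable[OF opt] \<Gamma>]
    by (intro nn_integral_cong) (simp add: vim G_def L.emeasure_eq_measure)
  moreover have "(\<integral>\<^sup>+x. ennreal (G (z - X (\<tau> x) x)) \<partial>M) = ennreal (\<integral>x. G (z - X (\<tau> x) x) \<partial>M)"
  proof (rule nn_integral_eq_integral)
    show "integrable M (\<lambda>x. G (z - X (\<tau> x) x))"
    proof (rule integrable_const_bound[of _ 1])
      show "(\<lambda>x. G (z - X (\<tau> x) x)) \<in> borel_measurable M"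
        by (rule measurable_compose[OF borel_measurable_diff[OF borel_measurable_const X\<tau>] G_measurable])
    qed (auto simp: G_def)
  qed (auto simp: G_def)
  ultimately have "ennreal (prob {x \<in> space M. \<tau> x < last x}) = ennreal (\<integral>x. G (z - X (\<tau> x) x) \<partial>M)"
    by simp
  then show "prob {x \<in> space M. \<tau> x < last x} = (\<integral>x. G (z - X (\<tau> x) x) \<partial>M)"
    by (subst (asm) ennreal_inj) (auto simp: G_def intro!: integral_nonneg_AE)
qed

text \<open>
  By continuity of \<open>G\<close> and of the paths, \<open>\<P>(\<tau>\<^sub>n < last)\<close> converges to \<open>\<P>(\<tau> < last)\<close>: the last passage
  time is totally inaccessible.
\<close>

lemma last_not_announced:
  assumes opt: "\<And>n. optional (R n)" "optional \<tau>"
    and lim: "\<And>x. x \<in> space M \<Longrightarrow> (\<lambda>n. R n x) \<longlonglongrightarrow> \<tau> x"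
    and le: "\<And>n x. x \<in> space M \<Longrightarrow> R n x \<le> \<tau> x"
  shows "AE x in M. \<not> ((\<forall>n. R n x < last x) \<and> last x \<le> \<tau> x)"
proof -
  define S where "S \<rho> = {x \<in> space M. \<rho> x < last x}" for \<rho>
  have S: "S (R n) \<in> events" "S \<tau> \<in> events" for n
    unfolding S_def by (intro prob_less_last(1) opt)+
  have sub: "S \<tau> \<subseteq> S (R n)" for n
  proof
    fix x assume "x \<in> S \<tau>"
    then show "x \<in> S (R n)" using le[of x n] by (simp add: S_def)
  qed
  have X_meas: "(\<lambda>x. X (\<rho> x) x) \<in> borel_measurable M" if "optional \<rho>" for \<rho>
    by (rule measurable_Post_imp[OF that at_optional_measurable[OF that]])
  have "(\<lambda>n. \<integral>x. G (z - X (R n x) x) \<partial>M) \<longlonglongrightarrow> (\<integral>x. G (z - X (\<tau> x) x) \<partial>M)"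
  proof (rule integral_dominated_convergence[where w = "\<lambda>_. 1"])
    show "AE x in M. (\<lambda>n. G (z - X (R n x) x)) \<longlonglongrightarrow> G (z - X (\<tau> x) x)"
    proof (rule AE_I2)
      fix x assume x: "x \<in> space M"
      have "(\<lambda>n. X (R n x) x) \<longlonglongrightarrow> X (\<tau> x) x"
        by (rule continuous_on_tendsto_compose[OF continuous_X[OF x] lim[OF x]])
           (use optional_nonneg[OF opt(1) x] optional_nonneg[OF opt(2) x] in auto)
      then show "(\<lambda>n. G (z - X (R n x) x)) \<longlonglongrightarrow> G (z - X (\<tau> x) x)"
        by (intro G_tendsto tendsto_diff tendsto_const)
    qed
    interpret L: prob_space law by (rule prob_space_law)
    show "AE x in M. norm (G (z - X (R n x) x)) \<le> 1" for n by (auto simp: G_def)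
    show "(\<lambda>x. G (z - X (\<tau> x) x)) \<in> borel_measurable M"
      "(\<lambda>x. G (z - X (R n x) x)) \<in> borel_measurable M" for n
      by (rule measurable_compose[OF borel_measurable_diff[OF borel_measurable_const X_meas[OF opt(2)]] G_measurable]
          measurable_compose[OF borel_measurable_diff[OF borel_measurable_const X_meas[OF opt(1)]] G_measurable])+
  qed simp
  then have "(\<lambda>n. prob (S (R n)) - prob (S \<tau>)) \<longlonglongrightarrow> 0"
    unfolding S_def prob_less_last(2)[OF opt(1)] prob_less_last(2)[OF opt(2)]
    by (intro iffD2[OF LIM_zero_iff])
  moreover have "prob (S (R n)) - prob (S \<tau>) = prob (S (R n) - S \<tau>)" for n
    by (rule finite_measure_Diff[symmetric, OF S sub])
  ultimately have lim0: "(\<lambda>n. prob (S (R n) - S \<tau>)) \<longlonglongrightarrow> 0" by simp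
  define E where "E = (\<Inter>n. S (R n)) - S \<tau>"
  have E: "E \<in> events" unfolding E_def using S by (intro sets.Diff sets.countable_INT) auto
  have "prob E \<le> prob (S (R n) - S \<tau>)" for n
    using S by (intro finite_measure_mono) (auto simp: E_def)
  then have "prob E \<le> 0" by (intro LIMSEQ_le_const[OF lim0]) auto
  then have "E \<in> null_sets M" using E by (simp add: null_sets_def emeasure_eq_measure measure_le_0_iff)
  then have "AE x in M. x \<notin> E" by (rule AE_not_in)
  then show ?thesis using AE_space
    by eventually_elim (auto simp: E_def S_def not_less)
qed

subsection \<open>The filtration of the stopped process\<close>

abbreviation \<xi> :: "real \<Rightarrow> 'a \<Rightarrow> real" where
  "\<xi> \<equiv> xi B lam z"

abbreviation F\<xi> :: "ennreal \<Rightarrow> 'a measure" where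
  "F\<xi> \<equiv> completed_natural_filtration M \<xi>"

lemma \<xi>_measurable: "0 \<le> s \<Longrightarrow> ennreal s \<le> t \<Longrightarrow> \<xi> s \<in> borel_measurable (F\<xi> t)"
  by (rule measurable_completed_natural_filtration)

text \<open>At a fixed time \<open>q > 0\<close> the path is almost surely not at \<open>z\<close>,
  so \<open>\<xi> q = z\<close> happens only because the process has already been stopped.\<close>

lemma last_le_in_F\<xi>:
  assumes q: "0 \<le> q"
  shows "{x \<in> space M. last x \<le> q} \<in> sets (F\<xi> (ennreal q))"
proof (cases "q = 0")
  case True
  then have "{x \<in> space M. last x \<le> q} = {}" using last_props(1) by force
  then show ?thesis by (simp only: sets.empty_sets)
next
  case False
  then have q': "0 < q" using q by simp
  have neq: "AE x in M. B q x \<notin> {z - lam * q}"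
    by (rule AE_B_notin_countable[OF q']) simp
  have "\<xi> q -` {z} \<inter> space (F\<xi> (ennreal q)) \<in> sets (F\<xi> (ennreal q))"
    by (rule measurable_sets[OF \<xi>_measurable[OF q order_refl]]) simp
  then show ?thesis
  proof (rule sets_completed_natural_filtration_AE_cong)
    show "AE x in M. x \<in> \<xi> q -` {z} \<inter> space (F\<xi> (ennreal q)) \<longleftrightarrow> x \<in> {x \<in> space M. last x \<le> q}"
      using neq AE_space
    proof eventually_elim
      case (elim x)
      then have "X q x \<noteq> z" by (auto simp: drifted_def)
      then show ?case
        using elim(2) xi_after[OF elim(2), of q] xi_before[OF elim(2) q] by (cases "last x \<le> q") auto
    qed
  qed auto
qed

text \<open>After the last passage time the process \<open>\<xi>\<close> is constant, so there is nothing left to observe.\<close>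

lemma F\<xi>_after_last:
  assumes q: "0 \<le> q" and C: "C \<in> sets (F\<xi> t)"
  shows "{x \<in> C. last x \<le> q} \<in> sets (F\<xi> (ennreal q))"
proof -
  define L where "L = {x \<in> space M. last x \<le> q}"
  have L: "L \<in> sets (F\<xi> (ennreal q))" unfolding L_def by (rule last_le_in_F\<xi>[OF q])
  have "C \<inter> L \<in> sets (F\<xi> (ennreal q))"
    using C unfolding sets_completed_natural_filtration[of M \<xi> t]
  proof (induction rule: sigma_sets.induct)
    case (Basic C)
    then consider s A where "C = \<xi> s -` A \<inter> space M" "0 \<le> s" "A \<in> sets borel" | "C \<in> null_sets M" by blast
    then show ?case
    proof cases
      case 1
      show ?thesis
      proof (cases "s \<le> q")
        case True
        then have "\<xi> s -` A \<inter> space (F\<xi> (ennreal q)) \<in> sets (F\<xi> (ennreal q))"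
          using 1 by (intro measurable_sets[OF \<xi>_measurable]) (auto intro: ennreal_leI)
        then have "C \<in> sets (F\<xi> (ennreal q))" unfolding 1 space_completed_natural_filtration .
        then show ?thesis using L by (rule sets.Int)
      next
        case False
        then have "C \<inter> L = (if z \<in> A then L else {})"
          unfolding 1 L_def using xi_after by auto
        then show ?thesis using L by (cases "z \<in> A") (simp_all only: if_True if_False sets.empty_sets)
      qed
    next
      case 2
      then show ?thesis by (intro sets.Int[OF _ L] null_sets_completed_natural_filtration)
    qed
  next
    case Empty
    show ?case by (simp only: Int_empty_left sets.empty_sets)
  next
    case (Compl C)
    have "(space M - C) \<inter> L = L - C \<inter> L" by (auto simp: L_def)
    then show ?case using sets.Diff[OF L Compl(2)] by (simp only:)
  next
    case (Union C)
    have "(\<Union>i. C i) \<inter> L = (\<Union>i. C i \<inter> L)" by blast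
    moreover have "(\<Union>i. C i \<inter> L) \<in> sets (F\<xi> (ennreal q))"
      by (intro sets.countable_UN image_subsetI Union(2))
    ultimately show ?case by (simp only:)
  qed
  moreover have "C \<subseteq> space M" using sets.sets_into_space[OF C] by simp
  then have "C \<inter> L = {x \<in> C. last x \<le> q}" by (auto simp: L_def)
  ultimately show ?thesis by (simp only:)
qed

text \<open>The sets with such a counterpart form a sigma-algebra, which contains the generators
  because \<open>\<xi> s\<close> and \<open>X s\<close> agree for \<open>s \<le> t < last x\<close>.
  Nothing is claimed about the counterpart once \<open>last x \<le> t\<close>.\<close>

lemma F\<xi>_before_last:
  assumes t: "0 \<le> t" and A: "A \<in> sets (F\<xi> (ennreal t))"
  shows "\<exists>A'\<in>sets (F t). \<forall>x\<in>space M. t < last x \<longrightarrow> (x \<in> A \<longleftrightarrow> x \<in> A')"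
  using A unfolding sets_completed_natural_filtration[of M \<xi> "ennreal t"]
proof (induction rule: sigma_sets.induct)
  case (Basic A)
  then consider s U where "A = \<xi> s -` U \<inter> space M" "0 \<le> s" "s \<le> t" "U \<in> sets borel" | "A \<in> null_sets M"
    using t by auto
  then show ?case
  proof cases
    case 1
    have "X s -` U \<inter> space (F s) \<in> sets (F s)"
      by (rule measurable_sets[OF X_measurable[OF 1(2)] 1(4)])
    then have "X s -` U \<inter> space M \<in> sets (F t)"
      unfolding space_completed_natural_filtration
      by (rule completed_natural_filtration_mono) (rule ennreal_leI[OF 1(3)])
    moreover have "\<forall>x\<in>space M. t < last x \<longrightarrow> (x \<in> A \<longleftrightarrow> x \<in> X s -` U \<inter> space M)"
      using 1 xi_before by auto
    ultimately show ?thesis by blast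
  next
    case 2
    then show ?thesis by (intro bexI[of _ A] null_sets_completed_natural_filtration) auto
  qed
next
  case Empty
  show ?case by (intro bexI[of _ "{}"] sets.empty_sets) auto
next
  case (Compl A)
  then obtain A' where "A' \<in> sets (F t)" "\<forall>x\<in>space M. t < last x \<longrightarrow> (x \<in> A \<longleftrightarrow> x \<in> A')" by blast
  then show ?case by (intro bexI[of _ "space (F t) - A'"] sets.compl_sets) auto
next
  case (Union A)
  then obtain A' where "\<And>i. A' i \<in> sets (F t)" "\<And>i. \<forall>x\<in>space M. t < last x \<longrightarrow> (x \<in> A i \<longleftrightarrow> x \<in> A' i)"
    by metis
  then show ?case by (intro bexI[of _ "\<Union>i. A' i"] sets.countable_UN) auto
qed

section \<open>From stopping times of the stopped process to optional times\<close>

text \<open>Optional times that may be infinite. For negative \<open>t\<close> the set is empty, as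
  \<open>ennreal t = 0\<close>.\<close>

definition ext_optional :: "('a \<Rightarrow> ennreal) \<Rightarrow> bool" where
  "ext_optional \<tau> \<longleftrightarrow> (\<forall>t. {x \<in> space M. \<tau> x < ennreal t} \<in> sets (F t))"

lemma ext_optionalD: "ext_optional \<tau> \<Longrightarrow> {x \<in> space M. \<tau> x < ennreal t} \<in> sets (F t)"
  by (simp add: ext_optional_def)

lemma rational_between:
  fixes x y :: ennreal
  assumes "x < y"
  obtains q where "q \<in> \<rat>" "0 \<le> q" "x < ennreal q" "ennreal q < y"
proof -
  obtain r :: rat where r: "x < ennreal (real_of_rat r)" "ennreal (real_of_rat r) < y"
    using ennreal_rat_dense[OF assms] by blast
  have "0 \<le> real_of_rat r"
  proof (rule ccontr)
    assume "\<not> 0 \<le> real_of_rat r"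
    then have "ennreal (real_of_rat r) = 0" by (simp add: ennreal_neg)
    then show False using r(1) by simp
  qed
  then show thesis using that[of "real_of_rat r"] r by auto
qed

text \<open>For rational \<open>q < last x\<close> the event \<open>T x \<le> q\<close> has a
  counterpart \<open>C q\<close> in \<open>F q\<close>, and \<open>\<tau>\<close> is the infimum of
  the \<open>q\<close> with \<open>x\<close> in \<open>C q\<close>. For
  \<open>q \<ge> last x\<close> the set \<open>C q\<close> is uncontrolled, but such
  \<open>q\<close> neither undercut a value of \<open>T\<close> before \<open>last\<close> nor bring
  \<open>\<tau>\<close> below \<open>last\<close>.\<close>

lemma stopping_time_before_last:
  assumes T: "stopping_time F\<xi> T"
  obtains \<tau> where "ext_optional \<tau>"
    and "\<And>x. x \<in> space M \<Longrightarrow> T x < ennreal (last x) \<Longrightarrow> \<tau> x = T x"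
    and "\<And>x. x \<in> space M \<Longrightarrow> ennreal (last x) \<le> T x \<Longrightarrow> ennreal (last x) \<le> \<tau> x"
proof -
  define Q where "Q = {q \<in> \<rat>. 0 \<le> (q :: real)}"
  have Q: "countable Q" unfolding Q_def by (rule countable_subset[OF _ countable_rat]) auto
  have ex: "\<forall>q\<in>Q. \<exists>C. C \<in> sets (F q) \<and> (\<forall>x\<in>space M. q < last x \<longrightarrow> (T x \<le> ennreal q \<longleftrightarrow> x \<in> C))"
  proof
    fix q assume "q \<in> Q"
    then have q: "0 \<le> q" by (simp add: Q_def)
    have "{x \<in> space (F\<xi> (ennreal q)). T x \<le> ennreal q} \<in> sets (F\<xi> (ennreal q))"
      using stopping_timeD[OF T, of "ennreal q"] unfolding pred_def .
    from F\<xi>_before_last[OF q this]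
    show "\<exists>C. C \<in> sets (F q) \<and> (\<forall>x\<in>space M. q < last x \<longrightarrow> (T x \<le> ennreal q \<longleftrightarrow> x \<in> C))"
      by auto
  qed
  obtain C where C: "\<And>q. q \<in> Q \<Longrightarrow> C q \<in> sets (F q)"
    and CT: "\<And>q x. q \<in> Q \<Longrightarrow> x \<in> space M \<Longrightarrow> q < last x \<Longrightarrow> T x \<le> ennreal q \<longleftrightarrow> x \<in> C q"
    using bchoice[OF ex] by blast
  define \<tau> where "\<tau> x = (INF q\<in>{q \<in> Q. x \<in> C q}. ennreal q)" for x
  show thesis
  proof
    show "ext_optional \<tau>"
      unfolding ext_optional_def
    proof
      fix t :: real
      have "{x \<in> space M. \<tau> x < ennreal t} = (\<Union>q\<in>{q \<in> Q. q < t}. C q)"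
      proof safe
        fix x assume "x \<in> space M" "\<tau> x < ennreal t"
        then obtain q where q: "q \<in> Q" "x \<in> C q" "ennreal q < ennreal t"
          by (auto simp: \<tau>_def INF_less_iff)
        then have "q < t" by (auto simp: Q_def ennreal_less_iff)
        then show "x \<in> (\<Union>q\<in>{q \<in> Q. q < t}. C q)" using q by blast
      next
        fix x q assume q: "q \<in> Q" "q < t" "x \<in> C q"
        then show "x \<in> space M" using sets.sets_into_space[OF C[OF q(1)]] by auto
        have "\<tau> x \<le> ennreal q" unfolding \<tau>_def using q by (intro INF_lower) simp
        also have "\<dots> < ennreal t" using q by (simp add: Q_def ennreal_less_iff)
        finally show "\<tau> x < ennreal t" .
      qed
      also have "\<dots> \<in> sets (F t)"
      proof (rule sets.countable_UN'')
        show "countable {q \<in> Q. q < t}" by (rule countable_subset[OF _ Q]) auto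
        show "C q \<in> sets (F t)" if "q \<in> {q \<in> Q. q < t}" for q
          using that by (intro completed_natural_filtration_mono[OF C] ennreal_leI) auto
      qed
      finally show "{x \<in> space M. \<tau> x < ennreal t} \<in> sets (F t)" .
    qed
  next
    fix x assume x: "x \<in> space M" and less: "T x < ennreal (last x)"
    show "\<tau> x = T x"
    proof (rule antisym)
      show "\<tau> x \<le> T x"
      proof (rule ccontr)
        assume "\<not> \<tau> x \<le> T x"
        then have "T x < min (\<tau> x) (ennreal (last x))" using less by simp
        then obtain q where q: "q \<in> \<rat>" "0 \<le> q" "T x < ennreal q" "ennreal q < min (\<tau> x) (ennreal (last x))"
          by (rule rational_between)
        then have "q < last x" "q \<in> Q" by (auto simp: ennreal_less_iff Q_def)
        then have "x \<in> C q" using CT[of q x] x less_imp_le[OF q(3)] by simp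
        then have "\<tau> x \<le> ennreal q" unfolding \<tau>_def using \<open>q \<in> Q\<close> by (intro INF_lower) simp
        then show False using q(4) by (simp add: leD)
      qed
      show "T x \<le> \<tau> x"
        unfolding \<tau>_def
      proof (rule INF_greatest)
        fix q assume "q \<in> {q \<in> Q. x \<in> C q}"
        then have q: "q \<in> Q" "x \<in> C q" by auto
        show "T x \<le> ennreal q"
        proof (cases "q < last x")
          case True
          then show ?thesis using CT[OF q(1) x] q by simp
        next
          case False
          then have "ennreal (last x) \<le> ennreal q" by (intro ennreal_leI) simp
          then show ?thesis using less by simp
        qed
      qed
    qed
  next
    fix x assume x: "x \<in> space M" and ge: "ennreal (last x) \<le> T x"
    show "ennreal (last x) \<le> \<tau> x"
      unfolding \<tau>_def
    proof (rule INF_greatest)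
      fix q assume "q \<in> {q \<in> Q. x \<in> C q}"
      then have q: "q \<in> Q" "x \<in> C q" by auto
      have "\<not> q < last x"
      proof
        assume less: "q < last x"
        then have "T x \<le> ennreal q" using CT[OF q(1) x] q by simp
        then have "ennreal (last x) \<le> ennreal q" using ge by (rule order_trans[rotated])
        then show False using less last_props(1)[OF x] q(1) by (simp add: Q_def ennreal_le_iff)
      qed
      then show "ennreal (last x) \<le> ennreal q" by (intro ennreal_leI) simp
    qed
  qed
qed

text \<open>The strong Markov property is stated for real-valued times; times in
  \<open>[0, \<infinity>]\<close> enter it through these caps.\<close>

definition trunc :: "nat \<Rightarrow> ('a \<Rightarrow> ennreal) \<Rightarrow> 'a \<Rightarrow> real" where
  "trunc N \<tau> x = enn2real (min (\<tau> x) (ennreal (real N)))"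

lemma ennreal_trunc: "ennreal (trunc N \<tau> x) = min (\<tau> x) (ennreal (real N))"
  unfolding trunc_def by (rule ennreal_enn2real) (auto simp: min_less_iff_disj ennreal_less_top)

lemma trunc_nonneg: "0 \<le> trunc N \<tau> x"
  by (simp add: trunc_def)

lemma trunc_eq: "\<tau> x < ennreal (real N) \<Longrightarrow> trunc N \<tau> x = enn2real (\<tau> x)"
  by (simp add: trunc_def min_absorb1)

lemma trunc_less_iff:
  assumes "0 \<le> t"
  shows "trunc N \<tau> x < t \<longleftrightarrow> \<tau> x < ennreal t \<or> real N < t"
proof -
  have "trunc N \<tau> x < t \<longleftrightarrow> ennreal (trunc N \<tau> x) < ennreal t"
    by (rule ennreal_less_iff[OF trunc_nonneg, symmetric])
  also have "\<dots> \<longleftrightarrow> \<tau> x < ennreal t \<or> ennreal (real N) < ennreal t"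
    unfolding ennreal_trunc by (rule min_less_iff_disj)
  also have "ennreal (real N) < ennreal t \<longleftrightarrow> real N < t" by (rule ennreal_less_iff) simp
  finally show ?thesis .
qed

lemma optional_trunc:
  assumes "ext_optional \<tau>"
  shows "optional (trunc N \<tau>)"
  unfolding optional_def
proof (intro conjI ballI allI impI)
  fix t :: real assume t: "0 \<le> t"
  show "{x \<in> space M. trunc N \<tau> x < t} \<in> sets (F t)"
  proof (cases "real N < t")
    case True
    then have "{x \<in> space M. trunc N \<tau> x < t} = space (F t)" by (simp add: trunc_less_iff[OF t])
    then show ?thesis by (simp only: sets.top)
  next
    case False
    then have "{x \<in> space M. trunc N \<tau> x < t} = {x \<in> space M. \<tau> x < ennreal t}"
      by (simp add: trunc_less_iff[OF t])
    then show ?thesis using ext_optionalD[OF assms, of t] by (simp only:)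
  qed
qed (rule trunc_nonneg)

lemma ext_optional_max:
  assumes "ext_optional \<sigma>" "ext_optional \<tau>"
  shows "ext_optional (\<lambda>x. max (\<sigma> x) (\<tau> x))"
  unfolding ext_optional_def
proof
  fix t
  have "{x \<in> space M. max (\<sigma> x) (\<tau> x) < ennreal t} = {x \<in> space M. \<sigma> x < ennreal t} \<inter> {x \<in> space M. \<tau> x < ennreal t}"
    by auto
  then show "{x \<in> space M. max (\<sigma> x) (\<tau> x) < ennreal t} \<in> sets (F t)"
    using sets.Int[OF assms[THEN ext_optionalD, of t]] by (simp only:)
qed

text \<open>All terms can be below \<open>t\<close> while the supremum equals \<open>t\<close>; the
  margins \<open>1 / Suc k\<close> in \<open>s k\<close> make the bound uniform in
  \<open>n\<close>.\<close>

lemma ext_optional_SUP: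
  assumes R: "\<And>n :: nat. ext_optional (R n)"
  shows "ext_optional (\<lambda>x. SUP n. R n x)"
  unfolding ext_optional_def
proof
  fix t :: real
  define s where "s k = t - 1 / real (Suc k)" for k
  show "{x \<in> space M. (SUP n. R n x) < ennreal t} \<in> sets (F t)"
  proof (cases "0 < t")
    case True
    have less: "ennreal (s k) < ennreal t" for k
      using True by (auto simp: s_def ennreal_lessI)
    have "{x \<in> space M. (SUP n. R n x) < ennreal t} = (\<Union>k. \<Inter>n. {x \<in> space M. R n x < ennreal (s k)})"
    proof safe
      fix x assume x: "x \<in> space M" "(SUP n. R n x) < ennreal t"
      then obtain q where q: "0 \<le> q" "(SUP n. R n x) < ennreal q" "ennreal q < ennreal t"
        by (blast elim: rational_between)
      then have "0 < t - q" by (simp add: ennreal_less_iff)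
      then obtain k where "1 / real (Suc k) < t - q" using nat_approx_posE by blast
      then have "ennreal q \<le> ennreal (s k)" by (intro ennreal_leI) (simp add: s_def)
      then have "R n x < ennreal (s k)" for n
        using q(2) SUP_upper[of n UNIV "\<lambda>n. R n x"] by (auto intro: le_less_trans less_le_trans)
      then show "x \<in> (\<Union>k. \<Inter>n. {x \<in> space M. R n x < ennreal (s k)})" using x by blast
    next
      fix x k assume *: "x \<in> (\<Inter>n. {x \<in> space M. R n x < ennreal (s k)})"
      then show "x \<in> space M" by auto
      have "(SUP n. R n x) \<le> ennreal (s k)" using * by (intro SUP_least) (auto intro: less_imp_le)
      then show "(SUP n. R n x) < ennreal t" using less by (rule le_less_trans)
    qed
    also have "\<dots> \<in> sets (F t)"
    proof (intro sets.countable_UN sets.countable_INT image_subsetI)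
      fix k n
      show "{x \<in> space M. R n x < ennreal (s k)} \<in> sets (F t)"
        by (rule completed_natural_filtration_mono[OF ext_optionalD[OF R]]) (rule less_imp_le[OF less])
    qed simp
    finally show ?thesis .
  next
    case False
    then have "{x \<in> space M. (SUP n. R n x) < ennreal t} = {}" by (simp add: ennreal_neg)
    then show ?thesis by (simp only: sets.empty_sets)
  qed
qed

section \<open>Predictable times avoid the last passage\<close>

text \<open>Where \<open>T = last\<close>, the announcing times lie strictly before
  \<open>last\<close>, so their optional counterparts coincide with them and would announce the last
  passage time, contrary to \<open>last_not_announced\<close>.\<close>

lemma predictable_time_neq_last:
  assumes T: "predictable_time M F\<xi> T"
  shows "AE x in M. T x \<noteq> ennreal (last x)"
proof -
  obtain S :: "nat \<Rightarrow> 'a \<Rightarrow> ennreal" where S: "\<And>n. stopping_time F\<xi> (S n)"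
    and ae: "AE x in M. incseq (\<lambda>n. S n x) \<and> (\<lambda>n. S n x) \<longlonglongrightarrow> T x \<and> (0 < T x \<longrightarrow> (\<forall>n. S n x < T x))"
    using T by (auto simp: predictable_time_def)
  have "\<forall>n. \<exists>\<sigma>. ext_optional \<sigma> \<and> (\<forall>x\<in>space M. S n x < ennreal (last x) \<longrightarrow> \<sigma> x = S n x)"
    using stopping_time_before_last[OF S] by metis
  then obtain \<sigma> where \<sigma>: "\<And>n. ext_optional (\<sigma> n)"
    and \<sigma>_eq: "\<And>n x. x \<in> space M \<Longrightarrow> S n x < ennreal (last x) \<Longrightarrow> \<sigma> n x = S n x"
    by metis
  \<comment> \<open>The counterparts need not increase where they differ from the announcing times.
    Running maxima repair this everywhere and change nothing where \<open>T = last\<close>.\<close>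
  define R where "R = rec_nat (\<sigma> 0) (\<lambda>n r x. max (r x) (\<sigma> (Suc n) x))"
  have R_simps: "R 0 = \<sigma> 0" "R (Suc n) = (\<lambda>x. max (R n x) (\<sigma> (Suc n) x))" for n
    by (simp_all add: R_def)
  have R: "ext_optional (R n)" for n
    by (induction n) (simp_all only: R_simps \<sigma> ext_optional_max)
  have inc: "incseq (\<lambda>n. R n x)" for x
    by (rule incseq_SucI) (simp add: R_simps)
  \<comment> \<open>A supremum of the \<open>R n\<close>, instead of a counterpart of
    \<open>T\<close>, so that the convergence holds at every point.\<close>
  define U where "U x = (SUP n. R n x)" for x
  have U: "ext_optional U" unfolding U_def by (rule ext_optional_SUP[OF R])
  have "AE x in M. \<not> ((\<forall>n. trunc N (R n) x < last x) \<and> last x \<le> trunc N U x)" for N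
  proof (rule last_not_announced)
    show "optional (trunc N (R n))" for n by (rule optional_trunc[OF R])
    show "optional (trunc N U)" by (rule optional_trunc[OF U])
    fix x
    have "(\<lambda>n. R n x) \<longlonglongrightarrow> U x"
      unfolding U_def by (rule LIMSEQ_SUP[OF inc])
    then have "(\<lambda>n. min (R n x) (ennreal (real N))) \<longlonglongrightarrow> min (U x) (ennreal (real N))"
      by (intro tendsto_min tendsto_const)
    then have "(\<lambda>n. ennreal (trunc N (R n) x)) \<longlonglongrightarrow> ennreal (trunc N U x)"
      by (simp only: ennreal_trunc)
    then show "(\<lambda>n. trunc N (R n) x) \<longlonglongrightarrow> trunc N U x"
      by (rule tendsto_ennrealD) (auto simp: trunc_nonneg)
    fix n
    have "R n x \<le> U x" unfolding U_def by (rule SUP_upper) simp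
    then have "ennreal (trunc N (R n) x) \<le> ennreal (trunc N U x)"
      unfolding ennreal_trunc by (intro min.mono) auto
    then show "trunc N (R n) x \<le> trunc N U x"
      by (simp add: ennreal_le_iff trunc_nonneg)
  qed
  then have "AE x in M. \<forall>N. \<not> ((\<forall>n. trunc N (R n) x < last x) \<and> last x \<le> trunc N U x)"
    by (simp add: AE_all_countable)
  then show ?thesis
    using ae AE_space
  proof eventually_elim
    case (elim x)
    note x = elim(3)
    show ?case
    proof
      assume eq: "T x = ennreal (last x)"
      have pos: "0 < last x" by (rule last_props(1)[OF x])
      then have S_less: "S n x < ennreal (last x)" for n
        using elim(2) eq by simp
      have mono: "S m x \<le> S n x" if "m \<le> n" for m n
        using elim(2) that by (auto simp: incseq_def)
      have R_eq: "R n x = S n x" for n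
      proof (induction n)
        case 0
        show ?case using \<sigma>_eq[OF x S_less] by (simp add: R_simps)
      next
        case (Suc n)
        show ?case using Suc \<sigma>_eq[OF x S_less] mono[of n "Suc n"] by (simp add: R_simps max_absorb2)
      qed
      have U_eq: "U x = ennreal (last x)"
        using LIMSEQ_SUP[OF inc[of x]] elim(2) eq unfolding U_def R_eq by (auto intro: LIMSEQ_unique)
      obtain N :: nat where N: "last x < real N" using reals_Archimedean2 by blast
      then have N': "ennreal (last x) < ennreal (real N)" using pos by (simp add: ennreal_less_iff)
      have "trunc N (R n) x < last x" for n
        using S_less[of n] pos by (simp add: trunc_less_iff R_eq)
      moreover have "last x \<le> trunc N U x"
        using trunc_eq[of U x N] N' pos by (simp add: U_eq)
      ultimately show False using elim(1) by blast
    qed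
  qed
qed

end

subsection \<open>Quasi-left-continuity\<close>

lemma sets_strict_pre_sigma:
  assumes "filtration \<Omega> G"
  shows "space (strict_pre_sigma \<Omega> G T) = \<Omega>"
    and "sets (strict_pre_sigma \<Omega> G T) =
      sigma_sets \<Omega> (sets (G 0) \<union> {{x \<in> A. t < T x} | A t. t < \<infinity> \<and> A \<in> sets (G t)})"
proof -
  have "sets (G t) \<subseteq> Pow \<Omega>" for t
    using sets.space_closed[of "G t"] filtration.space_F[OF assms] by simp
  then have *: "sets (G 0) \<union> {{x \<in> A. t < T x} | A t. t < \<infinity> \<and> A \<in> sets (G t)} \<subseteq> Pow \<Omega>"
    by blast
  show "space (strict_pre_sigma \<Omega> G T) = \<Omega>"
    unfolding strict_pre_sigma_def by (rule space_measure_of[OF *])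
  show "sets (strict_pre_sigma \<Omega> G T) =
      sigma_sets \<Omega> (sets (G 0) \<union> {{x \<in> A. t < T x} | A t. t < \<infinity> \<and> A \<in> sets (G t)})"
    unfolding strict_pre_sigma_def by (rule sets_measure_of[OF *])
qed

text \<open>On \<open>T \<le> s\<close> a generator becomes \<open>A\<close> cut by
  \<open>t < T \<le> s\<close>: known at \<open>s\<close> if \<open>t < s\<close>, empty
  otherwise.\<close>

lemma sets_strict_pre_sigma_subset_pre_sigma:
  assumes "filtration \<Omega> G" and T: "stopping_time G T"
  shows "sets (strict_pre_sigma \<Omega> G T) \<subseteq> sets (filtration.pre_sigma \<Omega> G T)"
proof -
  interpret filtration \<Omega> G by fact
  have T_le: "{x \<in> \<Omega>. T x \<le> s} \<in> sets (G s)" for s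
    using stopping_timeD[OF T, of s] by (simp add: pred_def space_F)
  have T_le': "{x \<in> \<Omega>. T x \<le> t} \<in> sets (G s)" if "t \<le> s" for s t
    using T_le[of t] sets_F_mono[OF that] by blast
  have sub: "A \<subseteq> \<Omega>" if "A \<in> sets (G t)" for A t
    using sets.sets_into_space[OF that] by (simp add: space_F)
  have "sets (G 0) \<union> {{x \<in> A. t < T x} | A t. t < \<infinity> \<and> A \<in> sets (G t)} \<subseteq> sets (pre_sigma T)"
  proof (intro Un_least subsetI)
    fix A assume A: "A \<in> sets (G 0)"
    show "A \<in> sets (pre_sigma T)"
    proof (rule sets_pre_sigmaI[OF T])
      fix s
      have "{x \<in> A. T x \<le> s} = A \<inter> {x \<in> \<Omega>. T x \<le> s}" using sub[OF A] by blast
      moreover have "A \<in> sets (G s)" using A sets_F_mono[of 0 s] by auto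
      ultimately show "{x \<in> A. T x \<le> s} \<in> sets (G s)" using sets.Int[OF _ T_le] by simp
    qed
  next
    fix E assume "E \<in> {{x \<in> A. t < T x} | A t. t < \<infinity> \<and> A \<in> sets (G t)}"
    then obtain A t where E: "E = {x \<in> A. t < T x}" and A: "A \<in> sets (G t)" by blast
    show "E \<in> sets (pre_sigma T)"
    proof (rule sets_pre_sigmaI[OF T])
      fix s
      show "{x \<in> E. T x \<le> s} \<in> sets (G s)"
      proof (cases "s \<le> t")
        case True
        then have "{x \<in> E. T x \<le> s} = {}" by (auto simp: E)
        then show ?thesis by (simp only: sets.empty_sets)
      next
        case False
        then have ts: "t \<le> s" by simp
        have "{x \<in> E. T x \<le> s} = A \<inter> ({x \<in> \<Omega>. T x \<le> s} - {x \<in> \<Omega>. T x \<le> t})"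
          using sub[OF A] by (auto simp: E)
        moreover have "A \<in> sets (G s)" using A sets_F_mono[OF ts] by auto
        ultimately show ?thesis using sets.Int[OF _ sets.Diff[OF T_le T_le'[OF ts]]] by simp
      qed
    qed
  qed
  then show ?thesis
    unfolding sets_strict_pre_sigma[OF assms(1)]
    using sets.sigma_sets_subset[of _ "pre_sigma T"] by (simp only: space_pre_sigma)
qed

section \<open>Deciding events at a predictable time strictly before it\<close>

context drifted_brownian
begin

text \<open>If \<open>\<tau> < \<sigma>\<close> and \<open>\<tau> < t\<close>, a rational
  \<open>q < t\<close> separates the two times, so countably many events known at \<open>t\<close>
  decide the comparison. Below \<open>N\<close> the cap does not alter
  \<open>\<tau>\<close>.\<close>

lemma post_trunc_le:
  assumes \<sigma>: "ext_optional \<sigma>" and \<tau>: "ext_optional \<tau>"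
  shows "{x \<in> space M. \<sigma> x \<le> \<tau> x \<and> \<tau> x < ennreal (real N)} \<in> post (trunc N \<tau>)"
proof -
  define Q where "Q = {q \<in> \<rat>. 0 \<le> (q :: real)}"
  have Q: "countable Q" unfolding Q_def by (rule countable_subset[OF _ countable_rat]) auto
  have le: "{x \<in> space M. \<sigma> x \<le> \<tau> x \<and> \<tau> x < ennreal t} \<in> sets (F t)" for t :: real
  proof -
    have "{x \<in> space M. \<sigma> x \<le> \<tau> x \<and> \<tau> x < ennreal t} = {x \<in> space M. \<tau> x < ennreal t} -
        (\<Union>q\<in>{q \<in> Q. q < t}. {x \<in> space M. \<tau> x < ennreal q} - {x \<in> space M. \<sigma> x < ennreal q})"
      (is "?L = ?R")
    proof
      show "?L \<subseteq> ?R" by auto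
      show "?R \<subseteq> ?L"
      proof
        fix x assume x: "x \<in> ?R"
        have "\<sigma> x \<le> \<tau> x"
        proof (rule ccontr)
          assume "\<not> \<sigma> x \<le> \<tau> x"
          then have "\<tau> x < min (\<sigma> x) (ennreal t)" using x by auto
          then obtain q where q: "q \<in> \<rat>" "0 \<le> q" "\<tau> x < ennreal q" "ennreal q < min (\<sigma> x) (ennreal t)"
            by (rule rational_between)
          then have "q \<in> Q" "q < t" "\<not> \<sigma> x < ennreal q" by (auto simp: Q_def ennreal_less_iff)
          then show False using q x by blast
        qed
        then show "x \<in> ?L" using x by auto
      qed
    qed
    also have "\<dots> \<in> sets (F t)"
    proof (intro sets.Diff ext_optionalD[OF \<tau>] sets.countable_UN'')
      show "countable {q \<in> Q. q < t}" by (rule countable_subset[OF _ Q]) auto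
      fix q assume "q \<in> {q \<in> Q. q < t}"
      then have "ennreal q \<le> ennreal t" by (intro ennreal_leI) auto
      then show "{x \<in> space M. \<tau> x < ennreal q} \<in> sets (F t)" "{x \<in> space M. \<sigma> x < ennreal q} \<in> sets (F t)"
        by (rule completed_natural_filtration_mono[OF ext_optionalD[OF \<tau>]],
            rule completed_natural_filtration_mono[OF ext_optionalD[OF \<sigma>]])
    qed
    finally show ?thesis .
  qed
  have "{x \<in> {x \<in> space M. \<sigma> x \<le> \<tau> x \<and> \<tau> x < ennreal (real N)}. trunc N \<tau> x < t} \<in> sets (F t)"
    if t: "0 \<le> t" for t
  proof (cases "real N < t")
    case True
    then have "{x \<in> {x \<in> space M. \<sigma> x \<le> \<tau> x \<and> \<tau> x < ennreal (real N)}. trunc N \<tau> x < t} =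
        {x \<in> space M. \<sigma> x \<le> \<tau> x \<and> \<tau> x < ennreal (real N)}"
      by (auto simp: trunc_less_iff[OF t])
    moreover have "{x \<in> space M. \<sigma> x \<le> \<tau> x \<and> \<tau> x < ennreal (real N)} \<in> sets (F t)"
      using True by (intro completed_natural_filtration_mono[OF le] ennreal_leI) simp
    ultimately show ?thesis by (simp only:)
  next
    case False
    then have "ennreal t \<le> ennreal (real N)" by (intro ennreal_leI) simp
    then have "{x \<in> {x \<in> space M. \<sigma> x \<le> \<tau> x \<and> \<tau> x < ennreal (real N)}. trunc N \<tau> x < t} =
        {x \<in> space M. \<sigma> x \<le> \<tau> x \<and> \<tau> x < ennreal t}"
      using False by (auto simp: trunc_less_iff[OF t] intro: less_le_trans)
    then show ?thesis using le[of t] by (simp only:)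
  qed
  then show ?thesis unfolding post_def by blast
qed

context
  fixes T :: "'a \<Rightarrow> ennreal"
  assumes T: "predictable_time M F\<xi> T"
begin

abbreviation P :: "'a measure" where
  "P \<equiv> strict_pre_sigma (space M) F\<xi> T"

lemma stopping_T: "stopping_time F\<xi> T"
  using T by (simp add: predictable_time_def)

lemma space_P [simp]: "space P = space M"
  by (rule sets_strict_pre_sigma(1)[OF filtration_completed_natural_filtration])

lemma in_P_0: "A \<in> sets (F\<xi> 0) \<Longrightarrow> A \<in> sets P"
  unfolding sets_strict_pre_sigma(2)[OF filtration_completed_natural_filtration]
  by (intro sigma_sets.Basic UnI1)

lemma in_P: "A \<in> sets (F\<xi> (ennreal t)) \<Longrightarrow> {x \<in> A. ennreal t < T x} \<in> sets P"
  unfolding sets_strict_pre_sigma(2)[OF filtration_completed_natural_filtration]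
  by (intro sigma_sets.Basic UnI2 CollectI exI[of _ A] exI[of _ "ennreal t"]) (simp add: ennreal_less_top)

lemma null_sets_P: "null_sets M \<subseteq> sets P"
  by (auto intro: in_P_0 null_sets_completed_natural_filtration)

lemma T_measurable_P: "T \<in> borel_measurable P"
proof (rule borel_measurableI_greater)
  fix y :: ennreal
  show "{x \<in> space P. y < T x} \<in> sets P"
  proof (cases y)
    case (real r)
    then show ?thesis
      using in_P[OF sets.top[of "F\<xi> (ennreal r)"]] by simp
  next
    case top
    then have "{x \<in> space P. y < T x} = {}" by auto
    then show ?thesis by (simp only: sets.empty_sets)
  qed
qed

text \<open>Choose a rational \<open>q\<close> with \<open>last x \<le> q < T x\<close>: by
  \<open>F\<xi>_after_last\<close> the part of \<open>A\<close> with \<open>last \<le> q\<close> is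
  known at \<open>q\<close>, whatever \<open>t\<close> is.\<close>

lemma after_last_in_P:
  assumes A: "A \<in> sets (F\<xi> t)"
  shows "{x \<in> A. ennreal (last x) < T x} \<in> sets P"
proof -
  define Q where "Q = {q \<in> \<rat>. 0 \<le> (q :: real)}"
  have Q: "countable Q" unfolding Q_def by (rule countable_subset[OF _ countable_rat]) auto
  have "{x \<in> A. ennreal (last x) < T x} = (\<Union>q\<in>Q. {x \<in> {x \<in> A. last x \<le> q}. ennreal q < T x})"
  proof safe
    fix x assume x: "x \<in> A" "ennreal (last x) < T x"
    obtain q where q: "q \<in> \<rat>" "0 \<le> q" "ennreal (last x) < ennreal q" "ennreal q < T x"
      by (rule rational_between[OF x(2)])
    have "last x \<le> q"
    proof (rule ccontr)
      assume "\<not> last x \<le> q"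
      then have "ennreal q \<le> ennreal (last x)" by (intro ennreal_leI) simp
      then show False using q(3) by simp
    qed
    then show "x \<in> (\<Union>q\<in>Q. {x \<in> {x \<in> A. last x \<le> q}. ennreal q < T x})"
      using q x by (auto simp: Q_def)
  next
    fix x q assume "last x \<le> q" "ennreal q < T x"
    then show "ennreal (last x) < T x" using ennreal_leI[of "last x" q] by (rule_tac le_less_trans)
  qed
  also have "\<dots> \<in> sets P"
    by (intro sets.countable_UN'' Q in_P F\<xi>_after_last[OF _ A]) (simp add: Q_def)
  finally show ?thesis .
qed

text \<open>Up to the null event \<open>T = last\<close> this is the complement of an event already
  in \<open>P\<close>. Predictability of \<open>T\<close> enters here.\<close>

lemma before_last_in_P: "{x \<in> space M. T x < ennreal (last x)} \<in> sets P"
proof (rule sets_AE_cong[OF null_sets_P space_P])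
  have "{x \<in> space (F\<xi> 0). ennreal (last x) < T x} \<in> sets P"
    by (rule after_last_in_P[OF sets.top])
  then show "space P - {x \<in> space M. ennreal (last x) < T x} \<in> sets P"
    unfolding space_completed_natural_filtration by (rule sets.compl_sets)
  show "AE x in M. x \<in> space P - {x \<in> space M. ennreal (last x) < T x} \<longleftrightarrow>
      x \<in> {x \<in> space M. T x < ennreal (last x)}"
    using predictable_time_neq_last[OF T] AE_space by eventually_elim auto
qed auto

text \<open>
  Left-continuity of \<open>\<xi>\<close>: its value at a time at most \<open>T\<close> is a limit of values observed strictly
  before \<open>T\<close>.
\<close>

lemma \<xi>_at_min_measurable_P:
  assumes s: "0 \<le> s"
  shows "(\<lambda>x. \<xi> (min s (enn2real (T x))) x) \<in> borel_measurable P"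
proof (rule borel_measurable_LIMSEQ_real)
  \<comment> \<open>\<open>enn2real\<close> sends \<infinity> to 0, so on
    \<open>T = \<infinity>\<close> the value studied is \<open>\<xi> 0\<close>; later uses are
    confined to finite \<open>T\<close>.\<close>
  define \<rho> where "\<rho> x = min s (enn2real (T x))" for x
  \<comment> \<open>For \<open>\<rho> x > 0\<close> this is the largest integer strictly below
    \<open>2^n * \<rho> x\<close>, which puts the observation strictly before \<open>T\<close>. At
    \<open>\<rho> x = 0\<close> it is \<open>nat (-1) = 0\<close>.\<close>
  define k where "k n x = nat (\<lceil>2^n * \<rho> x\<rceil> - 1)" for n :: nat and x
  \<comment> \<open>The default 0 is the value of \<open>\<xi>\<close> at time 0, hence correct when
    \<open>T = 0\<close>.\<close>
  define f where "f n j x = (if ennreal (real j / 2^n) < T x then \<xi> (real j / 2^n) x else 0)" for n j :: nat and x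
  have [measurable]: "\<rho> \<in> borel_measurable P"
    unfolding \<rho>_def using T_measurable_P by measurable
  have f: "f n j \<in> borel_measurable P" for n j
  proof (rule measurableI)
    fix A :: "real set" assume A: "A \<in> sets borel"
    define r where "r = real j / 2^n"
    have r: "0 \<le> r" by (simp add: r_def)
    have "\<xi> r -` A \<inter> space (F\<xi> (ennreal r)) \<in> sets (F\<xi> (ennreal r))"
      by (rule measurable_sets[OF \<xi>_measurable[OF r order_refl] A])
    from in_P[OF this] have 1: "{x \<in> space M. \<xi> r x \<in> A \<and> ennreal r < T x} \<in> sets P"
      by (rule back_subst[of "\<lambda>S. S \<in> sets P"]) auto
    have 2: "{x \<in> space P. \<not> ennreal r < T x} \<in> sets P"
      using T_measurable_P by measurable
    have "f n j -` A \<inter> space P = {x \<in> space M. \<xi> r x \<in> A \<and> ennreal r < T x} \<union>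
        (if 0 \<in> A then {x \<in> space P. \<not> ennreal r < T x} else {})"
      by (auto simp: f_def r_def split: if_splits)
    also have "\<dots> \<in> sets P"
      using sets.Un[OF 1 2] 1 by (cases "0 \<in> A") (simp_all only: if_True if_False Un_empty_right)
    finally show "f n j -` A \<inter> space P \<in> sets P" .
  qed simp
  have k [measurable]: "k n \<in> measurable P (count_space UNIV)" for n
    unfolding k_def by measurable
  show "(\<lambda>x. f n (k n x) x) \<in> borel_measurable P" for n
    by (rule measurable_compose_countable[OF f k])
  fix x assume "x \<in> space P"
  then have x: "x \<in> space M" by simp
  have \<xi>0: "\<xi> 0 x = 0" using last_props(1)[OF x] by (simp add: xi_eq[OF x] X_0[OF x])
  have "0 \<le> \<rho> x" using s by (simp add: \<rho>_def)
  then consider "\<rho> x = 0" | "0 < \<rho> x" by linarith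
  then show "(\<lambda>n. f n (k n x) x) \<longlonglongrightarrow> \<xi> (min s (enn2real (T x))) x"
    unfolding \<rho>_def[symmetric]
  proof cases
    case 1
    then have "f n (k n x) x = 0" for n by (simp add: f_def k_def \<xi>0)
    then show "(\<lambda>n. f n (k n x) x) \<longlonglongrightarrow> \<xi> (\<rho> x) x" using 1 \<xi>0 by simp
  next
    case 2
    define r where "r n = real (k n x) / 2^n" for n
    have bounds: "r n < \<rho> x" "\<rho> x \<le> r n + (1/2)^n" for n
    proof -
      have pos: "0 < 2^n * \<rho> x" using 2 by simp
      then have "real (k n x) = of_int \<lceil>2^n * \<rho> x\<rceil> - 1"
        by (simp add: k_def of_nat_nat)
      moreover have "of_int \<lceil>2^n * \<rho> x\<rceil> - 1 < 2^n * \<rho> x" "2^n * \<rho> x \<le> of_int \<lceil>2^n * \<rho> x\<rceil>"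
        by linarith+
      ultimately show "r n < \<rho> x" "\<rho> x \<le> r n + (1/2)^n"
        by (auto simp: r_def field_simps power_divide)
    qed
    have f_eq: "f n (k n x) x = \<xi> (r n) x" for n
    proof -
      have "r n < enn2real (T x)" using bounds(1)[of n] by (simp add: \<rho>_def)
      then have "ennreal (r n) < T x"
        by (cases "T x") (auto simp: r_def ennreal_less_iff)
      then show ?thesis by (simp add: f_def r_def)
    qed
    have "r \<longlonglongrightarrow> \<rho> x"
    proof (rule tendsto_sandwich[where f = "\<lambda>n. \<rho> x - (1/2)^n" and h = "\<lambda>_. \<rho> x"])
      show "(\<lambda>n. \<rho> x - (1/2)^n) \<longlonglongrightarrow> \<rho> x"
        using tendsto_diff[OF tendsto_const[of "\<rho> x"] LIMSEQ_power_zero[of "1/2::real"]] by simp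
      show "\<forall>\<^sub>F n in sequentially. \<rho> x - (1/2)^n \<le> r n" "\<forall>\<^sub>F n in sequentially. r n \<le> \<rho> x"
        using bounds by (auto intro!: always_eventually less_imp_le simp: diff_le_eq)
    qed simp
    then have "(\<lambda>n. \<xi> (r n) x) \<longlonglongrightarrow> \<xi> (\<rho> x) x"
      by (rule continuous_on_tendsto_compose[OF continuous_xi[OF x]]) (use 2 in \<open>auto simp: r_def\<close>)
    then show "(\<lambda>n. f n (k n x) x) \<longlonglongrightarrow> \<xi> (\<rho> x) x" by (simp only: f_eq)
  qed
qed

text \<open>On the event \<open>E\<close> the capped time is \<open>T\<close> and precedes
  \<open>last\<close>, so the stopped Brownian path is \<open>\<xi>\<close> at
  \<open>min s T\<close> with the drift removed. Since \<open>E\<close> is in \<open>P\<close>, the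
  induction over \<open>K\<close> works with the traces \<open>K \<inter> E\<close>.\<close>

lemma Stopped_before_last_in_P:
  assumes \<tau>: "\<And>x. x \<in> space M \<Longrightarrow> T x < ennreal (last x) \<Longrightarrow> \<tau> x = T x"
    and K: "K \<in> sets (Stopped (trunc N \<tau>))"
  shows "{x \<in> K. T x < ennreal (real N) \<and> T x < ennreal (last x)} \<in> sets P"
proof -
  define E where "E = {x \<in> space M. T x < ennreal (real N) \<and> T x < ennreal (last x)}"
  have "{x \<in> space P. T x < ennreal (real N)} \<in> sets P"
    using T_measurable_P by measurable
  from sets.Int[OF this before_last_in_P] have E: "E \<in> sets P"
    by (rule back_subst[of "\<lambda>S. S \<in> sets P"]) (auto simp: E_def)
  have Eev: "x \<in> space M" "trunc N \<tau> x = enn2real (T x)" "enn2real (T x) < last x" if "x \<in> E" for x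
  proof -
    show x: "x \<in> space M" using that by (simp add: E_def)
    show "trunc N \<tau> x = enn2real (T x)" using that \<tau>[OF x] trunc_eq[of \<tau> x N] by (simp add: E_def)
    show "enn2real (T x) < last x"
      using that by (cases "T x") (auto simp: E_def ennreal_less_iff)
  qed
  have "K \<inter> E \<in> sets P"
    using K unfolding sets_Stopped
  proof (induction rule: sigma_sets.induct)
    case (Basic K)
    then consider A where "K = trunc N \<tau> -` A \<inter> space M" "A \<in> sets borel"
      | s A where "K = (\<lambda>x. B (min s (trunc N \<tau> x)) x) -` A \<inter> space M" "0 \<le> s" "A \<in> sets borel"
      | "K \<in> null_sets M"
      unfolding stopped_gens_def by blast
    then show ?case
    proof cases
      case 1
      have "(\<lambda>x. enn2real (T x)) -` A \<inter> space P \<in> sets P"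
        by (rule measurable_sets[OF borel_measurable_enn2real[OF T_measurable_P] 1(2)])
      from sets.Int[OF this E] show ?thesis
        by (rule back_subst[of "\<lambda>S. S \<in> sets P"]) (use Eev in \<open>auto simp: 1\<close>)
    next
      case 2
      define \<rho> where "\<rho> x = min s (enn2real (T x))" for x
      have \<rho>: "\<rho> \<in> borel_measurable P"
        unfolding \<rho>_def using T_measurable_P by measurable
      have meas: "(\<lambda>x. \<xi> (\<rho> x) x - lam * \<rho> x) \<in> borel_measurable P"
        using \<xi>_at_min_measurable_P[OF 2(2)] \<rho> unfolding \<rho>_def
        by (intro borel_measurable_diff borel_measurable_times borel_measurable_const)
      have eq: "B (min s (trunc N \<tau> x)) x = \<xi> (\<rho> x) x - lam * \<rho> x" if "x \<in> E" for x
      proof -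
        have "\<rho> x < last x" "0 \<le> \<rho> x" using Eev[OF that] 2(2) by (auto simp: \<rho>_def)
        then have "\<xi> (\<rho> x) x = X (\<rho> x) x" using xi_before[OF Eev(1)[OF that]] by simp
        then show ?thesis using Eev(2)[OF that] by (simp add: \<rho>_def drifted_def)
      qed
      from sets.Int[OF measurable_sets[OF meas 2(3)] E] show ?thesis
        by (rule back_subst[of "\<lambda>S. S \<in> sets P"]) (use Eev(1) eq in \<open>auto simp: 2(1)\<close>)
    next
      case 3
      then show ?thesis using null_sets_P by (intro sets.Int[OF _ E]) auto
    qed
  next
    case Empty
    show ?case by (simp only: Int_empty_left sets.empty_sets)
  next
    case (Compl K)
    have "(space M - K) \<inter> E = E - K \<inter> E" by (auto simp: E_def)
    then show ?case using sets.Diff[OF E Compl(2)] by (simp only:)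
  next
    case (Union K)
    have "(\<Union>i. K i) \<inter> E = (\<Union>i. K i \<inter> E)" by blast
    moreover have "(\<Union>i. K i \<inter> E) \<in> sets P"
      by (intro sets.countable_UN image_subsetI Union(2))
    ultimately show ?case by (simp only:)
  qed
  moreover have "K \<subseteq> space M" using sets.sets_into_space[OF K] by simp
  then have "K \<inter> E = {x \<in> K. T x < ennreal (real N) \<and> T x < ennreal (last x)}"
    by (auto simp: E_def)
  ultimately show ?thesis by (simp only:)
qed

text \<open>
  The event \<open>A\<close> of \<open>\<F>\<^bsub>T\<^esub>\<close> is recovered from the stopping time that equals \<open>T\<close> on \<open>A\<close> and \<open>\<infinity>\<close> elsewhere.
\<close>

lemma pre_sigma_before_last_in_P:
  assumes A: "A \<in> sets (filtration.pre_sigma (space M) F\<xi> T)"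
  shows "{x \<in> A. T x < ennreal (last x)} \<in> sets P"
proof -
  interpret filtration "space M" F\<xi> by (rule filtration_completed_natural_filtration)
  have A_sub: "A \<subseteq> space M" using sets.sets_into_space[OF A] by (simp add: space_pre_sigma)
  define TA where "TA x = (if x \<in> A then T x else \<top>)" for x
  have TA: "stopping_time F\<xi> TA"
  proof (rule stopping_timeI)
    fix t
    have "{x \<in> space M. TA x \<le> t} \<in> sets (F\<xi> t)"
    proof (cases "t = \<top>")
      case True
      then have "{x \<in> space M. TA x \<le> t} = space (F\<xi> t)" by simp
      then show ?thesis by (simp only: sets.top)
    next
      case False
      then have "{x \<in> space M. TA x \<le> t} = {x \<in> A. T x \<le> t}"
        using A_sub by (auto simp: TA_def top_unique)
      then show ?thesis using sets_pre_sigmaD[OF stopping_T A, of t] by (simp only:)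
    qed
    then show "Measurable.pred (F\<xi> t) (\<lambda>x. TA x \<le> t)"
      unfolding pred_def space_completed_natural_filtration .
  qed
  obtain \<tau> where \<tau>: "ext_optional \<tau>"
    and \<tau>_eq: "\<And>x. x \<in> space M \<Longrightarrow> T x < ennreal (last x) \<Longrightarrow> \<tau> x = T x"
    by (rule stopping_time_before_last[OF stopping_T]) blast
  obtain \<sigma> where \<sigma>: "ext_optional \<sigma>"
    and \<sigma>_eq: "\<And>x. x \<in> space M \<Longrightarrow> TA x < ennreal (last x) \<Longrightarrow> \<sigma> x = TA x"
    and \<sigma>_ge: "\<And>x. x \<in> space M \<Longrightarrow> ennreal (last x) \<le> TA x \<Longrightarrow> ennreal (last x) \<le> \<sigma> x"
    by (rule stopping_time_before_last[OF TA]) blast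
  define C where "C N = {x \<in> space M. \<sigma> x \<le> \<tau> x \<and> \<tau> x < ennreal (real N)}" for N
  have C: "{x \<in> C N. T x < ennreal (real N) \<and> T x < ennreal (last x)} \<in> sets P" for N
    by (rule Stopped_before_last_in_P[OF \<tau>_eq post_subset_sets_Stopped[OF optional_trunc[OF \<tau>]]])
       (simp_all add: C_def post_trunc_le[OF \<sigma> \<tau>])
  \<comment> \<open>Off \<open>A\<close> the time \<open>TA\<close> is infinite, which keeps
    \<open>\<sigma>\<close> at or above \<open>last\<close>, while \<open>\<tau> = T < last\<close>.
    So comparing \<open>\<sigma>\<close> with \<open>\<tau>\<close> decides
    \<open>A\<close>.\<close>
  have iff: "x \<in> A \<longleftrightarrow> \<sigma> x \<le> \<tau> x" if "x \<in> space M" "T x < ennreal (last x)" for x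
  proof
    assume "x \<in> A"
    then show "\<sigma> x \<le> \<tau> x" using \<sigma>_eq[OF that(1)] \<tau>_eq[OF that] that by (simp add: TA_def)
  next
    assume le: "\<sigma> x \<le> \<tau> x"
    show "x \<in> A"
    proof (rule ccontr)
      assume "x \<notin> A"
      then have "ennreal (last x) \<le> \<sigma> x" by (intro \<sigma>_ge that) (simp add: TA_def)
      also have "\<dots> \<le> T x" using le \<tau>_eq[OF that] by simp
      finally show False using that(2) by simp
    qed
  qed
  have "{x \<in> A. T x < ennreal (last x)} =
      (\<Union>N. {x \<in> C N. T x < ennreal (real N) \<and> T x < ennreal (last x)})"
  proof safe
    fix x assume x: "x \<in> A" "T x < ennreal (last x)"
    then have xM: "x \<in> space M" using A_sub by blast
    obtain N :: nat where "last x < real N" using reals_Archimedean2 by blast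
    then have "ennreal (last x) \<le> ennreal (real N)" by (intro ennreal_leI) simp
    then have "T x < ennreal (real N)" using x(2) by (rule less_le_trans[rotated])
    then show "x \<in> (\<Union>N. {x \<in> C N. T x < ennreal (real N) \<and> T x < ennreal (last x)})"
      using x xM iff[OF xM x(2)] \<tau>_eq[OF xM x(2)] by (auto simp: C_def)
  next
    fix x N assume "x \<in> C N" "T x < ennreal (last x)"
    then show "x \<in> A" using iff by (simp add: C_def)
  qed
  also have "\<dots> \<in> sets P" by (intro sets.countable_UN image_subsetI C)
  finally show ?thesis .
qed

text \<open>Up to the null event \<open>T = last\<close>, the set splits into a part after
  \<open>last\<close> and a part before it. Finiteness of \<open>T\<close> is imposed on the former
  and holds by itself on the latter.\<close>

lemma pre_sigma_finite_in_P:
  assumes A: "A \<in> sets (filtration.pre_sigma (space M) F\<xi> T)"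
  shows "{x \<in> A. T x < \<infinity>} \<in> sets P"
proof (rule sets_AE_cong[OF null_sets_P space_P])
  interpret filtration "space M" F\<xi> by (rule filtration_completed_natural_filtration)
  have A_sub: "A \<subseteq> space M" using sets.sets_into_space[OF A] by (simp add: space_pre_sigma)
  have "A \<in> sets (F\<xi> \<top>)" using sets_pre_sigmaD[OF stopping_T A, of \<top>] by simp
  then have 1: "{x \<in> A. ennreal (last x) < T x} \<in> sets P" by (rule after_last_in_P)
  have 2: "{x \<in> space P. T x < \<infinity>} \<in> sets P" using T_measurable_P by measurable
  show "({x \<in> A. ennreal (last x) < T x} \<inter> {x \<in> space P. T x < \<infinity>}) \<union> {x \<in> A. T x < ennreal (last x)} \<in> sets P"
    by (intro sets.Un sets.Int 1 2 pre_sigma_before_last_in_P[OF A])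
  show "{x \<in> A. T x < \<infinity>} \<subseteq> space M" using A_sub by blast
  show "AE x in M. x \<in> ({x \<in> A. ennreal (last x) < T x} \<inter> {x \<in> space P. T x < \<infinity>}) \<union> {x \<in> A. T x < ennreal (last x)} \<longleftrightarrow>
      x \<in> {x \<in> A. T x < \<infinity>}"
    using predictable_time_neq_last[OF T] AE_space
  proof eventually_elim
    case (elim x)
    have "T x < ennreal (last x) \<Longrightarrow> T x < \<infinity>"
      using ennreal_less_top[of "last x"] by (auto intro: less_trans)
    then show ?case using elim by (auto simp: neq_iff)
  qed
qed

end

lemma quasi_left_continuous_F\<xi>: "quasi_left_continuous M F\<xi>"
  unfolding quasi_left_continuous_def
proof (intro conjI allI impI)
  show filt: "filtration (space M) F\<xi>" by (rule filtration_completed_natural_filtration)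
  interpret filtration "space M" F\<xi> by fact
  fix T assume T: "predictable_time M F\<xi> T"
  define \<Omega> where "\<Omega> = {x \<in> space M. T x < \<infinity>}"
  let ?P = "strict_pre_sigma (space M) F\<xi> T"
  have sub: "sets ?P \<subseteq> sets (pre_sigma T)"
    using T by (intro sets_strict_pre_sigma_subset_pre_sigma[OF filt]) (simp add: predictable_time_def)
  have "\<Omega> \<inter> A \<in> (\<inter>) \<Omega> ` sets ?P" if A: "A \<in> sets (pre_sigma T)" for A
  proof (rule image_eqI)
    have "A \<subseteq> space M" using sets.sets_into_space[OF A] by (simp add: space_pre_sigma)
    then show "\<Omega> \<inter> A = \<Omega> \<inter> {x \<in> A. T x < \<infinity>}" by (auto simp: \<Omega>_def)
    show "{x \<in> A. T x < \<infinity>} \<in> sets ?P" by (rule pre_sigma_finite_in_P[OF T A])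
  qed
  then have "(\<inter>) \<Omega> ` sets ?P = (\<inter>) \<Omega> ` sets (pre_sigma T)"
    using sub by blast
  then show "sets (restrict_space ?P {x \<in> space M. T x < \<infinity>}) =
      sets (restrict_space (pre_sigma T) {x \<in> space M. T x < \<infinity>})"
    by (simp add: sets_restrict_space \<Omega>_def)
qed

end

section \<open>Removing the exceptional null sets\<close>

lemma xi_cong:
  assumes "\<forall>t\<ge>0. B t x = B' t x" "0 \<le> t"
  shows "xi B lam z t x = xi B' lam z t x"
proof -
  have "drifted B lam s x = drifted B' lam s x" if "0 \<le> s" for s
    using assms that by (simp add: drifted_def)
  moreover from this have "last_passage (drifted B lam) z x = last_passage (drifted B' lam) z x"
    unfolding last_passage_def by (intro SUP_cong) auto
  ultimately show ?thesis
    by (simp add: xi_def stopped_at_def)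
qed

text \<open>The zero path is a safe replacement off \<open>A\<close>: it is continuous, starts at 0,
  and with positive drift added it tends to infinity.\<close>

lemma brownian_motion_AE_restrict:
  assumes bm: "brownian_motion M B" and ae: "AE x in M. Q x"
  obtains A where "A \<in> sets M" "\<And>x. x \<in> A \<Longrightarrow> Q x" "AE x in M. x \<in> A"
    "brownian_motion M (\<lambda>t x. if x \<in> A then B t x else 0)"
proof -
  from ae obtain N where N: "N \<in> null_sets M" "{x \<in> space M. \<not> Q x} \<subseteq> N"
    by (auto elim!: AE_E intro: null_setsI)
  define A where "A = space M - N"
  have A: "A \<in> sets M" using N(1) by (auto simp: A_def)
  have AE_A: "AE x in M. x \<in> A"
    using AE_not_in[OF N(1)] AE_space by eventually_elim (simp add: A_def)
  have "brownian_motion M (\<lambda>t x. if x \<in> A then B t x else 0)"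
  proof (rule brownian_motion_cong_AE[OF bm])
    fix t :: real assume "0 \<le> t"
    then have "B t \<in> borel_measurable M" using bm by (simp add: brownian_motion_def)
    then show "(\<lambda>x. if x \<in> A then B t x else 0) \<in> borel_measurable M"
      using A by (intro measurable_If_set) (auto intro: sets.Int)
  next
    show "AE x in M. \<forall>t\<ge>0. (if x \<in> A then B t x else 0) = B t x"
      using AE_A by eventually_elim simp
  qed
  moreover have "Q x" if "x \<in> A" for x using that N(2) by (auto simp: A_def)
  ultimately show thesis using that A AE_A by blast
qed

theorem theorem5p1:
  fixes M :: "'a measure" and B :: "real \<Rightarrow> 'a \<Rightarrow> real" and lam z :: real
  assumes "complete_measure M"
    and "brownian_motion M B"
    and "lam > 0" and "z > 0"
  shows "quasi_left_continuous M (completed_natural_filtration M (xi B lam z))"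
proof -
  interpret complete_measure M by fact
  interpret prob_space M using assms(2) by (simp add: brownian_motion_def)
  have "AE x in M. B 0 x = 0 \<and> continuous_on {0..} (\<lambda>t. B t x)"
    using assms(2) by (simp add: brownian_motion_def)
  then obtain A1 where A1: "\<And>x. x \<in> A1 \<Longrightarrow> B 0 x = 0 \<and> continuous_on {0..} (\<lambda>t. B t x)"
    and ae1: "AE x in M. x \<in> A1" and bm1: "brownian_motion M (\<lambda>t x. if x \<in> A1 then B t x else 0)"
    by (rule brownian_motion_AE_restrict[OF assms(2)]) blast
  define B1 where "B1 t x = (if x \<in> A1 then B t x else 0)" for t x
  have B1: "B1 0 x = 0" "continuous_on {0..} (\<lambda>t. B1 t x)" for x
    using A1 by (cases "x \<in> A1"; simp add: B1_def)+
  have bmB1: "brownian_motion M B1" using bm1 by (simp add: B1_def[abs_def])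
  interpret B1: continuous_brownian M B1
    by unfold_locales (use B1 bmB1 in auto)
  \<comment> \<open>A second correction, because convergence to infinity is proved for a motion
    whose paths are already continuous everywhere.\<close>
  obtain A2 where A2: "\<And>x. x \<in> A2 \<Longrightarrow> filterlim (\<lambda>t. B1 t x + lam * t) at_top at_top"
    and ae2: "AE x in M. x \<in> A2" and bm2: "brownian_motion M (\<lambda>t x. if x \<in> A2 then B1 t x else 0)"
    by (rule brownian_motion_AE_restrict[OF bmB1 B1.AE_drift_at_top[OF assms(3)]]) blast
  define B2 where "B2 t x = (if x \<in> A2 then B1 t x else 0)" for t x
  have drift0: "filterlim (\<lambda>t. lam * t) at_top at_top"
    using assms(3) by (intro filterlim_tendsto_pos_mult_at_top[OF tendsto_const] filterlim_ident)
  have B2: "B2 0 x = 0" "continuous_on {0..} (\<lambda>t. B2 t x)"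
      "filterlim (\<lambda>t. B2 t x + lam * t) at_top at_top" for x
    using A2 B1 drift0 by (cases "x \<in> A2"; simp add: B2_def)+
  have bmB2: "brownian_motion M B2" using bm2 by (simp add: B2_def[abs_def])
  interpret B2: drifted_brownian M B2 lam z
    by unfold_locales (use B2 bmB2 assms(3,4) in auto)
  have "AE x in M. \<forall>t\<ge>0. xi B lam z t x = xi B2 lam z t x"
    using ae1 ae2 by eventually_elim (auto intro!: xi_cong simp: B1_def B2_def)
  from completed_natural_filtration_cong_AE[OF this] show ?thesis
    using B2.quasi_left_continuous_F\<xi> by simp
qed

end
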